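(* For every constant $0<\varepsilon<1$ there are constants (implicit in the $\Omega(\cdot)$ and $\Theta(\cdot)$ below, depending only on $\varepsilon$) such that for every sufficiently large $n$ there is an instance of \textsc{Directed Steiner Network} on $n$ vertices for which, with $r=n^{\Omega(\varepsilon)}$, the integrality gap of the $r$-th level Lasserre SDP $\text{SDP}_{DSN}$ (defined in the context) is at least $n^{\frac{1}{16}-\Theta(\varepsilon)}$.
   Context: \textsc{Directed Steiner Network}: given a directed graph $G=(V,E)$ and demand pairs $(s_1,t_1),\dots,(s_p,t_p)$, find $S\subseteq E$ of minimum size such that for every $i\in[p]$ the graph $(V,S)$ contains a path from $s_i$ to $t_i$. For $u,v\in V$ let $\mathcal P_{u,v}$ be the set of all $u$-to-$v$ paths in $G$, and $\mathcal Z^{u,v}=\{\mathbf z\in[0,1]^{E}:\sum_{e\in P}z_e\ge1\ \forall P\in\mathcal P_{u,v}\}$. The $r$-th level Lasserre SDP $\text{SDP}_{DSN}$ has a variable $y_I\in[0,1]$ for each $I\subseteq E$ and is: minimize $\sum_{e\in E}y_{\{e\}}$ subject to $y_\varnothing=1$; $M_{r+1}(y)=(y_{I\cup J})_{|I|,|J|\le r+1}\succeq 0$; and for every $i\in[p]$ and every $\mathbf z\in\mathcal Z^{s_i,t_i}$, $M^{\mathbf z}_r(y)=\left(\sum_{e\in E}z_e y_{I\cup J\cup\{e\}}-y_{I\cup J}\right)_{|I|,|J|\le r}\succeq 0$. The integrality gap on an instance is the ratio of the minimum size of a feasible $S$ to the optimal SDP value. *)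

theory Defs
  imports Complex_Main
begin

type_synonym vertex = nat
type_synonym edge = "nat \<times> nat"

text \<open>A simple directed path from u to v in the edge set E, given as a list of distinct vertices.\<close>
definition is_path :: "edge set \<Rightarrow> vertex \<Rightarrow> vertex \<Rightarrow> vertex list \<Rightarrow> bool" where
  "is_path E u v xs \<longleftrightarrow> xs \<noteq> [] \<and> hd xs = u \<and> last xs = v \<and> distinct xs \<and>
     (\<forall>i. Suc i < length xs \<longrightarrow> (xs ! i, xs ! Suc i) \<in> E)"

definition path_edges :: "vertex list \<Rightarrow> edge set" where
  "path_edges xs = set (zip xs (tl xs))"

text \<open>The set Z^{u,v}: vectors in [0,1]^E hitting every u-to-v path with weight at least 1.\<close>
definition cut_vectors :: "edge set \<Rightarrow> vertex \<Rightarrow> vertex \<Rightarrow> (edge \<Rightarrow> real) set" where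
  "cut_vectors E u v = {z. (\<forall>e\<in>E. 0 \<le> z e \<and> z e \<le> 1) \<and>
      (\<forall>xs. is_path E u v xs \<longrightarrow> (\<Sum>e\<in>path_edges xs. z e) \<ge> 1)}"

text \<open>Positive semidefiniteness of a (symmetric) real matrix indexed by a finite set A.\<close>
definition psd_on :: "'i set \<Rightarrow> ('i \<Rightarrow> 'i \<Rightarrow> real) \<Rightarrow> bool" where
  "psd_on A M \<longleftrightarrow> (\<forall>x :: 'i \<Rightarrow> real. 0 \<le> (\<Sum>i\<in>A. \<Sum>j\<in>A. x i * M i j * x j))"

text \<open>Index set of moment matrices: subsets of E of size at most k.\<close>
definition small_subsets :: "edge set \<Rightarrow> nat \<Rightarrow> edge set set" where
  "small_subsets E k = {I. I \<subseteq> E \<and> card I \<le> k}"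

text \<open>Feasibility for the r-th level Lasserre SDP_DSN.\<close>
definition sdp_dsn_feasible :: "edge set \<Rightarrow> (vertex \<times> vertex) list \<Rightarrow> nat \<Rightarrow> (edge set \<Rightarrow> real) \<Rightarrow> bool" where
  "sdp_dsn_feasible E ds r y \<longleftrightarrow>
     (\<forall>I. I \<subseteq> E \<longrightarrow> 0 \<le> y I \<and> y I \<le> 1) \<and>
     y {} = 1 \<and>
     psd_on (small_subsets E (r + 1)) (\<lambda>I J. y (I \<union> J)) \<and>
     (\<forall>(s, t) \<in> set ds. \<forall>z \<in> cut_vectors E s t.
        psd_on (small_subsets E r) (\<lambda>I J. (\<Sum>e\<in>E. z e * y (I \<union> J \<union> {e})) - y (I \<union> J)))"

definition sdp_dsn_value :: "edge set \<Rightarrow> (vertex \<times> vertex) list \<Rightarrow> nat \<Rightarrow> real" where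
  "sdp_dsn_value E ds r = Inf ((\<lambda>y. \<Sum>e\<in>E. y {e}) ` {y. sdp_dsn_feasible E ds r y})"

definition dsn_solution :: "edge set \<Rightarrow> (vertex \<times> vertex) list \<Rightarrow> edge set \<Rightarrow> bool" where
  "dsn_solution E ds S \<longleftrightarrow> S \<subseteq> E \<and> (\<forall>(s, t) \<in> set ds. (s, t) \<in> S\<^sup>*)"

definition dsn_feasible :: "edge set \<Rightarrow> (vertex \<times> vertex) list \<Rightarrow> bool" where
  "dsn_feasible E ds \<longleftrightarrow> (\<exists>S. dsn_solution E ds S)"

definition dsn_opt :: "edge set \<Rightarrow> (vertex \<times> vertex) list \<Rightarrow> nat" where
  "dsn_opt E ds = Min (card ` {S. dsn_solution E ds S})"

definition integrality_gap :: "edge set \<Rightarrow> (vertex \<times> vertex) list \<Rightarrow> nat \<Rightarrow> real" where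
  "integrality_gap E ds r = real (dsn_opt E ds) / sdp_dsn_value E ds r"

text \<open>An instance on n vertices: vertex set {0..<n}, edges and demand pairs inside it.\<close>
definition dsn_instance :: "nat \<Rightarrow> edge set \<Rightarrow> (vertex \<times> vertex) list \<Rightarrow> bool" where
  "dsn_instance n E ds \<longleftrightarrow> E \<subseteq> {..<n} \<times> {..<n} \<and> set ds \<subseteq> {..<n} \<times> {..<n}"

end

theory Submission
  imports Defs "HOL-Library.Z2" "HOL-Library.Function_Algebras" "HOL-Library.FuncSet"
begin

text \<open>
  The instance is a label cover instance built from a random linear constraint system over \<open>GF(2)\<close>.
  Each of \<open>m\<close> constraints forces the values of \<open>k\<close> random variables (with values in \<open>GF(2)\<^sup>t\<close>) into a random
  shift of a fixed pairwise independent linear code, and a demand from a constraint to one of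
  its variables can only be routed through a codeword and the value it gives to the variable. An
  assignment satisfying all constraints would solve all demands at cost \<open>3mk\<close>.

  No such assignment exists, but the Lasserre hierarchy does not notice: the constraint hypergraph
  expands, so every linear combination of few constraints involves many variables, hence the
  system has no refutation of small width and one can work with the signed density
  \<open>\<Sum>\<^sub>z \<plusminus> \<chi>\<^sub>z(x)\<close>, the sum over the combinations \<open>z\<close> of few constraints. It is positive
  semidefinite on functions of small width because, on small-width characters, being related by a
  combination of few constraints is an equivalence relation.

  In an integral solution with few labels per variable, a random constraint has no codeword that
  agrees with the chosen labels in as many as \<open>t\<close> positions, so it must buy about \<open>k / t\<close> codewords; a
  union bound over all choices of labels gives the gap. All parameters are powers of \<open>2\<^sup>u\<close>: the gap is
  about \<open>2^(100 u)\<close> on at most \<open>2^(1480 u)\<close> vertices after \<open>2^u\<close> rounds, which beats the exponent \<open>1/16\<close>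
  without any loss depending on \<open>\<epsilon>\<close>.
\<close>

section \<open>Fourier analysis over \<open>GF(2)\<close>\<close>

text \<open>The exponents come from one balance; let q be the intended gap. In a combination every
  constraint touches at least three variables, and a variable cancels only if touched twice, so
  expansion has to rule out nearly 3/2 repeated incidences per constraint. Random incidences achieve
  this once \<open>N ^ (3/2)\<close> exceeds about \<open>m * k ^ (3/2)\<close>. An integral cost of
  q per demand needs \<open>k\<close> about q. Ruling out codewords that meet a label set of average
  size q per variable needs \<open>2 ^ t\<close> above \<open>g * k\<close>, about q^2, so
  \<open>card C0\<close> is about q^5. The union bound over label sets needs \<open>W\<close> about
  q^2. With \<open>m = N * W\<close> the expansion condition then gives \<open>N\<close> about q^7,
  \<open>m\<close> about q^9, and the dominant vertex class, one vertex per constraint and codeword,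
  about q^14. The ideal exponent 1/14 exceeds 1/16, and the difference pays for using the ratio
  47/32 in place of 3/2, for the factors \<open>2 ^ u\<close>, and for rounding
  \<open>n\<close>.\<close>

declare add_bit_eq_xor [simp del] mult_bit_eq_and [simp del]

lemma bit_add_self: "(a::bit) + a = 0"
  by (cases a) simp_all

lemma bit_add_eq_0_iff: "(a::bit) + b = 0 \<longleftrightarrow> a = b"
  by (cases a; cases b) simp_all

definition sg :: "bit \<Rightarrow> real" where
  "sg b = (if b = 0 then 1 else -1)"

lemma sg_0 [simp]: "sg 0 = 1" and sg_1 [simp]: "sg 1 = -1"
  by (simp_all add: sg_def)

lemma sg_add: "sg (a + b) = sg a * sg b"
  by (cases a; cases b) simp_all

lemma sg_nonzero [simp]: "sg a \<noteq> 0"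
  by (cases a) simp_all

definition vecs :: "'p set \<Rightarrow> ('p \<Rightarrow> bit) set" where
  "vecs P = {x. \<forall>p. p \<notin> P \<longrightarrow> x p = 0}"

definition dot :: "'p set \<Rightarrow> ('p \<Rightarrow> bit) \<Rightarrow> ('p \<Rightarrow> bit) \<Rightarrow> bit" where
  "dot P x y = (\<Sum>p\<in>P. x p * y p)"

definition chi :: "'p set \<Rightarrow> ('p \<Rightarrow> bit) \<Rightarrow> ('p \<Rightarrow> bit) \<Rightarrow> real" where
  "chi P x y = sg (dot P x y)"

lemma vec_add_self: "(x :: 'p \<Rightarrow> bit) + x = 0"
  by (rule ext) (simp add: bit_add_self)

lemma vec_add_cancel: "(x :: 'p \<Rightarrow> bit) + (x + y) = y"
  by (simp add: add.assoc [symmetric] vec_add_self)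

lemma vec_add_eq_0_iff: "(x :: 'p \<Rightarrow> bit) + y = 0 \<longleftrightarrow> x = y"
  by (simp add: fun_eq_iff bit_add_eq_0_iff)

lemma zero_in_vecs [simp]: "0 \<in> vecs P"
  by (simp add: vecs_def)

lemma vecs_add: "x \<in> vecs P \<Longrightarrow> y \<in> vecs P \<Longrightarrow> x + y \<in> vecs P"
  by (simp add: vecs_def)

lemma vecs_mono: "P \<subseteq> P' \<Longrightarrow> vecs P \<subseteq> vecs P'"
  by (auto simp: vecs_def)

lemma bij_betw_vecs:
  "bij_betw (\<lambda>A p. if p \<in> A then 1 else 0) (Pow P) (vecs P)"
proof (rule bij_betw_byWitness[where f' = "\<lambda>x. {p \<in> P. x p = 1}"])
  show "\<forall>a'\<in>vecs P. (\<lambda>p. if p \<in> {p \<in> P. a' p = 1} then 1 else 0) = a'"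
    by (auto simp: vecs_def fun_eq_iff)
qed (auto simp: vecs_def)

lemma finite_vecs [simp]: "finite P \<Longrightarrow> finite (vecs P)"
  using bij_betw_vecs[of P] by (metis bij_betw_finite finite_Pow_iff)

lemma card_vecs: "finite P \<Longrightarrow> card (vecs P) = 2 ^ card P"
  using bij_betw_same_card[OF bij_betw_vecs[of P]] by (simp add: card_Pow)

lemma dot_commute: "dot P x y = dot P y x"
  by (simp add: dot_def mult.commute)

lemma dot_add_left: "dot P (x + x') y = dot P x y + dot P x' y"
  by (simp add: dot_def distrib_right sum.distrib)

lemma dot_add_right: "dot P x (y + y') = dot P x y + dot P x y'"
  by (simp add: dot_def distrib_left sum.distrib)

lemma dot_0_left [simp]: "dot P 0 y = 0" and dot_0_right [simp]: "dot P x 0 = 0"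
  by (simp_all add: dot_def)

lemma chi_commute: "chi P x y = chi P y x"
  by (simp add: chi_def dot_commute)

lemma chi_add_left: "chi P (x + x') y = chi P x y * chi P x' y"
  by (simp add: chi_def dot_add_left sg_add)

lemma chi_add_right: "chi P x (y + y') = chi P x y * chi P x y'"
  by (simp add: chi_def dot_add_right sg_add)

lemma chi_0_left [simp]: "chi P 0 y = 1" and chi_0_right [simp]: "chi P x 0 = 1"
  by (simp_all add: chi_def)

lemma dot_superset:
  assumes "finite P'" "P \<subseteq> P'" "x \<in> vecs P"
  shows "dot P' x y = dot P x y"
  unfolding dot_def using assms
  by (intro sum.mono_neutral_right) (auto simp: vecs_def)

lemma chi_superset:
  assumes "finite P'" "P \<subseteq> P'" "x \<in> vecs P"
  shows "chi P' x y = chi P x y"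
  using dot_superset[OF assms] by (simp add: chi_def)

text \<open>Translation by an element where the character is -1 permutes \<open>H\<close> and
  negates the sum.\<close>

lemma sum_chi_subgroup:
  assumes fin: "finite H" and add: "\<And>x y. x \<in> H \<Longrightarrow> y \<in> H \<Longrightarrow> x + y \<in> H"
  shows "(\<Sum>x\<in>H. chi P z x) = (if \<forall>x\<in>H. dot P z x = 0 then real (card H) else 0)"
proof (cases "\<forall>x\<in>H. dot P z x = 0")
  case True
  then show ?thesis by (simp add: chi_def)
next
  case False
  then obtain a where a: "a \<in> H" "dot P z a \<noteq> 0" by auto
  then have neg: "chi P z a = -1" by (simp add: chi_def sg_def)
  have "bij_betw (\<lambda>x. a + x) H H"
    by (rule bij_betw_byWitness[where f' = "\<lambda>x. a + x"])
      (use a add in \<open>auto simp: vec_add_cancel\<close>)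
  then have "(\<Sum>x\<in>H. chi P z (a + x)) = (\<Sum>x\<in>H. chi P z x)"
    by (rule sum.reindex_bij_betw)
  then have "(\<Sum>x\<in>H. chi P z x) = 0"
    by (simp add: chi_add_right neg sum_negf)
  then show ?thesis using False by auto
qed

lemma dot_unit:
  assumes "finite P" "p \<in> P"
  shows "dot P z (\<lambda>p'. if p' = p then 1 else 0) = z p"
  using assms by (simp add: dot_def if_distrib cong: if_cong)

lemma sum_chi_vecs:
  assumes fin: "finite P" and z: "z \<in> vecs P"
  shows "(\<Sum>x\<in>vecs P. chi P z x) = (if z = 0 then 2 ^ card P else 0)"
proof -
  have "(\<forall>x\<in>vecs P. dot P z x = 0) \<longleftrightarrow> z = 0"
  proof
    assume *: "\<forall>x\<in>vecs P. dot P z x = 0"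
    show "z = 0"
    proof
      fix p
      show "z p = 0 p"
      proof (cases "p \<in> P")
        case True
        then have "(\<lambda>p'. if p' = p then 1 else 0) \<in> vecs P" by (auto simp: vecs_def)
        with * dot_unit[OF fin True, of z] show ?thesis by simp
      qed (use z in \<open>simp add: vecs_def\<close>)
    qed
  qed simp
  then show ?thesis
    using sum_chi_subgroup[of "vecs P" P z] fin by (simp add: vecs_add card_vecs)
qed

text \<open>Fourier expansion of a subcube indicator. It writes events as combinations of characters
  supported on \<open>P\<close>, which is how events obtain a width.\<close>

lemma indicator_eq_sum_chi:
  assumes fin: "finite P"
  shows "(if \<forall>p\<in>P. x p = v p then 1 else 0 :: real)
    = (\<Sum>\<alpha>\<in>vecs P. chi P \<alpha> v / 2 ^ card P * chi P \<alpha> x)"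
proof -
  define d where "d = (\<lambda>p. if p \<in> P then x p + v p else 0)"
  have d: "d \<in> vecs P" by (simp add: d_def vecs_def)
  have "chi P \<alpha> v * chi P \<alpha> x = chi P d \<alpha>" for \<alpha>
  proof -
    have "dot P d \<alpha> = dot P (x + v) \<alpha>"
      unfolding dot_def by (rule sum.cong) (auto simp: d_def)
    then show ?thesis
      by (simp add: chi_def dot_add_right sg_add dot_commute[of P _ \<alpha>] mult.commute)
  qed
  then have "(\<Sum>\<alpha>\<in>vecs P. chi P \<alpha> v / 2 ^ card P * chi P \<alpha> x)
      = (\<Sum>\<alpha>\<in>vecs P. chi P d \<alpha>) / 2 ^ card P"
    by (simp add: sum_divide_distrib)
  also have "\<dots> = (if d = 0 then 1 else 0)"
    by (simp add: sum_chi_vecs[OF fin d])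
  also have "d = 0 \<longleftrightarrow> (\<forall>p\<in>P. x p = v p)"
    by (auto simp: d_def fun_eq_iff bit_add_eq_0_iff)
  finally show ?thesis by simp
qed

text \<open>The Fourier transform of the indicator of a subgroup is supported on its annihilator,
  so a vector orthogonal to the annihilator has the same indicator value as \<open>0\<close>.\<close>

lemma double_annihilator:
  assumes fin: "finite P" and H: "H \<subseteq> vecs P" "0 \<in> H"
    and add: "\<And>x y. x \<in> H \<Longrightarrow> y \<in> H \<Longrightarrow> x + y \<in> H"
    and v: "v \<in> vecs P"
    and ann: "\<And>z. z \<in> vecs P \<Longrightarrow> \<forall>a\<in>H. dot P z a = 0 \<Longrightarrow> dot P z v = 0"
  shows "v \<in> H"
proof (rule ccontr)
  assume "v \<notin> H"
  have finH: "finite H" using fin H(1) by (meson finite_vecs finite_subset)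
  have "(\<Sum>z\<in>vecs P. (\<Sum>a\<in>H. chi P z a) * chi P z v)
      = (\<Sum>z\<in>vecs P. \<Sum>a\<in>H. chi P (a + v) z)"
    by (intro sum.cong) (simp_all add: sum_distrib_right chi_add_right chi_commute[of P "_ + _"])
  also have "\<dots> = (\<Sum>a\<in>H. \<Sum>z\<in>vecs P. chi P (a + v) z)"
    by (rule sum.swap)
  also have "\<dots> = (\<Sum>a\<in>H. 0)"
  proof (rule sum.cong)
    fix a assume a: "a \<in> H"
    then have "a + v \<noteq> 0" using \<open>v \<notin> H\<close> by (auto simp: vec_add_eq_0_iff)
    moreover have "a + v \<in> vecs P" using a H v by (auto intro: vecs_add)
    ultimately show "(\<Sum>z\<in>vecs P. chi P (a + v) z) = 0"
      by (simp add: sum_chi_vecs[OF fin])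
  qed simp
  finally have zero: "(\<Sum>z\<in>vecs P. (\<Sum>a\<in>H. chi P z a) * chi P z v) = 0" by simp
  have nonneg: "0 \<le> (\<Sum>a\<in>H. chi P z a) * chi P z v" if "z \<in> vecs P" for z
  proof (cases "\<forall>a\<in>H. dot P z a = 0")
    case True
    then have "chi P z v = 1" using ann[OF that] by (simp add: chi_def)
    then show ?thesis by (simp add: sum_chi_subgroup[OF finH add])
  next
    case False
    then have "(\<Sum>a\<in>H. chi P z a) = 0" by (simp only: sum_chi_subgroup[OF finH add] if_False)
    then show ?thesis by simp
  qed
  \<comment> \<open>The term of \<open>z = 0\<close> alone is \<open>card H\<close>, which is
    positive, while the nonnegative terms sum to 0.\<close>
  have "(\<Sum>a\<in>H. chi P 0 a) * chi P 0 v \<le> (\<Sum>z\<in>vecs P. (\<Sum>a\<in>H. chi P z a) * chi P z v)"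
    by (rule member_le_sum[where i = "0"]) (use nonneg fin in auto)
  moreover have "card H > 0" using finH H(2) by (auto simp: card_gt_0_iff)
  ultimately show False using zero by simp
qed

section \<open>Pseudo-expectations for linear systems without small-width refutations\<close>

text \<open>A kernel that vanishes between different classes and is multiplicative inside each class
  is an average over representatives of rank-one kernels.\<close>

lemma class_kernel_psd:
  fixes G :: "'i \<Rightarrow> 'i \<Rightarrow> real" and c :: "'i \<Rightarrow> real"
  assumes fin: "finite A"
    and diag: "\<And>a. a \<in> A \<Longrightarrow> G a a = 1"
    and sym: "\<And>a b. a \<in> A \<Longrightarrow> b \<in> A \<Longrightarrow> G a b = G b a"
    and mult: "\<And>a b d. a \<in> A \<Longrightarrow> b \<in> A \<Longrightarrow> d \<in> A \<Longrightarrow> G a b \<noteq> 0 \<Longrightarrow> G a d = G a b * G b d"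
  shows "0 \<le> (\<Sum>a\<in>A. \<Sum>b\<in>A. c a * c b * G a b)"
proof -
  \<comment> \<open>\<open>n a\<close> is the size of the class of \<open>a\<close>. Averaging over
    all members \<open>d\<close> of the class replaces the choice of one representative.\<close>
  define n where "n a = card {d\<in>A. G a d \<noteq> 0}" for a
  have npos: "n a > 0" if "a \<in> A" for a
    using that diag[OF that] fin by (auto simp: n_def card_gt_0_iff)
  have n_eq: "n a = n b" if "a \<in> A" "b \<in> A" "G a b \<noteq> 0" for a b
    using mult[OF that(1,2) _ that(3)] that(3) unfolding n_def
    by (intro arg_cong[where f = card]) auto
  have "c a * c b * G a b = (\<Sum>d\<in>A. (c a * G a d) * (c b * G b d) / n d)"
    if a: "a \<in> A" and b: "b \<in> A" for a b
  proof -
    have "(\<Sum>d\<in>A. (c a * G a d) * (c b * G b d) / n d)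
        = (\<Sum>d\<in>{d\<in>A. G a d \<noteq> 0}. c a * c b * G a b / n a)"
    proof (rule sum.mono_neutral_cong_right)
      fix d assume "d \<in> {d\<in>A. G a d \<noteq> 0}"
      then have d: "d \<in> A" "G a d \<noteq> 0" by auto
      have "G a b = G a d * G b d" using mult[OF a d(1) b d(2)] sym[OF b d(1)] by simp
      then show "(c a * G a d) * (c b * G b d) / n d = c a * c b * G a b / n a"
        using n_eq[OF a d] by simp
    qed (use fin in auto)
    also have "\<dots> = c a * c b * G a b"
      using npos[OF a] by (simp add: n_def[symmetric])
    finally show ?thesis by simp
  qed
  then have "(\<Sum>a\<in>A. \<Sum>b\<in>A. c a * c b * G a b)
      = (\<Sum>a\<in>A. \<Sum>b\<in>A. \<Sum>d\<in>A. (c a * G a d) * (c b * G b d) / n d)"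
    by simp
  also have "\<dots> = (\<Sum>a\<in>A. \<Sum>d\<in>A. \<Sum>b\<in>A. (c a * G a d) * (c b * G b d) / n d)"
    by (rule sum.cong[OF refl]) (rule sum.swap)
  also have "\<dots> = (\<Sum>d\<in>A. \<Sum>a\<in>A. \<Sum>b\<in>A. (c a * G a d) * (c b * G b d) / n d)"
    by (rule sum.swap)
  also have "\<dots> = (\<Sum>d\<in>A. (\<Sum>a\<in>A. c a * G a d) ^ 2 / n d)"
    by (simp add: power2_eq_square sum_product sum_divide_distrib)
  also have "\<dots> \<ge> 0" by (intro sum_nonneg) simp
  finally show ?thesis .
qed

text \<open>The set \<open>Z\<close> consists of the linear combinations of the equations of a linear system over
  \<open>GF(2)\<close>; a combination \<open>z\<close> has left-hand side \<open>bd z\<close> and right-hand side sign \<open>v z\<close>, and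
  \<open>cov w \<alpha>\<close> says that the functional \<open>\<alpha>\<close> has width at most \<open>w\<close>. The assumption
  \<open>expanding\<close> rules out refutations of small width.\<close>

locale linear_system =
  fixes P :: "'p set" and Z :: "'z::ab_group_add set" and bd :: "'z \<Rightarrow> 'p \<Rightarrow> bit"
    and v :: "'z \<Rightarrow> real" and size :: "'z \<Rightarrow> nat" and cov :: "nat \<Rightarrow> ('p \<Rightarrow> bit) \<Rightarrow> bool"
    and h :: nat and wm :: nat
  assumes finite_P: "finite P" and finite_Z: "finite Z" and zero_Z: "0 \<in> Z"
    and add_Z: "\<And>z z'. z \<in> Z \<Longrightarrow> z' \<in> Z \<Longrightarrow> z + z' \<in> Z"
    and self_Z: "\<And>z. z \<in> Z \<Longrightarrow> z + z = 0"
    and bd_add: "\<And>z z'. z \<in> Z \<Longrightarrow> z' \<in> Z \<Longrightarrow> bd (z + z') = bd z + bd z'"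
    and bd_vecs: "\<And>z. z \<in> Z \<Longrightarrow> bd z \<in> vecs P"
    and v_add: "\<And>z z'. z \<in> Z \<Longrightarrow> z' \<in> Z \<Longrightarrow> v (z + z') = v z * v z'"
    and v_0: "v 0 = 1"
    and size_add: "\<And>z z'. z \<in> Z \<Longrightarrow> z' \<in> Z \<Longrightarrow> size (z + z') \<le> size z + size z'"
    and size_0: "size 0 = 0" and size_eq_0: "\<And>z. z \<in> Z \<Longrightarrow> size z = 0 \<Longrightarrow> z = 0"
    and cov_0: "cov 0 0"
    and cov_add: "\<And>w w' \<alpha> \<beta>. cov w \<alpha> \<Longrightarrow> cov w' \<beta> \<Longrightarrow> cov (w + w') (\<alpha> + \<beta>)"
    and cov_mono: "\<And>w w' \<alpha>. cov w \<alpha> \<Longrightarrow> w \<le> w' \<Longrightarrow> cov w' \<alpha>"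
    and expanding: "\<And>z w. z \<in> Z \<Longrightarrow> size z \<le> 2 * h \<Longrightarrow> w \<le> wm \<Longrightarrow> cov w (bd z) \<Longrightarrow> size z \<le> 48 * w"
    and wm_le: "48 * wm \<le> h"
begin

text \<open>\<open>Ex\<close> is the pseudo-expectation, \<open>mu\<close> its value on characters, and \<open>LD w\<close> holds of the
  functions of width at most \<open>w\<close>.\<close>

definition mu :: "('p \<Rightarrow> bit) \<Rightarrow> real" where
  "mu \<gamma> = (\<Sum>z\<in>{z\<in>Z. size z \<le> h \<and> bd z = \<gamma>}. v z)"

definition Ex :: "(('p \<Rightarrow> bit) \<Rightarrow> real) \<Rightarrow> real" where
  "Ex f = (\<Sum>x\<in>vecs P. f x * (\<Sum>z\<in>{z\<in>Z. size z \<le> h}. v z * chi P (bd z) x)) / 2 ^ card P"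

definition vc :: "nat \<Rightarrow> ('p \<Rightarrow> bit) set" where
  "vc w = {\<alpha>\<in>vecs P. cov w \<alpha>}"

definition LD :: "nat \<Rightarrow> (('p \<Rightarrow> bit) \<Rightarrow> real) \<Rightarrow> bool" where
  "LD w f \<longleftrightarrow> (\<exists>c. \<forall>x\<in>vecs P. f x = (\<Sum>\<alpha>\<in>vc w. c \<alpha> * chi P \<alpha> x))"

lemma finite_vc [simp]: "finite (vc w)"
  by (simp add: vc_def finite_P)

lemma bd_0: "bd 0 = 0"
  using bd_add[OF zero_Z zero_Z] by simp

section \<open>Linearity of the pseudo-expectation, and shift invariance of its moments\<close>

lemma Ex_cong: "(\<And>x. x \<in> vecs P \<Longrightarrow> f x = g x) \<Longrightarrow> Ex f = Ex g"
  by (simp add: Ex_def)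

lemma Ex_sum: "Ex (\<lambda>x. \<Sum>i\<in>I. f i x) = (\<Sum>i\<in>I. Ex (f i))"
proof -
  have "(\<Sum>x\<in>vecs P. (\<Sum>i\<in>I. f i x) * (\<Sum>z\<in>{z\<in>Z. size z \<le> h}. v z * chi P (bd z) x))
     = (\<Sum>i\<in>I. \<Sum>x\<in>vecs P. f i x * (\<Sum>z\<in>{z\<in>Z. size z \<le> h}. v z * chi P (bd z) x))"
    by (subst sum.swap) (simp add: sum_distrib_right)
  then show ?thesis by (simp add: Ex_def sum_divide_distrib)
qed

lemma Ex_scale: "Ex (\<lambda>x. c * f x) = c * Ex f"
  by (simp add: Ex_def sum_distrib_left mult.assoc)

lemma Ex_add: "Ex (\<lambda>x. f x + g x) = Ex f + Ex g"
  by (simp add: Ex_def distrib_right sum.distrib add_divide_distrib)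

lemma Ex_diff: "Ex (\<lambda>x. f x - g x) = Ex f - Ex g"
  using Ex_add[of f "\<lambda>x. (-1) * g x"] Ex_scale[of "-1" g] by simp

lemma Ex_chi: 
  assumes \<gamma>: "\<gamma> \<in> vecs P"
  shows "Ex (chi P \<gamma>) = mu \<gamma>"
proof -
  have "(\<Sum>x\<in>vecs P. chi P \<gamma> x * (\<Sum>z\<in>{z\<in>Z. size z \<le> h}. v z * chi P (bd z) x))
     = (\<Sum>z\<in>{z\<in>Z. size z \<le> h}. v z * (\<Sum>x\<in>vecs P. chi P (\<gamma> + bd z) x))"
    by (simp add: sum_distrib_left chi_add_left mult_ac) (rule sum.swap)
  also have "\<dots> = (\<Sum>z\<in>{z\<in>Z. size z \<le> h}. if bd z = \<gamma> then v z * 2 ^ card P else 0)"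
    by (intro sum.cong refl)
      (use \<gamma> bd_vecs in \<open>auto simp: sum_chi_vecs[OF finite_P] vecs_add vec_add_eq_0_iff\<close>)
  also have "\<dots> = (\<Sum>z\<in>{z\<in>Z. size z \<le> h \<and> bd z = \<gamma>}. v z * 2 ^ card P)"
    by (rule sum.mono_neutral_cong_right) (use finite_Z in auto)
  finally show ?thesis by (simp add: Ex_def mu_def sum_distrib_right[symmetric])
qed

text \<open>Adding \<open>z0\<close> may double the size bound \<open>h\<close>, but a combination
  with a narrow left-hand side contracts again: expansion gives size at most \<open>48 * w\<close>,
  hence at most \<open>h\<close>. So adding \<open>z0\<close> is a bijection between the two index
  sets. This is why expansion is assumed up to \<open>2 * h\<close>.\<close>

lemma mu_shift:
  assumes z0: "z0 \<in> Z" "size z0 \<le> h" and w: "w \<le> wm" "cov w \<delta>" "cov w (\<delta> + bd z0)"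
  shows "mu (\<delta> + bd z0) = v z0 * mu \<delta>"
proof -
  have cancel: "(z + z0) + z0 = z" for z
    using self_Z[OF z0(1)] by (simp add: add.assoc)
  have small: "size (z + z0) \<le> h" if "z \<in> Z" "size z \<le> h" "cov w (bd (z + z0))" for z
  proof -
    have "size (z + z0) \<le> 2 * h" using size_add[OF that(1) z0(1)] that(2) z0(2) by simp
    then have "size (z + z0) \<le> 48 * w" by (intro expanding w that add_Z z0)
    then show ?thesis using w(1) wm_le by linarith
  qed
  have "bij_betw (\<lambda>z. z + z0) {z\<in>Z. size z \<le> h \<and> bd z = \<delta>} {z\<in>Z. size z \<le> h \<and> bd z = \<delta> + bd z0}"
  proof (rule bij_betw_byWitness[where f' = "\<lambda>z. z + z0"])
    show "(\<lambda>z. z + z0) ` {z\<in>Z. size z \<le> h \<and> bd z = \<delta>} \<subseteq> {z\<in>Z. size z \<le> h \<and> bd z = \<delta> + bd z0}"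
      using z0 w small by (auto simp: add_Z bd_add)
    show "(\<lambda>z. z + z0) ` {z\<in>Z. size z \<le> h \<and> bd z = \<delta> + bd z0} \<subseteq> {z\<in>Z. size z \<le> h \<and> bd z = \<delta>}"
    proof clarify
      fix z assume z: "z \<in> Z" "size z \<le> h" "bd z = \<delta> + bd z0"
      have "bd (z + z0) = \<delta>" using z z0 by (simp add: bd_add add.assoc vec_add_self)
      then show "z + z0 \<in> Z \<and> size (z + z0) \<le> h \<and> bd (z + z0) = \<delta>"
        using z z0 w small by (simp add: add_Z)
    qed
  qed (auto simp: cancel)
  then have "mu (\<delta> + bd z0) = (\<Sum>z\<in>{z\<in>Z. size z \<le> h \<and> bd z = \<delta>}. v (z + z0))"
    unfolding mu_def by (rule sum.reindex_bij_betw[symmetric])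
  also have "\<dots> = v z0 * mu \<delta>"
    unfolding mu_def sum_distrib_left by (rule sum.cong) (use z0 in \<open>auto simp: v_add\<close>)
  finally show ?thesis .
qed

text \<open>Expansion at width 0 leaves only the empty combination with left-hand side 0, so no
  small combination derives a contradiction.\<close>

lemma mu_0: "mu 0 = 1"
proof -
  have "{z\<in>Z. size z \<le> h \<and> bd z = 0} = {0}"
  proof (intro equalityI subsetI)
    fix z assume "z \<in> {z\<in>Z. size z \<le> h \<and> bd z = 0}"
    then have "z \<in> Z" "size z \<le> 48 * 0" using cov_0 expanding[of z 0] by auto
    then show "z \<in> {0}" using size_eq_0 by auto
  qed (use zero_Z size_0 bd_0 in auto)
  then show ?thesis by (simp add: mu_def v_0)
qed

text \<open>A nonzero moment at \<open>a + b\<close> supplies a combination with this left-hand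
  side; shifting by it carries \<open>b + d\<close> to \<open>a + d\<close>. This is the
  multiplicativity that \<open>class_kernel_psd\<close> asks for, and the widths double because two
  characters are multiplied.\<close>

lemma mu_mult:
  assumes w: "2 * w \<le> wm" and a: "cov w a" and b: "cov w b" and d: "cov w d"
    and nz: "mu (a + b) \<noteq> 0"
  shows "mu (a + d) = mu (a + b) * mu (b + d)"
proof -
  have "{z\<in>Z. size z \<le> h \<and> bd z = a + b} \<noteq> {}"
    using nz unfolding mu_def by (metis sum.empty)
  then obtain z0 where z0: "z0 \<in> Z" "size z0 \<le> h" "bd z0 = a + b" by auto
  have cov2: "cov (2 * w) (\<alpha> + \<beta>)" if "cov w \<alpha>" "cov w \<beta>" for \<alpha> \<beta>
    using cov_add[OF that] by (simp add: mult_2)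
  have eq: "(b + d) + (a + b) = a + d"
  proof -
    have "(b + d) + (a + b) = (b + b) + (a + d)" by (simp add: ac_simps)
    then show ?thesis by (simp add: vec_add_self)
  qed
  have "mu (a + d) = v z0 * mu (b + d)"
    using mu_shift[OF z0(1,2) w, of "b + d"] z0(3) eq cov2 a b d by simp
  moreover have "mu (a + b) = v z0"
    using mu_shift[OF z0(1,2) w, of "0"] z0(3) cov2[OF a b] cov_mono[OF cov_0, of "2 * w"] mu_0
    by simp
  ultimately show ?thesis by simp
qed

lemma vc_vecs: "\<alpha> \<in> vc w \<Longrightarrow> \<alpha> \<in> vecs P"
  by (simp add: vc_def)

theorem Ex_square_nonneg:
  assumes f: "LD w f" and w: "2 * w \<le> wm"
  shows "0 \<le> Ex (\<lambda>x. f x * f x)"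
proof -
  obtain c where c: "\<And>x. x \<in> vecs P \<Longrightarrow> f x = (\<Sum>\<alpha>\<in>vc w. c \<alpha> * chi P \<alpha> x)"
    using f by (auto simp: LD_def)
  have "Ex (\<lambda>x. f x * f x) = Ex (\<lambda>x. \<Sum>\<alpha>\<in>vc w. \<Sum>\<beta>\<in>vc w. (c \<alpha> * c \<beta>) * chi P (\<alpha> + \<beta>) x)"
    by (rule Ex_cong) (simp add: c sum_product chi_add_left mult_ac)
  also have "\<dots> = (\<Sum>\<alpha>\<in>vc w. \<Sum>\<beta>\<in>vc w. c \<alpha> * c \<beta> * mu (\<alpha> + \<beta>))"
    unfolding Ex_sum Ex_scale
    by (intro sum.cong refl) (simp add: Ex_chi vecs_add vc_vecs)
  also have "\<dots> \<ge> 0"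
    by (rule class_kernel_psd[OF finite_vc])
      (auto simp: vec_add_self mu_0 add.commute vc_def intro: mu_mult[OF w])
  finally show ?thesis .
qed

section \<open>Calculus of functions of small width\<close>

lemma LD_mono:
  assumes "LD w f" "w \<le> w'"
  shows "LD w' f"
proof -
  obtain c where c: "\<And>x. x \<in> vecs P \<Longrightarrow> f x = (\<Sum>\<alpha>\<in>vc w. c \<alpha> * chi P \<alpha> x)"
    using assms by (auto simp: LD_def)
  have sub: "vc w \<subseteq> vc w'" using cov_mono assms(2) by (auto simp: vc_def)
  have "f x = (\<Sum>\<alpha>\<in>vc w'. (if \<alpha> \<in> vc w then c \<alpha> else 0) * chi P \<alpha> x)" if "x \<in> vecs P" for x
    unfolding c[OF that] by (rule sum.mono_neutral_cong_left) (use sub in auto)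
  then show ?thesis unfolding LD_def by (intro exI ballI)
qed

lemma LD_chi:
  assumes "\<alpha> \<in> vc w"
  shows "LD w (chi P \<alpha>)"
proof -
  have "chi P \<alpha> x = (\<Sum>\<beta>\<in>vc w. (if \<beta> = \<alpha> then 1 else 0) * chi P \<beta> x)" for x
    using assms by (simp add: if_distrib[of "\<lambda>c. c * _"] cong: if_cong)
  then show ?thesis unfolding LD_def by (intro exI ballI)
qed

lemma LD_scale: "LD w f \<Longrightarrow> LD w (\<lambda>x. a * f x)"
  unfolding LD_def
proof (elim exE)
  fix c assume "\<forall>x\<in>vecs P. f x = (\<Sum>\<alpha>\<in>vc w. c \<alpha> * chi P \<alpha> x)"
  then have "\<forall>x\<in>vecs P. a * f x = (\<Sum>\<alpha>\<in>vc w. (a * c \<alpha>) * chi P \<alpha> x)"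
    by (simp add: sum_distrib_left mult.assoc)
  then show "\<exists>c. \<forall>x\<in>vecs P. a * f x = (\<Sum>\<alpha>\<in>vc w. c \<alpha> * chi P \<alpha> x)"
    by (rule exI[where x = "\<lambda>\<alpha>. a * c \<alpha>"])
qed

lemma LD_sum:
  assumes "\<And>i. i \<in> I \<Longrightarrow> LD w (f i)"
  shows "LD w (\<lambda>x. \<Sum>i\<in>I. f i x)"
proof -
  have "\<forall>i\<in>I. \<exists>c. \<forall>x\<in>vecs P. f i x = (\<Sum>\<alpha>\<in>vc w. c \<alpha> * chi P \<alpha> x)"
    using assms by (simp add: LD_def)
  then obtain c where c: "\<And>i x. i \<in> I \<Longrightarrow> x \<in> vecs P \<Longrightarrow> f i x = (\<Sum>\<alpha>\<in>vc w. c i \<alpha> * chi P \<alpha> x)"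
    by metis
  have "(\<Sum>i\<in>I. f i x) = (\<Sum>\<alpha>\<in>vc w. (\<Sum>i\<in>I. c i \<alpha>) * chi P \<alpha> x)" if "x \<in> vecs P" for x
    using that by (simp add: c sum_distrib_right) (rule sum.swap)
  then show ?thesis unfolding LD_def by (intro exI ballI)
qed

lemma LD_mult:
  assumes f: "LD w f" and g: "LD w' g"
  shows "LD (w + w') (\<lambda>x. f x * g x)"
proof -
  obtain c where c: "\<And>x. x \<in> vecs P \<Longrightarrow> f x = (\<Sum>\<alpha>\<in>vc w. c \<alpha> * chi P \<alpha> x)"
    using f by (auto simp: LD_def)
  obtain d where d: "\<And>x. x \<in> vecs P \<Longrightarrow> g x = (\<Sum>\<alpha>\<in>vc w'. d \<alpha> * chi P \<alpha> x)"
    using g by (auto simp: LD_def)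
  have "LD (w + w') (\<lambda>x. \<Sum>\<alpha>\<in>vc w. \<Sum>\<beta>\<in>vc w'. (c \<alpha> * d \<beta>) * chi P (\<alpha> + \<beta>) x)"
    by (intro LD_sum LD_scale LD_chi) (auto simp: vc_def vecs_add cov_add)
  moreover have "f x * g x = (\<Sum>\<alpha>\<in>vc w. \<Sum>\<beta>\<in>vc w'. (c \<alpha> * d \<beta>) * chi P (\<alpha> + \<beta>) x)"
    if "x \<in> vecs P" for x
    using that by (simp add: c d sum_product chi_add_left mult_ac)
  ultimately show ?thesis unfolding LD_def by simp
qed

lemma LD_const: "LD 0 (\<lambda>x. a)"
  using LD_scale[OF LD_chi[of "0" 0], of a] cov_0 by (simp add: vc_def)

lemma LD_diff:
  assumes "LD w f" "LD w g"
  shows "LD w (\<lambda>x. f x - g x)"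
proof -
  have "LD w (if b then f else (\<lambda>x. (-1) * g x))" for b
    using assms LD_scale[of w g "-1"] by simp
  from LD_sum[of UNIV w "\<lambda>b. if b then f else (\<lambda>x. (-1) * g x)", OF this]
  show ?thesis by (simp add: UNIV_bool)
qed

lemma LD_prod:
  assumes "finite I" "\<And>i. i \<in> I \<Longrightarrow> LD 1 (f i)"
  shows "LD (card I) (\<lambda>x. \<Prod>i\<in>I. f i x)"
  using assms
proof (induction I rule: finite_induct)
  case empty
  then show ?case using LD_const by simp
next
  case (insert i I)
  then show ?case using LD_mult[of 1 "f i" "card I"] by simp
qed

text \<open>The width depends on how \<open>P0\<close> can be covered and not on its cardinality, so
  an event about all variables of one constraint can have width 1.\<close>

lemma LD_indicator:
  assumes sub: "P0 \<subseteq> P" and cov: "\<And>\<alpha>. \<alpha> \<in> vecs P0 \<Longrightarrow> cov w \<alpha>"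
  shows "LD w (\<lambda>x. if \<forall>p\<in>P0. x p = y p then 1 else 0)"
proof -
  have fin: "finite P0" using sub finite_P by (rule finite_subset)
  have "LD w (\<lambda>x. \<Sum>\<alpha>\<in>vecs P0. chi P0 \<alpha> y / 2 ^ card P0 * chi P \<alpha> x)"
    by (intro LD_sum LD_scale LD_chi) (use vecs_mono[OF sub] cov in \<open>auto simp: vc_def\<close>)
  moreover have "(if \<forall>p\<in>P0. x p = y p then 1 else 0)
      = (\<Sum>\<alpha>\<in>vecs P0. chi P0 \<alpha> y / 2 ^ card P0 * chi P \<alpha> x)" for x
    unfolding indicator_eq_sum_chi[OF fin] 
    by (intro sum.cong refl) (simp add: chi_superset[OF finite_P sub])
  ultimately show ?thesis by simp
qed

text \<open>Shift invariance lifted from characters to functions: under \<open>Ex\<close> the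
  character of a derived equation may be replaced by its sign, as if every assignment satisfied the
  equation.\<close>

lemma Ex_chi_mult:
  assumes z0: "z0 \<in> Z" "size z0 \<le> h" "cov w' (bd z0)" and f: "LD w f" and w: "w + w' \<le> wm"
  shows "Ex (\<lambda>x. chi P (bd z0) x * f x) = v z0 * Ex f"
proof -
  obtain c where c: "\<And>x. x \<in> vecs P \<Longrightarrow> f x = (\<Sum>\<alpha>\<in>vc w. c \<alpha> * chi P \<alpha> x)"
    using f by (auto simp: LD_def)
  have mu: "mu (\<alpha> + bd z0) = v z0 * mu \<alpha>" if "\<alpha> \<in> vc w" for \<alpha>
  proof (rule mu_shift[OF z0(1,2) w])
    show "cov (w + w') \<alpha>" using that cov_mono[of w \<alpha> "w + w'"] by (simp add: vc_def)
    show "cov (w + w') (\<alpha> + bd z0)" using that z0 by (simp add: vc_def cov_add)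
  qed
  have "Ex (\<lambda>x. chi P (bd z0) x * f x) = Ex (\<lambda>x. \<Sum>\<alpha>\<in>vc w. c \<alpha> * chi P (\<alpha> + bd z0) x)"
    by (rule Ex_cong) (simp add: c sum_distrib_left chi_add_left mult_ac)
  also have "\<dots> = (\<Sum>\<alpha>\<in>vc w. c \<alpha> * (v z0 * mu \<alpha>))"
    unfolding Ex_sum Ex_scale
    by (intro sum.cong refl) (use z0 in \<open>simp add: Ex_chi vecs_add vc_vecs bd_vecs mu\<close>)
  also have "\<dots> = v z0 * Ex (\<lambda>x. \<Sum>\<alpha>\<in>vc w. c \<alpha> * chi P \<alpha> x)"
    unfolding Ex_sum Ex_scale sum_distrib_left
    by (intro sum.cong refl) (simp add: Ex_chi vc_vecs)
  also have "Ex (\<lambda>x. \<Sum>\<alpha>\<in>vc w. c \<alpha> * chi P \<alpha> x) = Ex f"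
    by (rule Ex_cong) (simp add: c)
  finally show ?thesis .
qed

lemma Ex_const: "Ex (\<lambda>x. a) = a"
  using Ex_chi[of "0"] mu_0 Ex_scale[of a "\<lambda>x. 1"] by (simp add: chi_0_left[abs_def])

end

section \<open>A code with dual distance three\<close>

text \<open>Dual distance at least three means that any two symbols of a random codeword are
  independent and uniform. The code encodes pairwise independent Toeplitz hashing: symbol \<open>l\<close> is
  \<open>c\<close> plus a Toeplitz matrix applied to the binary expansion of \<open>l\<close>.\<close>

lemma toeplitz_code:
  fixes p t :: nat
  defines "R \<equiv> {..<2 ^ p} \<times> {..<t}"
  obtains C0 :: "(nat \<times> nat \<Rightarrow> bit) set"
  where "C0 \<subseteq> vecs R" "0 \<in> C0" "\<And>x y. x \<in> C0 \<Longrightarrow> y \<in> C0 \<Longrightarrow> x + y \<in> C0"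
    "card C0 \<le> 2 ^ (2 * t + p)"
    "\<And>z. z \<in> vecs R \<Longrightarrow> \<forall>a\<in>C0. dot R z a = 0 \<Longrightarrow> z \<noteq> 0 \<Longrightarrow>
       3 \<le> card {l. l < 2 ^ p \<and> (\<exists>\<tau><t. z (l, \<tau>) \<noteq> 0)}"
proof -
  \<comment> \<open>Entry \<open>(\<tau>, v)\<close> of the matrix is \<open>d (\<tau> + v)\<close>,
    so \<open>tz l \<tau> \<mu>\<close> is the coefficient of \<open>d \<mu>\<close> in coordinate
    \<open>\<tau>\<close> of symbol \<open>l\<close>.\<close>
  define tz :: "nat \<Rightarrow> nat \<Rightarrow> nat \<Rightarrow> bit" where
    "tz l \<tau> \<mu> = (if \<tau> \<le> \<mu> \<and> \<mu> - \<tau> < p \<and> bit l (\<mu> - \<tau>) then 1 else 0)" for l \<tau> \<mu>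
  define cw :: "(nat \<Rightarrow> bit) \<Rightarrow> (nat \<Rightarrow> bit) \<Rightarrow> nat \<times> nat \<Rightarrow> bit" where
    "cw c d = (\<lambda>(l, \<tau>). if (l, \<tau>) \<in> R then c \<tau> + (\<Sum>\<mu><t + p. tz l \<tau> \<mu> * d \<mu>) else 0)" for c d
  define C0 where "C0 = (\<lambda>(c, d). cw c d) ` (vecs {..<t} \<times> vecs {..<t + p})"
  have finR: "finite R" by (simp add: R_def)
  have cw_add: "cw c d + cw c' d' = cw (c + c') (d + d')" for c c' d d'
    by (rule ext) (auto simp: cw_def distrib_left sum.distrib ac_simps)
  have cwI: "cw c d \<in> C0" if "c \<in> vecs {..<t}" "d \<in> vecs {..<t + p}" for c d
    using that by (auto simp: C0_def)
  show thesis
  proof (rule that[of C0])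
    show "C0 \<subseteq> vecs R" by (auto simp: C0_def cw_def vecs_def)
    have "cw 0 0 = 0" by (rule ext) (auto simp: cw_def)
    then show "0 \<in> C0" using cwI[of "0" "0"] by simp
    show "x + y \<in> C0" if "x \<in> C0" "y \<in> C0" for x y
      using that by (auto simp: C0_def cw_add intro!: cwI[unfolded C0_def] vecs_add)
    have "card C0 \<le> card (vecs {..<t} \<times> vecs {..<t + p})"
      unfolding C0_def by (rule card_image_le) simp
    also have "\<dots> = 2 ^ (2 * t + p)"
      by (simp add: card_cartesian_product card_vecs power_add[symmetric] mult_2)
    finally show "card C0 \<le> 2 ^ (2 * t + p)" .
  next
    fix z assume z: "z \<in> vecs R" and ann: "\<forall>a\<in>C0. dot R z a = 0" and "z \<noteq> 0"
    define L where "L = {l. l < 2 ^ p \<and> (\<exists>\<tau><t. z (l, \<tau>) \<noteq> 0)}"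
    have finL: "finite L" by (simp add: L_def)
    have z_out: "z (l, \<tau>) = 0" if "l \<notin> L" for l \<tau>
    proof (cases "(l, \<tau>) \<in> R")
      case True
      then show ?thesis using that by (auto simp: L_def R_def)
    qed (use z in \<open>simp add: vecs_def\<close>)
    have LR: "L \<subseteq> {..<2 ^ p}" by (auto simp: L_def)
    have dot_eq: "dot R z a = (\<Sum>l\<in>L. \<Sum>\<tau><t. z (l, \<tau>) * a (l, \<tau>))" for a
    proof -
      have "dot R z a = (\<Sum>l<2 ^ p. \<Sum>\<tau><t. z (l, \<tau>) * a (l, \<tau>))"
        by (simp add: dot_def R_def sum.cartesian_product case_prod_beta)
      also have "\<dots> = (\<Sum>l\<in>L. \<Sum>\<tau><t. z (l, \<tau>) * a (l, \<tau>))"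
        by (rule sum.mono_neutral_right) (use LR z_out in auto)
      finally show ?thesis .
    qed
    have c_eq: "(\<Sum>l\<in>L. z (l, \<tau>0)) = 0" if "\<tau>0 < t" for \<tau>0
    proof -
      define c where "c = (\<lambda>\<tau>. if \<tau> = \<tau>0 then 1 else 0 :: bit)"
      have "c \<in> vecs {..<t}" using that by (auto simp: c_def vecs_def)
      then have "dot R z (cw c 0) = 0" using ann cwI by simp
      moreover have "dot R z (cw c 0) = (\<Sum>l\<in>L. \<Sum>\<tau><t. if \<tau> = \<tau>0 then z (l, \<tau>) else 0)"
        unfolding dot_eq using LR
        by (intro sum.cong refl) (auto simp: cw_def c_def R_def)
      ultimately show ?thesis using that by simp
    qed
    have d_eq: "(\<Sum>l\<in>L. \<Sum>\<tau><t. z (l, \<tau>) * tz l \<tau> \<mu>) = 0" if "\<mu> < t + p" for \<mu>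
    proof -
      define d where "d = (\<lambda>\<mu>'. if \<mu>' = \<mu> then 1 else 0 :: bit)"
      have "d \<in> vecs {..<t + p}" using that by (auto simp: d_def vecs_def)
      then have "dot R z (cw 0 d) = 0" using ann cwI by simp
      moreover have "dot R z (cw 0 d) = (\<Sum>l\<in>L. \<Sum>\<tau><t. z (l, \<tau>) * tz l \<tau> \<mu>)"
        unfolding dot_eq using LR that
        by (intro sum.cong refl)
          (auto simp: cw_def d_def R_def if_distrib[of "\<lambda>x. _ * x"] cong: if_cong)
      ultimately show ?thesis by simp
    qed
    have "3 \<le> card L"
    proof (rule ccontr)
      assume "\<not> 3 \<le> card L"
      then consider "card L = 0" | "card L = 1" | "card L = 2" by linarith
      then show False
      proof cases
        case 1
        then have "z = 0" using z_out finL by (auto simp: fun_eq_iff)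
        then show False using \<open>z \<noteq> 0\<close> by simp
      next
        case 2
        then obtain l where l: "L = {l}" by (auto simp: card_1_singleton_iff)
        then obtain \<tau> where "\<tau> < t" "z (l, \<tau>) \<noteq> 0" by (auto simp: L_def)
        then show False using c_eq[of \<tau>] l by simp
      next
        case 3
        then obtain l l' where l: "L = {l, l'}" "l \<noteq> l'" by (auto simp: card_2_iff)
        have lp: "l < 2 ^ p" "l' < 2 ^ p" using LR l by auto
        have eq: "z (l', \<tau>) = z (l, \<tau>)" if "\<tau> < t" for \<tau>
          using c_eq[OF that] l by (auto simp: bit_add_eq_0_iff)
        define A where "A = {\<tau>. \<tau> < t \<and> z (l, \<tau>) \<noteq> 0}"
        define D where "D = {v. v < p \<and> bit l v \<noteq> bit l' v}"
        have "\<exists>\<tau><t. z (l, \<tau>) \<noteq> 0" using l by (auto simp: L_def)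
        then have A: "finite A" "A \<noteq> {}" by (auto simp: A_def)
        obtain v where v: "bit l v \<noteq> bit l' v" using l(2) by (meson bit_eq_iff)
        have "take_bit p l = l" "take_bit p l' = l'" using lp by (simp_all add: take_bit_nat_eq_self)
        then have "v < p" using v by (metis bit_take_bit_iff)
        then have D: "finite D" "D \<noteq> {}" using v by (auto simp: D_def)
        \<comment> \<open>Read \<open>z (l, _)\<close> and the difference of the bits of
          \<open>l\<close> and \<open>l'\<close> as polynomials over \<open>GF(2)\<close>, with
          leading terms at \<open>\<tau>0\<close> and \<open>v0\<close>. Then \<open>d_eq\<close> at
          \<open>\<tau>0 + v0\<close> says that the leading coefficient of their product is 0,
          although it is a product of ones.\<close>
        define \<tau>0 where "\<tau>0 = Max A"
        define v0 where "v0 = Max D"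
        have t0: "\<tau>0 < t" "z (l, \<tau>0) \<noteq> 0" using Max_in[OF A] by (auto simp: \<tau>0_def A_def)
        have v0: "v0 < p" "bit l v0 \<noteq> bit l' v0" using Max_in[OF D] by (auto simp: v0_def D_def)
        have "(\<Sum>\<tau><t. z (l, \<tau>) * tz l \<tau> (\<tau>0 + v0)) + (\<Sum>\<tau><t. z (l, \<tau>) * tz l' \<tau> (\<tau>0 + v0)) = 0"
          using d_eq[of "\<tau>0 + v0"] t0 v0 l eq by simp
        then have "(\<Sum>\<tau><t. z (l, \<tau>) * (tz l \<tau> (\<tau>0 + v0) + tz l' \<tau> (\<tau>0 + v0))) = 0"
          by (simp add: sum.distrib distrib_left)
        also have "(\<Sum>\<tau><t. z (l, \<tau>) * (tz l \<tau> (\<tau>0 + v0) + tz l' \<tau> (\<tau>0 + v0)))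
            = (\<Sum>\<tau>\<in>{\<tau>0}. z (l, \<tau>) * (tz l \<tau> (\<tau>0 + v0) + tz l' \<tau> (\<tau>0 + v0)))"
        proof (rule sum.mono_neutral_right)
          show "\<forall>\<tau>\<in>{..<t} - {\<tau>0}. z (l, \<tau>) * (tz l \<tau> (\<tau>0 + v0) + tz l' \<tau> (\<tau>0 + v0)) = 0"
          proof
            fix \<tau> assume \<tau>: "\<tau> \<in> {..<t} - {\<tau>0}"
            show "z (l, \<tau>) * (tz l \<tau> (\<tau>0 + v0) + tz l' \<tau> (\<tau>0 + v0)) = 0"
            proof (cases "z (l, \<tau>) = 0")
              case False
              then have "\<tau> \<in> A" using \<tau> by (simp add: A_def)
              then have "\<tau> < \<tau>0" using \<tau> A by (auto simp: \<tau>0_def le_neq_implies_less)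
              then have "\<tau>0 + v0 - \<tau> \<notin> D" using Max_ge[OF D(1), of "\<tau>0 + v0 - \<tau>"] by (auto simp: v0_def)
              then show ?thesis by (auto simp: D_def tz_def bit_add_self)
            qed simp
          qed
        qed (use t0 in auto)
        also have "\<dots> = 1" using t0 v0 by (auto simp: tz_def)
        finally show False by simp
      qed
    qed
    then show "3 \<le> card {l. l < 2 ^ p \<and> (\<exists>\<tau><t. z (l, \<tau>) \<noteq> 0)}" by (simp add: L_def)
  qed
qed

section \<open>Expanding constraint systems\<close>

text \<open>Variables are the pairs \<open>(l, j)\<close> and take values in \<open>GF(2)\<^sup>t\<close>; constraint \<open>i\<close> requires the
  word \<open>l \<mapsto> (l, e i l)\<close> to lie in \<open>C0 + b i\<close>. Variables with different \<open>l\<close> are never identified,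
  so the \<open>k\<close> variables of a constraint are automatically distinct.\<close>

locale label_system =
  fixes m k t N :: nat and e :: "nat \<Rightarrow> nat \<Rightarrow> nat" and b :: "nat \<Rightarrow> nat \<times> nat \<Rightarrow> bit"
    and C0 :: "(nat \<times> nat \<Rightarrow> bit) set" and s h wm :: nat
  assumes e_less: "\<And>i l. i < m \<Longrightarrow> l < k \<Longrightarrow> e i l < N"
    and b_vecs: "\<And>i. b i \<in> vecs ({..<k} \<times> {..<t})"
    and C0_vecs: "C0 \<subseteq> vecs ({..<k} \<times> {..<t})" and C0_0: "0 \<in> C0"
    and C0_add: "\<And>x y. x \<in> C0 \<Longrightarrow> y \<in> C0 \<Longrightarrow> x + y \<in> C0"
    and dual_distance: "\<And>z. z \<in> vecs ({..<k} \<times> {..<t}) \<Longrightarrow> \<forall>a\<in>C0. dot ({..<k} \<times> {..<t}) z a = 0 \<Longrightarrow> z \<noteq> 0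
       \<Longrightarrow> 3 \<le> card {l. l < k \<and> (\<exists>\<tau><t. z (l, \<tau>) \<noteq> 0)}"
    and few_collisions: "\<And>S K. S \<subseteq> {..<m} \<Longrightarrow> S \<noteq> {} \<Longrightarrow> card S \<le> s \<Longrightarrow> K \<subseteq> S \<times> {..<k} \<Longrightarrow>
       (\<And>i l. (i, l) \<in> K \<Longrightarrow> \<exists>i'\<in>S. i' < i \<and> e i' l = e i l) \<Longrightarrow> 32 * card K < 47 * card S"
    and wm_h: "48 * wm \<le> h" and h_s: "2 * h + wm \<le> s" and h_pos: "1 \<le> h"
begin

definition R where "R = {..<k} \<times> {..<t}"
definition P where "P = {..<k} \<times> {..<N} \<times> {..<t}"
text \<open>The dual code, whose members are the linear equations valid on \<open>C0\<close>. An
  element of \<open>Z\<close> picks one of them for every constraint, and \<open>bd\<close> adds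
  them up as a functional on assignments.\<close>

definition Z0 where "Z0 = {z\<in>vecs R. \<forall>a\<in>C0. dot R z a = 0}"
definition Z :: "(nat \<Rightarrow> nat \<times> nat \<Rightarrow> bit) set" where
  "Z = {z. \<forall>i. (i \<in> {..<m} \<longrightarrow> z i \<in> Z0) \<and> (i \<notin> {..<m} \<longrightarrow> z i = 0)}"
definition bd :: "(nat \<Rightarrow> nat \<times> nat \<Rightarrow> bit) \<Rightarrow> nat \<times> nat \<times> nat \<Rightarrow> bit" where
  "bd z = (\<lambda>(l, j, \<tau>). if (l, j, \<tau>) \<in> P then \<Sum>i<m. if e i l = j then z i (l, \<tau>) else 0 else 0)"
definition sign :: "(nat \<Rightarrow> nat \<times> nat \<Rightarrow> bit) \<Rightarrow> real" where
  "sign z = sg (\<Sum>i<m. dot R (z i) (b i))"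
definition sz :: "(nat \<Rightarrow> nat \<times> nat \<Rightarrow> bit) \<Rightarrow> nat" where
  "sz z = card {i\<in>{..<m}. z i \<noteq> 0}"
text \<open>A constraint in \<open>B\<close> covers all of its \<open>k\<close> variables at cost 1.
  Were only variables counted, the pattern of a single constraint would have width \<open>k\<close>,
  far beyond the \<open>wm\<close> that is available.\<close>

definition cov :: "nat \<Rightarrow> (nat \<times> nat \<times> nat \<Rightarrow> bit) \<Rightarrow> bool" where
  "cov w \<alpha> \<longleftrightarrow> (\<exists>B V. B \<subseteq> {..<m} \<and> V \<subseteq> {..<k} \<times> {..<N} \<and> card B + card V \<le> w \<and>
     (\<forall>l j \<tau>. \<alpha> (l, j, \<tau>) \<noteq> 0 \<longrightarrow> (\<exists>i\<in>B. e i l = j) \<or> (l, j) \<in> V))"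

lemma finite_R [simp]: "finite R" and finite_P [simp]: "finite P"
  by (simp_all add: R_def P_def)

lemma finite_C0: "finite C0"
  using C0_vecs finite_R by (metis R_def finite_subset finite_vecs)

lemma weight_Z0:
  assumes "z \<in> Z0" "z \<noteq> 0"
  shows "3 \<le> card {l. l < k \<and> (\<exists>\<tau><t. z (l, \<tau>) \<noteq> 0)}"
  using assms dual_distance[of z] by (simp add: Z0_def R_def)

text \<open>Active constraints outside \<open>B\<close> have at least three incidences each, and a
  variable outside the cover must be hit twice to cancel. Hence at least half of these incidences,
  up to \<open>card V\<close>, are repetitions:
  \<open>3 * card S1 \<le> 2 * card K + 2 * card V\<close>. Against
  \<open>32 * card K < 47 * card (S1 \<union> B)\<close> the ratio 3/2 = 48/32 wins by 1/32, so
  \<open>card S1 < 47 * card B + 32 * card V\<close>; adding \<open>card B\<close> gives the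
  constant 48.\<close>

lemma expanding_cov:
  assumes z: "z \<in> Z" and sz: "sz z + w \<le> s" and cov: "cov w (bd z)"
  shows "sz z \<le> 48 * w"
proof -
  obtain B V where B: "B \<subseteq> {..<m}" and V: "V \<subseteq> {..<k} \<times> {..<N}" and w: "card B + card V \<le> w"
    and cover: "\<And>l j \<tau>. bd z (l, j, \<tau>) \<noteq> 0 \<Longrightarrow> (\<exists>i\<in>B. e i l = j) \<or> (l, j) \<in> V"
    using cov unfolding cov_def by blast
  have finB: "finite B" and finV: "finite V"
    using B V finite_subset by blast+
  define S where "S = {i\<in>{..<m}. z i \<noteq> 0}"
  define S1 where "S1 = S - B"
  define Lr where "Lr i = {l. l < k \<and> (\<exists>\<tau><t. z i (l, \<tau>) \<noteq> 0)}" for i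
  define I1 where "I1 = Sigma S1 Lr"
  \<comment> \<open>All \<open>k\<close> incidences of every covering constraint are included, so
    that \<open>card B * k\<close> cancels between the count of incidences and the count of distinct
    variables.\<close>
  define IB where "IB = B \<times> {..<k}"
  define I2 where "I2 = I1 \<union> IB"
  define g where "g = (\<lambda>(i, l). (l, e i l))"
  \<comment> \<open>The first occurrence of each variable stays outside \<open>K\<close>, so
    \<open>card (I2 - K)\<close> counts distinct variables.\<close>
  define K where "K = {(i, l). (i, l) \<in> I2 \<and> (\<exists>i'. i' < i \<and> (i', l) \<in> I2 \<and> e i' l = e i l)}"
  have finS1: "finite S1" by (simp add: S1_def S_def)
  have finLr: "finite (Lr i)" for i by (simp add: Lr_def)
  have finI1: "finite I1" by (simp add: I1_def finS1 finLr)
  have finIB: "finite IB" by (simp add: IB_def finB)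
  have finI2: "finite I2" by (simp add: I2_def finI1 finIB)
  have KI2: "K \<subseteq> I2" by (auto simp: K_def)
  have I1_ge: "3 * card S1 \<le> card I1"
  proof -
    have "3 \<le> card (Lr i)" if "i \<in> S1" for i
      using that z weight_Z0[of "z i"] by (auto simp: Lr_def S1_def S_def Z_def)
    then have "(\<Sum>i\<in>S1. 3) \<le> (\<Sum>i\<in>S1. card (Lr i))" by (rule sum_mono)
    then show ?thesis by (simp add: I1_def card_SigmaI finS1 finLr mult.commute)
  qed
  have cardI2: "card I2 = card I1 + card B * k"
    unfolding I2_def by (subst card_Un_disjoint[OF finI1 finIB])
      (auto simp: I1_def IB_def S1_def card_cartesian_product)
  have inj: "inj_on g (I2 - K)"
  proof (rule inj_onI)
    fix x y assume x: "x \<in> I2 - K" and y: "y \<in> I2 - K" and gxy: "g x = g y"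
    obtain i l where xe: "x = (i, l)" by (cases x)
    obtain i' l' where ye: "y = (i', l')" by (cases y)
    have "l = l'" "e i l = e i' l" using gxy by (auto simp: xe ye g_def)
    moreover have "\<not> i < i'" "\<not> i' < i"
      using x y calculation by (auto simp: xe ye K_def)
    ultimately show "x = y" by (simp add: xe ye)
  qed
  define D where "D = g ` I1 - g ` IB - V"
  have finD: "finite D" by (simp add: D_def finI1)
  have two: "2 \<le> card {p\<in>I1. g p = d}" if d: "d \<in> D" for d
  proof -
    obtain i l where il: "(i, l) \<in> I1" "d = g (i, l)" using d by (auto simp: D_def)
    have iS: "i \<in> S" "i < m" "l < k" using il by (auto simp: I1_def S1_def S_def Lr_def)
    obtain \<tau> where \<tau>: "\<tau> < t" "z i (l, \<tau>) \<noteq> 0" using il by (auto simp: I1_def Lr_def)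
    have noB: "e i' l \<noteq> e i l" if "i' \<in> B" for i'
    proof
      assume "e i' l = e i l"
      then have "g (i', l) = d" "(i', l) \<in> IB" using that iS il by (auto simp: g_def IB_def)
      then show False using d by (metis DiffD1 DiffD2 D_def image_eqI)
    qed
    have "bd z (l, e i l, \<tau>) = 0"
      using cover[of l "e i l" \<tau>] noB d il by (auto simp: D_def g_def)
    moreover have "(l, e i l, \<tau>) \<in> P" using iS \<tau> e_less by (auto simp: P_def)
    ultimately have sum0: "(\<Sum>i'<m. if e i' l = e i l then z i' (l, \<tau>) else 0) = 0"
      by (simp add: bd_def)
    have "\<exists>i'. i' \<noteq> i \<and> i' < m \<and> e i' l = e i l \<and> z i' (l, \<tau>) \<noteq> 0"
    proof (rule ccontr)
      assume no: "\<not> ?thesis"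
      have "(\<Sum>i'<m. if e i' l = e i l then z i' (l, \<tau>) else 0)
          = (\<Sum>i'\<in>{i}. if e i' l = e i l then z i' (l, \<tau>) else 0)"
        by (rule sum.mono_neutral_right) (use iS no in auto)
      then show False using sum0 \<tau> by simp
    qed
    then obtain i' where i': "i' \<noteq> i" "i' < m" "e i' l = e i l" "z i' (l, \<tau>) \<noteq> 0" by auto
    have "z i' \<noteq> 0" using i'(4) by (auto simp: fun_eq_iff)
    then have "(i', l) \<in> I1"
      using i' noB \<tau> iS by (auto simp: I1_def S1_def S_def Lr_def)
    then have "{(i, l), (i', l)} \<subseteq> {p\<in>I1. g p = d}" using il i' by (auto simp: g_def)
    then have "card {(i, l), (i', l)} \<le> card {p\<in>I1. g p = d}"
      by (intro card_mono) (use finI1 in auto)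
    then show ?thesis using i'(1) by simp
  qed
  have cardD: "2 * card D \<le> card I1"
  proof -
    have "2 * card D = (\<Sum>d\<in>D. 2)" by simp
    also have "\<dots> \<le> (\<Sum>d\<in>D. card {p\<in>I1. g p = d})" by (rule sum_mono) (rule two)
    also have "\<dots> = card (\<Union>d\<in>D. {p\<in>I1. g p = d})"
      by (subst card_UN_disjoint) (use finD finI1 in auto)
    also have "\<dots> \<le> card I1" by (rule card_mono) (use finI1 in auto)
    finally show ?thesis .
  qed
  have "card (I2 - K) = card (g ` (I2 - K))" using card_image[OF inj] by simp
  also have "\<dots> \<le> card (g ` IB \<union> (V \<union> D))"
    by (rule card_mono) (use finIB finV finD in \<open>auto simp: D_def I2_def\<close>)
  also have "\<dots> \<le> card (g ` IB) + card (V \<union> D)" by (rule card_Un_le)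
  also have "\<dots> \<le> card IB + (card V + card D)"
    by (intro add_mono card_image_le card_Un_le finIB)
  finally have "card (I2 - K) \<le> card B * k + card V + card D"
    by (simp add: IB_def card_cartesian_product)
  moreover have "card I2 = card K + card (I2 - K)"
    using KI2 finI2 by (metis card_Diff_subset card_mono finite_subset le_add_diff_inverse)
  ultimately have K_ge: "3 * card S1 \<le> 2 * card K + 2 * card V"
    using cardI2 cardD I1_ge by linarith
  have S_le: "sz z \<le> card S1 + card B"
  proof -
    have "card S \<le> card (S1 \<union> B)" by (rule card_mono) (use finS1 finB in \<open>auto simp: S1_def\<close>)
    also have "\<dots> \<le> card S1 + card B" by (rule card_Un_le)
    finally show ?thesis by (simp add: sz_def S_def)
  qed
  show ?thesis
  proof (cases "S1 \<union> B = {}")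
    case True
    then show ?thesis using S_le by simp
  next
    case False
    have "card (S1 \<union> B) \<le> card S1 + card B" by (rule card_Un_le)
    moreover have "card S1 \<le> sz z" unfolding sz_def S1_def S_def by (rule card_mono) auto
    ultimately have small: "card (S1 \<union> B) \<le> s" using sz w by linarith
    have "32 * card K < 47 * card (S1 \<union> B)"
    proof (rule few_collisions[OF _ False small])
      show "S1 \<union> B \<subseteq> {..<m}" using B by (auto simp: S1_def S_def)
      show "K \<subseteq> (S1 \<union> B) \<times> {..<k}"
        by (auto simp: K_def I2_def I1_def IB_def Lr_def)
      show "\<exists>i'\<in>S1 \<union> B. i' < i \<and> e i' l = e i l" if "(i, l) \<in> K" for i l
        using that by (auto simp: K_def I2_def I1_def IB_def)
    qed
    then have "32 * card K < 47 * (card S1 + card B)"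
      by (rule less_le_trans) (intro mult_le_mono2 card_Un_le)
    then have "32 * card K < 47 * card S1 + 47 * card B" by (simp only: distrib_left)
    then show ?thesis using K_ge S_le w by linarith
  qed
qed

lemma zero_Z0: "0 \<in> Z0" and add_Z0: "x \<in> Z0 \<Longrightarrow> y \<in> Z0 \<Longrightarrow> x + y \<in> Z0"
  by (auto simp: Z0_def vecs_add dot_add_left)

lemma cov_add:
  assumes "cov w \<alpha>" "cov w' \<beta>"
  shows "cov (w + w') (\<alpha> + \<beta>)"
proof -
  obtain B V where 1: "B \<subseteq> {..<m}" "V \<subseteq> {..<k} \<times> {..<N}" "card B + card V \<le> w"
    "\<forall>l j \<tau>. \<alpha> (l, j, \<tau>) \<noteq> 0 \<longrightarrow> (\<exists>i\<in>B. e i l = j) \<or> (l, j) \<in> V"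
    using assms(1) unfolding cov_def by blast
  obtain B' V' where 2: "B' \<subseteq> {..<m}" "V' \<subseteq> {..<k} \<times> {..<N}" "card B' + card V' \<le> w'"
    "\<forall>l j \<tau>. \<beta> (l, j, \<tau>) \<noteq> 0 \<longrightarrow> (\<exists>i\<in>B'. e i l = j) \<or> (l, j) \<in> V'"
    using assms(2) unfolding cov_def by blast
  have "card (B \<union> B') + card (V \<union> V') \<le> w + w'"
    using card_Un_le[of B B'] card_Un_le[of V V'] 1(3) 2(3) by linarith
  moreover have "\<forall>l j \<tau>. (\<alpha> + \<beta>) (l, j, \<tau>) \<noteq> 0 \<longrightarrow> (\<exists>i\<in>B \<union> B'. e i l = j) \<or> (l, j) \<in> V \<union> V'"
  proof (intro allI impI)
    fix l j \<tau> assume "(\<alpha> + \<beta>) (l, j, \<tau>) \<noteq> 0"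
    then have "\<alpha> (l, j, \<tau>) \<noteq> 0 \<or> \<beta> (l, j, \<tau>) \<noteq> 0" by auto
    then show "(\<exists>i\<in>B \<union> B'. e i l = j) \<or> (l, j) \<in> V \<union> V'" using 1(4) 2(4) by (meson UnI1 UnI2)
  qed
  moreover have "B \<union> B' \<subseteq> {..<m}" "V \<union> V' \<subseteq> {..<k} \<times> {..<N}" using 1 2 by auto
  ultimately show ?thesis unfolding cov_def by (intro exI conjI)
qed

lemma bd_support: "bd z (l, j, \<tau>) \<noteq> 0 \<Longrightarrow> \<exists>i<m. z i (l, \<tau>) \<noteq> 0 \<and> e i l = j"
proof (rule ccontr)
  assume nz: "bd z (l, j, \<tau>) \<noteq> 0" and no: "\<not> (\<exists>i<m. z i (l, \<tau>) \<noteq> 0 \<and> e i l = j)"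
  have "(\<Sum>i<m. if e i l = j then z i (l, \<tau>) else 0) = 0"
    by (rule sum.neutral) (use no in auto)
  then show False using nz by (simp add: bd_def split: if_splits)
qed

sublocale linear_system P Z bd sign sz cov h wm
proof
  show "finite P" by simp
  have "finite Z0" by (rule finite_subset[of _ "vecs R"]) (auto simp: Z0_def)
  then show "finite Z" unfolding Z_def by (intro finite_set_of_finite_funs) auto
  show "0 \<in> Z" using zero_Z0 by (auto simp: Z_def)
  show "z + z' \<in> Z" if "z \<in> Z" "z' \<in> Z" for z z'
    using that add_Z0 by (auto simp: Z_def)
  show "z + z = 0" for z :: "nat \<Rightarrow> nat \<times> nat \<Rightarrow> bit"
    by (auto simp: fun_eq_iff bit_add_self)
  show "bd (z + z') = bd z + bd z'" for z z'
    by (auto simp: fun_eq_iff bd_def sum.distrib[symmetric] intro!: sum.cong)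
  show "bd z \<in> vecs P" for z by (auto simp: bd_def vecs_def)
  show "sign (z + z') = sign z * sign z'" for z z'
    by (simp add: sign_def dot_add_left sum.distrib sg_add)
  show "sign 0 = 1" by (simp add: sign_def)
  show "sz (z + z') \<le> sz z + sz z'" for z z'
  proof -
    have "sz (z + z') \<le> card ({i\<in>{..<m}. z i \<noteq> 0} \<union> {i\<in>{..<m}. z' i \<noteq> 0})"
      unfolding sz_def by (rule card_mono) auto
    also have "\<dots> \<le> sz z + sz z'" unfolding sz_def by (rule card_Un_le)
    finally show ?thesis .
  qed
  show "sz 0 = 0" by (simp add: sz_def)
  show "z = 0" if "z \<in> Z" "sz z = 0" for z
    using that by (auto simp: sz_def Z_def fun_eq_iff)
  show "cov 0 0" by (auto simp: cov_def intro!: exI[of _ "{}"])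
  show "cov (w + w') (\<alpha> + \<beta>)" if "cov w \<alpha>" "cov w' \<beta>" for w w' \<alpha> \<beta>
    using that by (rule cov_add)
  show "cov w' \<alpha>" if "cov w \<alpha>" "w \<le> w'" for w w' \<alpha>
    using that unfolding cov_def by (meson le_trans)
  show "sz z \<le> 48 * w" if "z \<in> Z" "sz z \<le> 2 * h" "w \<le> wm" "cov w (bd z)" for z w
    by (rule expanding_cov) (use that h_s in auto)
  show "48 * wm \<le> h" by (rule wm_h)
qed

section \<open>Patterns of one constraint under the pseudo-expectation\<close>

definition pull :: "nat \<Rightarrow> (nat \<times> nat \<times> nat \<Rightarrow> bit) \<Rightarrow> nat \<times> nat \<Rightarrow> bit" where
  "pull i x = (\<lambda>(l, \<tau>). if (l, \<tau>) \<in> R then x (l, e i l, \<tau>) else 0)"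

definition pat :: "nat \<Rightarrow> (nat \<times> nat \<Rightarrow> bit) \<Rightarrow> (nat \<times> nat \<times> nat \<Rightarrow> bit) \<Rightarrow> real" where
  "pat i a x = (if \<forall>l<k. \<forall>\<tau><t. x (l, e i l, \<tau>) = a (l, \<tau>) + b i (l, \<tau>) then 1 else 0)"

definition val :: "nat \<Rightarrow> nat \<Rightarrow> (nat \<Rightarrow> bit) \<Rightarrow> (nat \<times> nat \<times> nat \<Rightarrow> bit) \<Rightarrow> real" where
  "val l j c x = (if \<forall>\<tau><t. x (l, j, \<tau>) = c \<tau> then 1 else 0)"

text \<open>\<open>bd\<close> is the adjoint of \<open>pull\<close>: a combined equation evaluated
  at an assignment is the sum of the dual words evaluated on the words that the constraints
  read.\<close>

lemma dot_bd:
  "dot P (bd z) x = (\<Sum>i<m. dot R (z i) (pull i x))"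
proof -
  have "dot P (bd z) x = (\<Sum>l<k. \<Sum>j<N. \<Sum>\<tau><t. (\<Sum>i<m. if e i l = j then z i (l, \<tau>) else 0) * x (l, j, \<tau>))"
  proof -
    have "dot P (bd z) x = (\<Sum>(l, j, \<tau>)\<in>P. (\<Sum>i<m. if e i l = j then z i (l, \<tau>) else 0) * x (l, j, \<tau>))"
      unfolding dot_def by (intro sum.cong refl) (auto simp: bd_def)
    then show ?thesis by (simp add: P_def sum.cartesian_product)
  qed
  also have "\<dots> = (\<Sum>l<k. \<Sum>j<N. \<Sum>\<tau><t. \<Sum>i<m. if e i l = j then z i (l, \<tau>) * x (l, e i l, \<tau>) else 0)"
    by (intro sum.cong refl) (auto simp: sum_distrib_right intro!: sum.cong)
  also have "\<dots> = (\<Sum>l<k. \<Sum>j<N. \<Sum>i<m. \<Sum>\<tau><t. if e i l = j then z i (l, \<tau>) * x (l, e i l, \<tau>) else 0)"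
    by (rule sum.cong[OF refl], rule sum.cong[OF refl], rule sum.swap)
  also have "\<dots> = (\<Sum>l<k. \<Sum>i<m. \<Sum>j<N. \<Sum>\<tau><t. if e i l = j then z i (l, \<tau>) * x (l, e i l, \<tau>) else 0)"
    by (rule sum.cong[OF refl], rule sum.swap)
  also have "\<dots> = (\<Sum>i<m. \<Sum>l<k. \<Sum>j<N. \<Sum>\<tau><t. if e i l = j then z i (l, \<tau>) * x (l, e i l, \<tau>) else 0)"
    by (rule sum.swap)
  also have "\<dots> = (\<Sum>i<m. \<Sum>l<k. \<Sum>\<tau><t. \<Sum>j<N. if e i l = j then z i (l, \<tau>) * x (l, e i l, \<tau>) else 0)"
    by (rule sum.cong[OF refl], rule sum.cong[OF refl], rule sum.swap)
  also have "\<dots> = (\<Sum>i<m. \<Sum>l<k. \<Sum>\<tau><t. z i (l, \<tau>) * x (l, e i l, \<tau>))"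
    by (intro sum.cong refl) (simp add: e_less)
  also have "\<dots> = (\<Sum>i<m. dot R (z i) (pull i x))"
    unfolding dot_def R_def sum.cartesian_product
    by (intro sum.cong refl) (auto simp: pull_def R_def)
  finally show ?thesis .
qed

lemma LD_pat:
  assumes i: "i < m"
  shows "LD 1 (pat i a)"
proof -
  define P0 where "P0 = {(l, j, \<tau>). l < k \<and> \<tau> < t \<and> j = e i l}"
  have "LD 1 (\<lambda>x. if \<forall>p\<in>P0. x p = (\<lambda>(l, j, \<tau>). a (l, \<tau>) + b i (l, \<tau>)) p then 1 else 0)"
  proof (rule LD_indicator)
    show "P0 \<subseteq> P" using i e_less by (auto simp: P0_def P_def)
    show "cov 1 \<alpha>" if "\<alpha> \<in> vecs P0" for \<alpha>
    proof -
      have "p \<in> P0" if "\<alpha> p \<noteq> 0" for p using that \<open>\<alpha> \<in> vecs P0\<close> unfolding vecs_def by blast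
      then show ?thesis
        unfolding cov_def using i
        by (intro exI[of _ "{i}"] exI[of _ "{}"]) (fastforce simp: P0_def)
    qed
  qed
  moreover have "(if \<forall>p\<in>P0. x p = (\<lambda>(l, j, \<tau>). a (l, \<tau>) + b i (l, \<tau>)) p then 1 else 0) = pat i a x" for x
    unfolding pat_def by (rule if_cong) (auto simp: P0_def)
  ultimately show ?thesis by simp
qed

lemma LD_val:
  assumes "l < k" "j < N"
  shows "LD 1 (val l j c)"
proof -
  define P0 where "P0 = {(l', j', \<tau>). l' = l \<and> \<tau> < t \<and> j' = j}"
  have "LD 1 (\<lambda>x. if \<forall>p\<in>P0. x p = (\<lambda>(l, j, \<tau>). c \<tau>) p then 1 else 0)"
  proof (rule LD_indicator)
    show "P0 \<subseteq> P" using assms by (auto simp: P0_def P_def)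
    show "cov 1 \<alpha>" if "\<alpha> \<in> vecs P0" for \<alpha>
    proof -
      have "p \<in> P0" if "\<alpha> p \<noteq> 0" for p using that \<open>\<alpha> \<in> vecs P0\<close> unfolding vecs_def by blast
      then show ?thesis
        unfolding cov_def using assms
        by (intro exI[of _ "{}"] exI[of _ "{(l, j)}"]) (fastforce simp: P0_def)
    qed
  qed
  moreover have "(if \<forall>p\<in>P0. x p = (\<lambda>(l, j, \<tau>). c \<tau>) p then 1 else 0) = val l j c x" for x
    unfolding val_def by (rule if_cong) (auto simp: P0_def)
  ultimately show ?thesis by simp
qed

text \<open>By \<open>double_annihilator\<close> some dual word detects \<open>a\<close>. Its
  equation has the wrong sign wherever the pattern holds, but the right sign under
  \<open>Ex\<close>, so the value equals its own negative. The pattern and the character of the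
  equation account for the two extra units of width.\<close>

lemma Ex_pat_outside:
  assumes i: "i < m" and a: "a \<in> vecs R" "a \<notin> C0" and f: "LD w f" and w: "w + 2 \<le> wm"
  shows "Ex (\<lambda>x. pat i a x * f x) = 0"
proof -
  have "\<exists>y\<in>Z0. dot R y a \<noteq> 0"
  proof (rule ccontr)
    assume no: "\<not> ?thesis"
    have "a \<in> C0"
      by (rule double_annihilator[of R])
        (use no a C0_vecs C0_0 C0_add in \<open>auto simp: Z0_def R_def[symmetric]\<close>)
    then show False using a by simp
  qed
  then obtain y where y: "y \<in> Z0" "dot R y a \<noteq> 0" by blast
  define z where "z = (\<lambda>i'. if i' = i then y else 0)"
  have zZ: "z \<in> Z" using y zero_Z0 i by (auto simp: Z_def z_def)
  have "sz z \<le> card {i}" unfolding sz_def z_def by (rule card_mono) auto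
  then have szz: "sz z \<le> h" using h_pos by simp
  have covz: "cov 1 (bd z)"
    unfolding cov_def using i bd_support[of z]
    by (intro exI[of _ "{i}"] exI[of _ "{}"]) (fastforce simp: z_def split: if_splits)
  have dz: "(\<Sum>i'<m. dot R (z i') (q i')) = dot R y (q i)" for q
  proof -
    have "(\<Sum>i'<m. dot R (z i') (q i')) = (\<Sum>i'\<in>{i}. dot R (z i') (q i'))"
      by (rule sum.mono_neutral_right) (use i in \<open>auto simp: z_def\<close>)
    then show ?thesis by (simp add: z_def)
  qed
  have point: "chi P (bd z) x * pat i a x = - sign z * pat i a x" for x
  proof (cases "pat i a x = 0")
    case False
    then have "\<And>l \<tau>. l < k \<Longrightarrow> \<tau> < t \<Longrightarrow> x (l, e i l, \<tau>) = a (l, \<tau>) + b i (l, \<tau>)"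
      by (auto simp: pat_def split: if_splits)
    then have "dot R y (pull i x) = dot R y (a + b i)"
      unfolding dot_def by (intro sum.cong refl) (auto simp: pull_def R_def)
    then have "chi P (bd z) x = - sg (dot R y (b i))"
      using y(2) by (simp add: chi_def dot_bd dz dot_add_right sg_add)
    then show ?thesis by (simp add: sign_def dz)
  qed simp
  have "sign z * Ex (\<lambda>x. pat i a x * f x) = Ex (\<lambda>x. chi P (bd z) x * (pat i a x * f x))"
    by (rule Ex_chi_mult[OF zZ szz covz LD_mult[OF LD_pat[OF i] f], symmetric]) (use w in simp)
  also have "\<dots> = Ex (\<lambda>x. (- sign z) * (pat i a x * f x))"
    by (simp only: mult.assoc[symmetric] point)
  also have "\<dots> = - sign z * Ex (\<lambda>x. pat i a x * f x)" by (rule Ex_scale)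
  finally show ?thesis by (simp add: sign_def)
qed

text \<open>Law of total probability restricted to codewords: each assignment reads exactly one
  word, and words outside \<open>C0\<close> contribute nothing. The factor \<open>f\<close> allows
  it to be used after conditioning.\<close>

lemma Ex_sum_pat:
  assumes i: "i < m" and f: "LD w f" and w: "w + 2 \<le> wm"
  shows "(\<Sum>a\<in>C0. Ex (\<lambda>x. pat i a x * f x)) = Ex f"
proof -
  have one: "(\<Sum>a\<in>vecs R. pat i a x) = 1" for x
  proof -
    define a0 where "a0 = pull i x + b i"
    have a0: "a0 \<in> vecs R" using b_vecs[of i] by (auto simp: a0_def vecs_def R_def pull_def)
    have "pat i a x = (if a = a0 then 1 else 0)" if "a \<in> vecs R" for a
    proof -
      have "(\<forall>l<k. \<forall>\<tau><t. x (l, e i l, \<tau>) = a (l, \<tau>) + b i (l, \<tau>)) \<longleftrightarrow> a = a0"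
      proof
        assume *: "\<forall>l<k. \<forall>\<tau><t. x (l, e i l, \<tau>) = a (l, \<tau>) + b i (l, \<tau>)"
        show "a = a0"
        proof (rule ext)
          fix p show "a p = a0 p"
          proof (cases "p \<in> R")
            case True
            then show ?thesis
              using * by (auto simp: a0_def pull_def R_def add.assoc bit_add_self)
          next
            case False
            then have "a p = 0" "a0 p = 0" using that a0 unfolding vecs_def by blast+
            then show ?thesis by simp
          qed
        qed
      next
        assume "a = a0"
        then show "\<forall>l<k. \<forall>\<tau><t. x (l, e i l, \<tau>) = a (l, \<tau>) + b i (l, \<tau>)"
          by (auto simp: a0_def pull_def R_def add.assoc bit_add_self)
      qed
      then show ?thesis by (simp add: pat_def)
    qed
    then have "(\<Sum>a\<in>vecs R. pat i a x) = (\<Sum>a\<in>vecs R. if a = a0 then 1 else 0)" by simp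
    then show ?thesis using a0 by simp
  qed
  have "Ex f = Ex (\<lambda>x. \<Sum>a\<in>vecs R. pat i a x * f x)"
    by (simp add: sum_distrib_right[symmetric] one)
  also have "\<dots> = (\<Sum>a\<in>vecs R. Ex (\<lambda>x. pat i a x * f x))" by (rule Ex_sum)
  also have "\<dots> = (\<Sum>a\<in>C0. Ex (\<lambda>x. pat i a x * f x))"
    by (rule sum.mono_neutral_right)
      (use C0_vecs Ex_pat_outside[OF i _ _ f w] in \<open>auto simp: R_def[symmetric]\<close>)
  finally show ?thesis by simp
qed

end

section \<open>The network and its Lasserre solution\<close>

lemma sum_Un_le:
  fixes g :: "'q \<Rightarrow> real"
  assumes "finite A" "finite B" "\<And>p. p \<in> A \<union> B \<Longrightarrow> 0 \<le> g p"
  shows "sum g (A \<union> B) \<le> sum g A + sum g B"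
proof -
  have "sum g (A \<union> B) + sum g (A \<inter> B) = sum g A + sum g B"
    using assms by (intro sum.union_inter)
  moreover have "0 \<le> sum g (A \<inter> B)" using assms by (intro sum_nonneg) auto
  ultimately show ?thesis by linarith
qed

datatype vtx = Src nat nat | Lab nat "nat \<times> nat \<Rightarrow> bit" | Var nat nat "nat \<Rightarrow> bit" | Trm nat nat nat

text \<open>Multiplicities replace edge weights: constraint \<open>i\<close> has \<open>k\<close> copies \<open>Src i _\<close> of its source and
  variable \<open>(l, j)\<close> has \<open>W\<close> copies \<open>Trm l j _\<close> of its sink, so that the
  label-to-label edges do not dominate the cost.\<close>

locale dsn_gap = label_system m k t N e b C0 s h wm
  for m k t N :: nat and e :: "nat \<Rightarrow> nat \<Rightarrow> nat" and b :: "nat \<Rightarrow> nat \<times> nat \<Rightarrow> bit"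
    and C0 :: "(nat \<times> nat \<Rightarrow> bit) set" and s h wm :: nat +
  fixes W r n :: nat and enc :: "vtx \<Rightarrow> nat" and Vt :: "vtx set"
  assumes Vt: "Vt = (\<lambda>(i, \<alpha>). Src i \<alpha>) ` ({..<m} \<times> {..<k}) \<union> (\<lambda>(i, a). Lab i a) ` ({..<m} \<times> C0)
      \<union> (\<lambda>(l, j, c). Var l j c) ` ({..<k} \<times> {..<N} \<times> vecs {..<t})
      \<union> (\<lambda>(l, j, \<beta>). Trm l j \<beta>) ` ({..<k} \<times> {..<N} \<times> {..<W})"
    and enc_inj: "inj_on enc Vt" and enc_less: "enc ` Vt \<subseteq> {..<n}"
    and r_wm: "4 * r + 8 \<le> wm"
begin

definition cv :: "nat \<Rightarrow> (nat \<times> nat \<Rightarrow> bit) \<Rightarrow> nat \<Rightarrow> nat \<Rightarrow> bit" where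
  "cv i a l = (\<lambda>\<tau>. if \<tau> < t then a (l, \<tau>) + b i (l, \<tau>) else 0)"

definition f1 where "f1 = (\<lambda>(i, \<alpha>, a). (enc (Src i \<alpha>), enc (Lab i a)))"
definition f2 where "f2 = (\<lambda>(i, l, a). (enc (Lab i a), enc (Var l (e i l) (cv i a l))))"
definition f3 where "f3 = (\<lambda>(l, j, \<beta>, c). (enc (Var l j c), enc (Trm l j \<beta>)))"
definition "A1 = {..<m} \<times> {..<k} \<times> C0"
definition "A2 = {..<m} \<times> {..<k} \<times> C0"
definition "A3 = {..<k} \<times> {..<N} \<times> {..<W} \<times> vecs {..<t}"
definition "E = f1 ` A1 \<union> f2 ` A2 \<union> f3 ` A3"
definition "dem = (\<lambda>(i, \<alpha>, l, \<beta>). (enc (Src i \<alpha>), enc (Trm l (e i l) \<beta>)))"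
definition "Dm = dem ` ({..<m} \<times> {..<k} \<times> {..<k} \<times> {..<W})"
definition "ds = (SOME xs. set xs = Dm)"

fun ev0 :: "vtx \<Rightarrow> vtx \<Rightarrow> (nat \<times> nat \<times> nat \<Rightarrow> bit) \<Rightarrow> real" where
  "ev0 (Src i \<alpha>) (Lab i' a) = pat i' a"
| "ev0 (Lab i a) _ = pat i a"
| "ev0 (Var l j c) _ = val l j c"
| "ev0 _ _ = (\<lambda>x. 1)"

definition dec where "dec = inv_into Vt enc"
definition ev :: "nat \<times> nat \<Rightarrow> (nat \<times> nat \<times> nat \<Rightarrow> bit) \<Rightarrow> real" where
  "ev p = ev0 (dec (fst p)) (dec (snd p))"
definition IE :: "(nat \<times> nat) set \<Rightarrow> (nat \<times> nat \<times> nat \<Rightarrow> bit) \<Rightarrow> real" where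
  "IE I x = (if \<forall>p\<in>I. ev p x = 1 then 1 else 0)"
text \<open>The program bounds \<open>y I\<close> between 0 and 1 even for large \<open>I\<close>,
  where nothing controls the sign of \<open>Ex\<close>; the value 0 settles these. The matrices read
  only unions of at most \<open>2 * r + 2\<close> edges.\<close>

definition y :: "(nat \<times> nat) set \<Rightarrow> real" where
  "y I = (if card I \<le> 2 * r + 2 then Ex (IE I) else 0)"

lemma Vt_intros [simp]:
  "i < m \<Longrightarrow> \<alpha> < k \<Longrightarrow> Src i \<alpha> \<in> Vt"
  "i < m \<Longrightarrow> a \<in> C0 \<Longrightarrow> Lab i a \<in> Vt"
  "l < k \<Longrightarrow> j < N \<Longrightarrow> c \<in> vecs {..<t} \<Longrightarrow> Var l j c \<in> Vt"
  "l < k \<Longrightarrow> j < N \<Longrightarrow> \<beta> < W \<Longrightarrow> Trm l j \<beta> \<in> Vt"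
  by (simp_all add: Vt image_iff Bex_def)

lemma cv_vecs [simp]: "cv i a l \<in> vecs {..<t}"
  by (simp add: cv_def vecs_def)

lemma dec_enc [simp]: "u \<in> Vt \<Longrightarrow> dec (enc u) = u"
  by (simp add: dec_def enc_inj)

lemma enc_eq_iff [simp]: "u \<in> Vt \<Longrightarrow> u' \<in> Vt \<Longrightarrow> enc u = enc u' \<longleftrightarrow> u = u'"
  using enc_inj by (auto dest: inj_onD)

lemma enc_n [simp]: "u \<in> Vt \<Longrightarrow> enc u < n"
  using enc_less by auto

lemma ev_f1: "i < m \<Longrightarrow> \<alpha> < k \<Longrightarrow> a \<in> C0 \<Longrightarrow> ev (f1 (i, \<alpha>, a)) = pat i a"
  by (simp add: ev_def f1_def)

lemma ev_f2: "i < m \<Longrightarrow> l < k \<Longrightarrow> a \<in> C0 \<Longrightarrow> ev (f2 (i, l, a)) = pat i a"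
  by (simp add: ev_def f2_def)

lemma ev_f3: "l < k \<Longrightarrow> j < N \<Longrightarrow> \<beta> < W \<Longrightarrow> c \<in> vecs {..<t} \<Longrightarrow> ev (f3 (l, j, \<beta>, c)) = val l j c"
  by (simp add: ev_def f3_def)

lemma finite_A: "finite A1" "finite A2" "finite A3"
  by (simp_all add: A1_def A2_def A3_def finite_C0)

lemma finite_E [simp]: "finite E"
  by (simp add: E_def finite_A)

lemma set_ds: "set ds = Dm"
proof -
  have "finite Dm" by (simp add: Dm_def)
  then show ?thesis unfolding ds_def by (rule someI_ex[OF finite_list])
qed

lemma ev_01: "ev p x = 0 \<or> ev p x = 1"
  unfolding ev_def by (cases "(dec (fst p), dec (snd p))" rule: ev0.cases) (auto simp: pat_def val_def)

lemma LD_ev: "p \<in> E \<Longrightarrow> LD 1 (ev p)"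
  unfolding E_def A1_def A2_def A3_def
  by (auto simp: ev_f1 ev_f2 ev_f3 intro: LD_pat[unfolded One_nat_def] LD_val[unfolded One_nat_def])

lemma IE_Un: "IE (I \<union> J) x = IE I x * IE J x"
  unfolding IE_def ball_Un by simp

lemma IE_single: "IE {p} x = ev p x"
  using ev_01[of p x] by (auto simp: IE_def)

lemma IE_prod: "finite I \<Longrightarrow> IE I x = (\<Prod>p\<in>I. ev p x)"
proof (induction I rule: finite_induct)
  case empty
  then show ?case by (simp add: IE_def)
next
  case (insert p I)
  then show ?case using IE_Un[of "{p}" I x] IE_single[of p x] by simp
qed

lemma LD_IE:
  assumes "I \<subseteq> E" "card I \<le> w"
  shows "LD w (IE I)"
proof -
  have fin: "finite I" using assms finite_subset finite_E by blast
  have "LD (card I) (\<lambda>x. \<Prod>p\<in>I. ev p x)" using assms LD_ev by (intro LD_prod fin) auto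
  moreover have "(\<lambda>x. \<Prod>p\<in>I. ev p x) = IE I" using IE_prod[OF fin] by auto
  ultimately show ?thesis using LD_mono assms(2) by metis
qed

lemma IE_idem: "IE I x * IE I x = IE I x"
  by (simp add: IE_def)

section \<open>Feasibility of the pseudo-moments\<close>

lemma y_bounds:
  assumes "I \<subseteq> E"
  shows "0 \<le> y I" "y I \<le> 1"
proof -
  have "0 \<le> Ex (IE I) \<and> Ex (IE I) \<le> 1" if c: "card I \<le> 2 * r + 2"
  proof
    have ld: "LD (2 * r + 2) (IE I)" using LD_IE[OF assms c] .
    have w: "2 * (2 * r + 2) \<le> wm" using r_wm by simp
    show "0 \<le> Ex (IE I)" using Ex_square_nonneg[OF ld w] by (simp add: IE_idem)
    have "0 \<le> Ex (\<lambda>x. (1 - IE I x) * (1 - IE I x))"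
      by (rule Ex_square_nonneg[OF LD_diff[OF LD_mono[OF LD_const] ld] w]) simp
    also have "(\<lambda>x. (1 - IE I x) * (1 - IE I x)) = (\<lambda>x. 1 - IE I x)"
      using IE_idem by (auto simp: algebra_simps)
    finally show "Ex (IE I) \<le> 1" by (simp add: Ex_diff Ex_const)
  qed
  then show "0 \<le> y I" "y I \<le> 1" by (auto simp: y_def)
qed

lemma finite_small [simp]: "finite (small_subsets E q)"
  by (rule finite_subset[of _ "Pow E"]) (auto simp: small_subsets_def)

lemma LD_comb:
  "LD q (\<lambda>x. \<Sum>I\<in>small_subsets E q. c I * IE I x)"
  by (intro LD_sum LD_scale LD_IE) (auto simp: small_subsets_def)

text \<open>With \<open>X = {}\<close> this is the form of a moment matrix; with
  \<open>X = {p}\<close> it is the contribution of the edge \<open>p\<close> to a cut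
  matrix.\<close>

lemma quad_form:
  assumes X: "X \<subseteq> E" "card X + 2 * q \<le> 2 * r + 2"
  shows "(\<Sum>I\<in>small_subsets E q. \<Sum>J\<in>small_subsets E q. c I * y (I \<union> J \<union> X) * c J)
    = Ex (\<lambda>x. IE X x * ((\<Sum>I\<in>small_subsets E q. c I * IE I x) * (\<Sum>I\<in>small_subsets E q. c I * IE I x)))"
proof -
  have "Ex (\<lambda>x. IE X x * ((\<Sum>I\<in>small_subsets E q. c I * IE I x) * (\<Sum>I\<in>small_subsets E q. c I * IE I x)))
     = Ex (\<lambda>x. \<Sum>I\<in>small_subsets E q. \<Sum>J\<in>small_subsets E q. (c I * c J) * IE (I \<union> J \<union> X) x)"
    by (rule Ex_cong) (simp add: sum_product sum_distrib_left IE_Un mult_ac)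
  also have "\<dots> = (\<Sum>I\<in>small_subsets E q. \<Sum>J\<in>small_subsets E q. c I * y (I \<union> J \<union> X) * c J)"
    unfolding Ex_sum Ex_scale
  proof (intro sum.cong refl)
    fix I J assume "I \<in> small_subsets E q" "J \<in> small_subsets E q"
    then have "card (I \<union> J \<union> X) \<le> 2 * r + 2"
      using card_Un_le[of I J] card_Un_le[of "I \<union> J" X] X by (auto simp: small_subsets_def)
    then show "c I * c J * Ex (IE (I \<union> J \<union> X)) = c I * y (I \<union> J \<union> X) * c J"
      by (simp add: y_def)
  qed
  finally show ?thesis by simp
qed

lemma psd_moment: "psd_on (small_subsets E (r + 1)) (\<lambda>I J. y (I \<union> J))"
  unfolding psd_on_def
proof
  fix c :: "(nat \<times> nat) set \<Rightarrow> real"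
  let ?f = "\<lambda>x. \<Sum>I\<in>small_subsets E (r + 1). c I * IE I x"
  have "(\<Sum>I\<in>small_subsets E (r + 1). \<Sum>J\<in>small_subsets E (r + 1). c I * y (I \<union> J) * c J)
      = Ex (\<lambda>x. IE {} x * (?f x * ?f x))"
    using quad_form[of "{}" "r + 1" c] by simp
  also have "\<dots> = Ex (\<lambda>x. ?f x * ?f x)" by (simp add: IE_def)
  also have "\<dots> \<ge> 0" by (rule Ex_square_nonneg[OF LD_comb]) (use r_wm in simp)
  finally show "0 \<le> (\<Sum>I\<in>small_subsets E (r + 1). \<Sum>J\<in>small_subsets E (r + 1). c I * y (I \<union> J) * c J)" .
qed

lemma pat_val:
  assumes "c \<in> vecs {..<t}" "l < k"
  shows "pat i a x * val l (e i l) c x = (if cv i a l = c then pat i a x else 0)"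
proof (cases "pat i a x = 0")
  case False
  then have *: "\<And>\<tau>. \<tau> < t \<Longrightarrow> x (l, e i l, \<tau>) = cv i a l \<tau>"
    using assms by (auto simp: pat_def cv_def split: if_splits)
  have "(\<forall>\<tau><t. x (l, e i l, \<tau>) = c \<tau>) \<longleftrightarrow> cv i a l = c"
  proof
    assume "\<forall>\<tau><t. x (l, e i l, \<tau>) = c \<tau>"
    then show "cv i a l = c" using * assms by (auto simp: fun_eq_iff vecs_def cv_def)
  qed (use * in auto)
  then show ?thesis by (simp add: val_def)
qed simp

text \<open>The numbers \<open>pa a\<close> form a flow: \<open>Ex\<close> of the square splits into
  one path for each codeword \<open>a\<close>, carrying \<open>pa a\<close>, and every edge
  \<open>p\<close> on these paths carries \<open>q p\<close> in total. Each path has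
  \<open>z\<close>-weight at least 1, so the weighted flow is at least the whole flow. All other
  edges add nonnegative terms.\<close>

lemma psd_cut:
  assumes i: "i < m" "\<alpha> < k" and l: "l < k" "\<beta> < W"
    and z: "z \<in> cut_vectors E (enc (Src i \<alpha>)) (enc (Trm l (e i l) \<beta>))"
  shows "psd_on (small_subsets E r) (\<lambda>I J. (\<Sum>p\<in>E. z p * y (I \<union> J \<union> {p})) - y (I \<union> J))"
  unfolding psd_on_def
proof
  fix c :: "(nat \<times> nat) set \<Rightarrow> real"
  let ?S = "small_subsets E r"
  define f where "f = (\<lambda>x. \<Sum>I\<in>?S. c I * IE I x)"
  have jN: "e i l < N" using e_less i l by simp
  have LDf: "LD r f" unfolding f_def by (rule LD_comb)
  have LDff: "LD (2 * r) (\<lambda>x. f x * f x)" using LD_mult[OF LDf LDf] by (simp add: mult_2)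
  define q where "q p = Ex (\<lambda>x. ev p x * (f x * f x))" for p
  define pa where "pa a = Ex (\<lambda>x. pat i a x * (f x * f x))" for a
  have z01: "\<And>p. p \<in> E \<Longrightarrow> 0 \<le> z p" using z by (auto simp: cut_vectors_def)
  have q_nonneg: "0 \<le> q p" if p: "p \<in> E" for p
  proof -
    have "LD (r + 1) (\<lambda>x. ev p x * f x)" using LD_mult[OF LD_ev[OF p] LDf] by simp
    then have "0 \<le> Ex (\<lambda>x. (ev p x * f x) * (ev p x * f x))"
      by (rule Ex_square_nonneg) (use r_wm in simp)
    also have "(\<lambda>x. (ev p x * f x) * (ev p x * f x)) = (\<lambda>x. ev p x * (f x * f x))"
    proof
      fix x show "(ev p x * f x) * (ev p x * f x) = ev p x * (f x * f x)"
        using ev_01[of p x] by auto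
    qed
    finally show ?thesis by (simp add: q_def)
  qed
  have "(\<Sum>I\<in>?S. \<Sum>J\<in>?S. c I * ((\<Sum>p\<in>E. z p * y (I \<union> J \<union> {p})) - y (I \<union> J)) * c J)
      = (\<Sum>I\<in>?S. \<Sum>J\<in>?S. (\<Sum>p\<in>E. z p * (c I * y (I \<union> J \<union> {p}) * c J)) - c I * y (I \<union> J) * c J)"
    by (intro sum.cong refl) (simp add: algebra_simps sum_distrib_left sum_distrib_right)
  also have "\<dots> = (\<Sum>I\<in>?S. \<Sum>J\<in>?S. \<Sum>p\<in>E. z p * (c I * y (I \<union> J \<union> {p}) * c J))
      - (\<Sum>I\<in>?S. \<Sum>J\<in>?S. c I * y (I \<union> J) * c J)"
    by (simp add: sum_subtractf)
  also have "(\<Sum>I\<in>?S. \<Sum>J\<in>?S. \<Sum>p\<in>E. z p * (c I * y (I \<union> J \<union> {p}) * c J))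
      = (\<Sum>I\<in>?S. \<Sum>p\<in>E. \<Sum>J\<in>?S. z p * (c I * y (I \<union> J \<union> {p}) * c J))"
    by (rule sum.cong[OF refl], rule sum.swap)
  also have "\<dots> = (\<Sum>p\<in>E. \<Sum>I\<in>?S. \<Sum>J\<in>?S. z p * (c I * y (I \<union> J \<union> {p}) * c J))"
    by (rule sum.swap)
  also have "\<dots> = (\<Sum>p\<in>E. z p * q p)"
  proof (rule sum.cong[OF refl])
    fix p assume "p \<in> E"
    then have "(\<Sum>I\<in>?S. \<Sum>J\<in>?S. c I * y (I \<union> J \<union> {p}) * c J) = q p"
      using quad_form[of "{p}" r c] by (simp add: q_def f_def IE_single)
    then show "(\<Sum>I\<in>?S. \<Sum>J\<in>?S. z p * (c I * y (I \<union> J \<union> {p}) * c J)) = z p * q p"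
      by (simp add: sum_distrib_left[symmetric])
  qed
  also have "(\<Sum>I\<in>?S. \<Sum>J\<in>?S. c I * y (I \<union> J) * c J) = Ex (\<lambda>x. f x * f x)"
    using quad_form[of "{}" r c] by (simp add: f_def IE_def)
  finally have form: "(\<Sum>I\<in>?S. \<Sum>J\<in>?S. c I * ((\<Sum>p\<in>E. z p * y (I \<union> J \<union> {p})) - y (I \<union> J)) * c J)
      = (\<Sum>p\<in>E. z p * q p) - Ex (\<lambda>x. f x * f x)" .
  define e1 where "e1 a = f1 (i, \<alpha>, a)" for a
  define e2 where "e2 a = f2 (i, l, a)" for a
  define e3 where "e3 c = f3 (l, e i l, \<beta>, c)" for c
  let ?V = "vecs {..<t} :: (nat \<Rightarrow> bit) set"
  have sub: "e1 ` C0 \<subseteq> E" "e2 ` C0 \<subseteq> E" "e3 ` ?V \<subseteq> E"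
    using i l jN by (auto simp: E_def A1_def A2_def A3_def e1_def e2_def e3_def)
  have inj: "inj_on e1 C0" "inj_on e2 C0" "inj_on e3 ?V"
    using i l jN by (auto simp: inj_on_def e1_def e2_def e3_def f1_def f2_def f3_def)
  have disj: "e1 ` C0 \<inter> e2 ` C0 = {}" "(e1 ` C0 \<union> e2 ` C0) \<inter> e3 ` ?V = {}"
    using i l jN by (auto simp: e1_def e2_def e3_def f1_def f2_def f3_def)
  have q1: "q (e1 a) = pa a" and q2: "q (e2 a) = pa a" if "a \<in> C0" for a
    using that i l by (simp_all add: q_def pa_def e1_def e2_def ev_f1 ev_f2)
  \<comment> \<open>Flow conservation at a value vertex: total probability over the codewords of
    constraint \<open>i\<close> splits the weight of a value among the codewords that produce
    it.\<close>
  have q3: "q (e3 d) = (\<Sum>a\<in>C0. if cv i a l = d then pa a else 0)" if d: "d \<in> ?V" for d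
  proof -
    have "LD (2 * r + 1) (\<lambda>x. val l (e i l) d x * (f x * f x))"
      using LD_mult[OF LD_val[OF l(1) jN] LDff] by (simp add: add.commute)
    from Ex_sum_pat[OF i(1) this]
    have "q (e3 d) = (\<Sum>a\<in>C0. Ex (\<lambda>x. pat i a x * (val l (e i l) d x * (f x * f x))))"
      using r_wm d l jN by (simp add: q_def e3_def ev_f3)
    also have "\<dots> = (\<Sum>a\<in>C0. if cv i a l = d then pa a else 0)"
    proof (rule sum.cong[OF refl])
      fix a
      show "Ex (\<lambda>x. pat i a x * (val l (e i l) d x * (f x * f x))) = (if cv i a l = d then pa a else 0)"
        by (simp add: mult.assoc[symmetric] pat_val[OF d l(1)] pa_def Ex_const)
    qed
    finally show ?thesis .
  qed
  have path: "1 \<le> z (e1 a) + z (e2 a) + z (e3 (cv i a l))" if a: "a \<in> C0" for a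
  proof -
    define xs where "xs = [enc (Src i \<alpha>), enc (Lab i a), enc (Var l (e i l) (cv i a l)), enc (Trm l (e i l) \<beta>)]"
    have eqs: "e1 a = (enc (Src i \<alpha>), enc (Lab i a))" "e2 a = (enc (Lab i a), enc (Var l (e i l) (cv i a l)))"
      "e3 (cv i a l) = (enc (Var l (e i l) (cv i a l)), enc (Trm l (e i l) \<beta>))"
      by (simp_all add: e1_def e2_def e3_def f1_def f2_def f3_def)
    have inE: "e1 a \<in> E" "e2 a \<in> E" "e3 (cv i a l) \<in> E" using sub a by auto
    have "is_path E (enc (Src i \<alpha>)) (enc (Trm l (e i l) \<beta>)) xs"
      unfolding is_path_def xs_def using i l jN a inE[unfolded eqs]
      by (auto simp: less_Suc_eq)
    then have "1 \<le> (\<Sum>p\<in>path_edges xs. z p)" using z by (auto simp: cut_vectors_def)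
    also have "path_edges xs = {e1 a, e2 a, e3 (cv i a l)}"
      by (simp add: path_edges_def xs_def eqs)
    also have "(\<Sum>p\<in>\<dots>. z p) = z (e1 a) + z (e2 a) + z (e3 (cv i a l))"
      using i l jN a by (simp add: eqs)
    finally show ?thesis .
  qed
  have pa_nonneg: "0 \<le> pa a" if "a \<in> C0" for a
    using q_nonneg[of "e1 a"] q1[OF that] sub that by auto
  have "Ex (\<lambda>x. f x * f x) = (\<Sum>a\<in>C0. pa a)"
    unfolding pa_def by (rule Ex_sum_pat[OF i(1) LDff, symmetric]) (use r_wm in simp)
  also have "\<dots> \<le> (\<Sum>a\<in>C0. (z (e1 a) + z (e2 a) + z (e3 (cv i a l))) * pa a)"
    using mult_right_mono[OF path pa_nonneg] by (intro sum_mono) simp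
  also have "\<dots> = (\<Sum>a\<in>C0. z (e1 a) * pa a) + (\<Sum>a\<in>C0. z (e2 a) * pa a) + (\<Sum>a\<in>C0. z (e3 (cv i a l)) * pa a)"
    by (simp add: distrib_right sum.distrib)
  also have "(\<Sum>a\<in>C0. z (e1 a) * pa a) = (\<Sum>p\<in>e1 ` C0. z p * q p)"
    by (simp add: sum.reindex[OF inj(1)] q1)
  also have "(\<Sum>a\<in>C0. z (e2 a) * pa a) = (\<Sum>p\<in>e2 ` C0. z p * q p)"
    by (simp add: sum.reindex[OF inj(2)] q2)
  also have "(\<Sum>a\<in>C0. z (e3 (cv i a l)) * pa a) = (\<Sum>p\<in>e3 ` ?V. z p * q p)"
  proof -
    have "(\<Sum>p\<in>e3 ` ?V. z p * q p) = (\<Sum>d\<in>?V. z (e3 d) * (\<Sum>a\<in>C0. if cv i a l = d then pa a else 0))"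
      by (simp add: sum.reindex[OF inj(3)] q3)
    also have "\<dots> = (\<Sum>d\<in>?V. \<Sum>a\<in>C0. if cv i a l = d then z (e3 d) * pa a else 0)"
      by (simp add: sum_distrib_left if_distrib cong: if_cong)
    also have "\<dots> = (\<Sum>a\<in>C0. \<Sum>d\<in>?V. if cv i a l = d then z (e3 d) * pa a else 0)"
      by (rule sum.swap)
    also have "\<dots> = (\<Sum>a\<in>C0. z (e3 (cv i a l)) * pa a)" by simp
    finally show ?thesis by simp
  qed
  also have "(\<Sum>p\<in>e1 ` C0. z p * q p) + (\<Sum>p\<in>e2 ` C0. z p * q p) + (\<Sum>p\<in>e3 ` ?V. z p * q p)
      = (\<Sum>p\<in>e1 ` C0 \<union> e2 ` C0 \<union> e3 ` ?V. z p * q p)"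
    by (subst sum.union_disjoint; (subst sum.union_disjoint)?) (use disj finite_C0 in auto)
  also have "\<dots> \<le> (\<Sum>p\<in>E. z p * q p)"
    by (rule sum_mono2) (use sub z01 q_nonneg in auto)
  finally show "0 \<le> (\<Sum>I\<in>?S. \<Sum>J\<in>?S. c I * ((\<Sum>p\<in>E. z p * y (I \<union> J \<union> {p})) - y (I \<union> J)) * c J)"
    unfolding form by simp
qed

lemma feasible_y: "sdp_dsn_feasible E ds r y"
  unfolding sdp_dsn_feasible_def
proof (intro conjI allI impI)
  show "0 \<le> y I" "y I \<le> 1" if "I \<subseteq> E" for I using y_bounds[OF that] .
  show "y {} = 1" by (simp add: y_def IE_def[abs_def] Ex_const)
  show "psd_on (small_subsets E (r + 1)) (\<lambda>I J. y (I \<union> J))" by (rule psd_moment)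
  show "\<forall>(u, v)\<in>set ds. \<forall>z\<in>cut_vectors E u v.
      psd_on (small_subsets E r) (\<lambda>I J. (\<Sum>e\<in>E. z e * y (I \<union> J \<union> {e})) - y (I \<union> J))"
    unfolding set_ds Dm_def dem_def using psd_cut by auto
qed

section \<open>Bounds on the value of the relaxation\<close>

lemma sum_y_image_le:
  assumes "finite A" "g ` A \<subseteq> E"
  shows "(\<Sum>p\<in>g ` A. y {p}) \<le> (\<Sum>p\<in>A. y {g p})"
proof -
  have "0 \<le> y {g p}" if "p \<in> A" for p
    by (rule y_bounds) (use assms(2) that in blast)
  then show ?thesis
    using sum_image_le[OF assms(1), of "\<lambda>p. y {p}" g] by (simp add: o_def)
qed

text \<open>For every pair of a constraint with a source copy, or with a position, the codeword
  events have total pseudo-probability 1; so do the value events at every sink copy.\<close>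

lemma cost_y: "(\<Sum>p\<in>E. y {p}) \<le> real (2 * m * k + k * N * W)"
proof -
  have yev: "y {p} = Ex (ev p)" for p
    by (simp add: y_def IE_single[abs_def])
  have nn: "0 \<le> y {p}" if "p \<in> E" for p using y_bounds that by auto
  have patsum: "(\<Sum>a\<in>C0. Ex (pat i a)) = 1" if "i < m" for i
    using Ex_sum_pat[OF that LD_const[of 1]] r_wm by (simp add: Ex_const)
  have valsum: "(\<Sum>c\<in>vecs {..<t}. Ex (val l j c)) = 1" for l j
  proof -
    have "(\<Sum>c\<in>vecs {..<t}. val l j c x) = 1" for x
    proof -
      define c0 where "c0 = (\<lambda>\<tau>. if \<tau> < t then x (l, j, \<tau>) else 0)"
      have c0: "c0 \<in> vecs {..<t}" by (simp add: c0_def vecs_def)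
      have "val l j c x = (if c = c0 then 1 else 0)" if "c \<in> vecs {..<t}" for c
        using that by (auto simp: val_def c0_def fun_eq_iff vecs_def)
      then have "(\<Sum>c\<in>vecs {..<t}. val l j c x) = (\<Sum>c\<in>vecs {..<t}. if c = c0 then 1 else 0)"
        by simp
      then show ?thesis using c0 by simp
    qed
    then show ?thesis by (simp add: Ex_sum[symmetric] Ex_const)
  qed
  have "(\<Sum>p\<in>E. y {p}) \<le> (\<Sum>p\<in>f1 ` A1. y {p}) + (\<Sum>p\<in>f2 ` A2. y {p}) + (\<Sum>p\<in>f3 ` A3. y {p})"
  proof -
    have "(\<Sum>p\<in>E. y {p}) \<le> (\<Sum>p\<in>f1 ` A1 \<union> f2 ` A2. y {p}) + (\<Sum>p\<in>f3 ` A3. y {p})"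
      unfolding E_def by (rule sum_Un_le) (blast intro: finite_imageI finite_A nn[unfolded E_def])+
    moreover have "(\<Sum>p\<in>f1 ` A1 \<union> f2 ` A2. y {p}) \<le> (\<Sum>p\<in>f1 ` A1. y {p}) + (\<Sum>p\<in>f2 ` A2. y {p})"
      by (rule sum_Un_le) (blast intro: finite_imageI finite_A nn[unfolded E_def])+
    ultimately show ?thesis by linarith
  qed
  also have "\<dots> \<le> (\<Sum>p\<in>A1. y {f1 p}) + (\<Sum>p\<in>A2. y {f2 p}) + (\<Sum>p\<in>A3. y {f3 p})"
    by (intro add_mono sum_y_image_le finite_A) (auto simp: E_def)
  also have "(\<Sum>p\<in>A1. y {f1 p}) = (\<Sum>i<m. \<Sum>\<alpha><k. \<Sum>a\<in>C0. Ex (pat i a))"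
    unfolding A1_def sum.cartesian_product yev by (intro sum.cong refl) (auto simp: ev_f1)
  also have "\<dots> = m * k" using patsum by simp
  also have "(\<Sum>p\<in>A2. y {f2 p}) = (\<Sum>i<m. \<Sum>l<k. \<Sum>a\<in>C0. Ex (pat i a))"
    unfolding A2_def sum.cartesian_product yev by (intro sum.cong refl) (auto simp: ev_f2)
  also have "\<dots> = m * k" using patsum by simp
  also have "(\<Sum>p\<in>A3. y {f3 p}) = (\<Sum>l<k. \<Sum>j<N. \<Sum>\<beta><W. \<Sum>c\<in>vecs {..<t}. Ex (val l j c))"
    unfolding A3_def sum.cartesian_product yev by (intro sum.cong refl) (auto simp: ev_f3)
  also have "\<dots> = k * N * W" using valsum by simp
  finally show ?thesis by (simp add: algebra_simps)
qed

lemma sdp_value_le: "sdp_dsn_value E ds r \<le> real (2 * m * k + k * N * W)"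
proof -
  have "bdd_below ((\<lambda>y. \<Sum>e\<in>E. y {e}) ` {y. sdp_dsn_feasible E ds r y})"
    by (rule bdd_belowI[of _ 0]) (auto simp: sdp_dsn_feasible_def intro!: sum_nonneg)
  then have "sdp_dsn_value E ds r \<le> (\<Sum>p\<in>E. y {p})"
    unfolding sdp_dsn_value_def using feasible_y by (intro cInf_lower) auto
  then show ?thesis using cost_y by linarith
qed

text \<open>The gap divides by this value, so it must be bounded away from 0. The constant 1 is a
  cut vector because a path between distinct vertices has an edge, and the entry of its matrix at
  the two empty sets gives the bound.\<close>

lemma sdp_value_ge:
  assumes "0 < m" "0 < k" "0 < W"
  shows "1 \<le> sdp_dsn_value E ds r"
  unfolding sdp_dsn_value_def
proof (rule cInf_greatest)
  show "(\<lambda>y. \<Sum>e\<in>E. y {e}) ` {y. sdp_dsn_feasible E ds r y} \<noteq> {}" using feasible_y by auto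
next
  fix v assume "v \<in> (\<lambda>y. \<Sum>e\<in>E. y {e}) ` {y. sdp_dsn_feasible E ds r y}"
  then obtain y' where y': "sdp_dsn_feasible E ds r y'" "v = (\<Sum>p\<in>E. y' {p})" by auto
  let ?u = "enc (Src 0 0)" and ?v = "enc (Trm 0 (e 0 0) 0)"
  have uv: "(?u, ?v) \<in> set ds"
    unfolding set_ds Dm_def dem_def
    by (rule image_eqI[where x = "(0, 0, 0, 0)"]) (use assms in auto)
  have ne: "?u \<noteq> ?v" using assms e_less by simp
  have "1 \<le> (\<Sum>p\<in>path_edges xs. 1 :: real)" if "is_path E ?u ?v xs" for xs
  proof -
    have hd_last: "xs \<noteq> []" "hd xs \<noteq> last xs" using that ne by (simp_all add: is_path_def)
    then obtain a a' ys where "xs = a # a' # ys" by (cases xs; cases "tl xs") auto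
    then have "path_edges xs \<noteq> {}" by (simp add: path_edges_def)
    then have "card (path_edges xs) \<ge> 1" by (simp add: Suc_leI card_gt_0_iff path_edges_def)
    then show ?thesis by simp
  qed
  then have one: "(\<lambda>_. 1) \<in> cut_vectors E ?u ?v" by (simp add: cut_vectors_def)
  have "psd_on (small_subsets E r) (\<lambda>I J. (\<Sum>p\<in>E. 1 * y' (I \<union> J \<union> {p})) - y' (I \<union> J))"
  proof -
    have "\<forall>(u, v)\<in>set ds. \<forall>z\<in>cut_vectors E u v.
      psd_on (small_subsets E r) (\<lambda>I J. (\<Sum>e\<in>E. z e * y' (I \<union> J \<union> {e})) - y' (I \<union> J))"
      using y'(1) unfolding sdp_dsn_feasible_def by (elim conjE)
    from bspec[OF this uv] one show ?thesis unfolding prod.case by (rule bspec)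
  qed
  then have nonneg: "0 \<le> (\<Sum>I\<in>small_subsets E r. \<Sum>J\<in>small_subsets E r. (if I = {} then 1 else 0) *
      ((\<Sum>p\<in>E. y' (I \<union> J \<union> {p})) - y' (I \<union> J)) * (if J = {} then 1 else 0))"
    unfolding psd_on_def mult_1 by (rule spec)
  have empty: "{} \<in> small_subsets E r" by (simp add: small_subsets_def)
  have "(\<Sum>I\<in>small_subsets E r. \<Sum>J\<in>small_subsets E r. (if I = {} then 1 else 0) *
      ((\<Sum>p\<in>E. y' (I \<union> J \<union> {p})) - y' (I \<union> J)) * (if J = {} then 1 else 0)) = (\<Sum>I\<in>small_subsets E r. \<Sum>J\<in>small_subsets E r. if J = {} then
      (if I = {} then (\<Sum>p\<in>E. y' {p}) - y' {} else 0) else 0)"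
    by (intro sum.cong refl) auto
  also have "\<dots> = (\<Sum>p\<in>E. y' {p}) - y' {}"
    using empty by simp
  finally show "1 \<le> v" using y' nonneg by (simp add: sdp_dsn_feasible_def)
qed

lemma dsn_instance_E: "dsn_instance n E ds"
  unfolding dsn_instance_def set_ds
proof
  show "E \<subseteq> {..<n} \<times> {..<n}"
    by (auto simp: E_def A1_def A2_def A3_def f1_def f2_def f3_def e_less)
  show "Dm \<subseteq> {..<n} \<times> {..<n}"
    by (auto simp: Dm_def dem_def e_less)
qed

lemma dsn_solution_E: "dsn_solution E ds E"
  unfolding dsn_solution_def set_ds
proof (intro conjI subset_refl ballI)
  fix d assume "d \<in> Dm"
  then obtain i \<alpha> l \<beta> where d: "d = dem (i, \<alpha>, l, \<beta>)" "i < m" "\<alpha> < k" "l < k" "\<beta> < W"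
    by (auto simp: Dm_def)
  have "f1 (i, \<alpha>, 0) \<in> E" "f2 (i, l, 0) \<in> E" "f3 (l, e i l, \<beta>, cv i 0 l) \<in> E"
    using d C0_0 e_less by (auto simp: E_def A1_def A2_def A3_def)
  then have "(enc (Src i \<alpha>), enc (Lab i 0)) \<in> E"
    "(enc (Lab i 0), enc (Var l (e i l) (cv i 0 l))) \<in> E"
    "(enc (Var l (e i l) (cv i 0 l)), enc (Trm l (e i l) \<beta>)) \<in> E"
    by (simp_all add: f1_def f2_def f3_def)
  then have "(enc (Src i \<alpha>), enc (Trm l (e i l) \<beta>)) \<in> E\<^sup>*"
    by (meson r_into_rtrancl rtrancl_trans)
  then show "case d of (u, v) \<Rightarrow> (u, v) \<in> E\<^sup>*" by (simp add: d dem_def)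
qed

end

section \<open>Integral solutions\<close>

context dsn_gap
begin

lemma out_Src:
  assumes "(enc (Src i \<alpha>), u) \<in> E" "i < m" "\<alpha> < k"
  shows "\<exists>a\<in>C0. u = enc (Lab i a)"
  using assms by (auto simp: E_def A1_def A2_def A3_def f1_def f2_def f3_def e_less)

lemma out_Lab:
  assumes "(enc (Lab i a), u) \<in> E" "i < m" "a \<in> C0"
  shows "\<exists>l<k. u = enc (Var l (e i l) (cv i a l))"
  using assms by (auto simp: E_def A1_def A2_def A3_def f1_def f2_def f3_def e_less)

lemma out_Var:
  assumes "(enc (Var l j c), u) \<in> E" "l < k" "j < N" "c \<in> vecs {..<t}"
  shows "\<exists>\<beta><W. u = enc (Trm l j \<beta>)"
  using assms by (auto simp: E_def A1_def A2_def A3_def f1_def f2_def f3_def e_less)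

lemma out_Trm:
  assumes "(enc (Trm l j \<beta>), u) \<in> E" "l < k" "j < N" "\<beta> < W"
  shows False
  using assms by (auto simp: E_def A1_def A2_def A3_def f1_def f2_def f3_def e_less)

text \<open>The network has four layers and every edge leads to the next, so the path has exactly
  three edges; its last edge forces the variable and the sink copy.\<close>

lemma reachable_label:
  assumes F: "F \<subseteq> E" and path: "(enc (Src i \<alpha>), enc (Trm l (e i l) \<beta>)) \<in> F\<^sup>*"
    and i: "i < m" "\<alpha> < k" "l < k" "\<beta> < W"
  shows "\<exists>a\<in>C0. f1 (i, \<alpha>, a) \<in> F \<and> f3 (l, e i l, \<beta>, cv i a l) \<in> F"
proof -
  note jN = e_less[OF i(1,3)]
  have ne: "enc (Src i \<alpha>) \<noteq> enc (Trm l (e i l) \<beta>)" using i jN by simp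
  obtain u where u: "(enc (Src i \<alpha>), u) \<in> F" "(u, enc (Trm l (e i l) \<beta>)) \<in> F\<^sup>*"
    using path ne by (meson converse_rtranclE)
  obtain a where a: "a \<in> C0" "u = enc (Lab i a)" using out_Src u F i by blast
  have "u \<noteq> enc (Trm l (e i l) \<beta>)" using a i jN by simp
  then obtain u' where u': "(u, u') \<in> F" "(u', enc (Trm l (e i l) \<beta>)) \<in> F\<^sup>*"
    using u(2) by (meson converse_rtranclE)
  obtain l' where l': "l' < k" "u' = enc (Var l' (e i l') (cv i a l'))"
    using out_Lab[of i a u'] u'(1) a F i by auto
  have jN': "e i l' < N" using e_less i l' by simp
  have "u' \<noteq> enc (Trm l (e i l) \<beta>)" using l' i jN jN' by simp
  then obtain u'' where u'': "(u', u'') \<in> F" "(u'', enc (Trm l (e i l) \<beta>)) \<in> F\<^sup>*"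
    using u'(2) by (meson converse_rtranclE)
  obtain \<beta>' where b': "\<beta>' < W" "u'' = enc (Trm l' (e i l') \<beta>')"
    using out_Var[of l' "e i l'" "cv i a l'" u''] u''(1) l' jN' F by auto
  have "u'' = enc (Trm l (e i l) \<beta>)"
  proof (rule ccontr)
    assume "u'' \<noteq> enc (Trm l (e i l) \<beta>)"
    then obtain u3 where "(u'', u3) \<in> F" using u''(2) by (meson converse_rtranclE)
    then show False using out_Trm[of l' "e i l'" \<beta>' u3] b' l' jN' F by auto
  qed
  then have "l' = l" "\<beta>' = \<beta>" using b' i l' jN jN' by simp_all
  then show ?thesis
    using u u' u'' a l' b' by (auto simp: f1_def f3_def)
qed

text \<open>Let \<open>T \<beta>\<close> be the labels bought at sink copy \<open>\<beta>\<close>.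
  If every copy buys more than \<open>G\<close> labels, the sinks alone are expensive. Otherwise one
  copy has a small \<open>T \<beta>\<close>, and for at least half of the constraints every codeword
  serves fewer than \<open>H\<close> of the \<open>k\<close> demands towards that copy. Each of the
  \<open>k\<close> source copies of such a constraint then buys at least \<open>k / H\<close>
  codewords.\<close>

theorem solution_card_ge:
  assumes F: "dsn_solution E ds F"
    and sparse: "\<And>T. T \<subseteq> {..<k} \<times> {..<N} \<times> vecs {..<t} \<Longrightarrow> card T \<le> G \<Longrightarrow>
      2 * card {i\<in>{..<m}. \<exists>a\<in>C0. H \<le> card {l\<in>{..<k}. (l, e i l, cv i a l) \<in> T}} < m"
  shows "(G + 1) * W \<le> card F \<or> m * k * k \<le> 2 * H * card F"
proof (rule disjCI)
  assume "\<not> m * k * k \<le> 2 * H * card F"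
  then have small: "2 * H * card F < m * k * k" by simp
  have FE: "F \<subseteq> E" and finF: "finite F"
    using F finite_subset[OF _ finite_E] by (auto simp: dsn_solution_def)
  let ?U = "{..<k} \<times> {..<N} \<times> (vecs {..<t} :: (nat \<Rightarrow> bit) set)"
  define S where "S i \<alpha> = {a\<in>C0. f1 (i, \<alpha>, a) \<in> F}" for i \<alpha>
  define T where "T \<beta> = {u\<in>?U. (case u of (l, j, c) \<Rightarrow> f3 (l, j, \<beta>, c)) \<in> F}" for \<beta>
  have finU: "finite ?U" by simp
  have finT: "finite (T \<beta>)" and finS: "finite (S i \<alpha>)" for i \<alpha> \<beta>
    by (simp_all add: T_def S_def finite_C0)
  have large: "G + 1 \<le> card (T \<beta>)" if \<beta>: "\<beta> < W" for \<beta>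
  proof (rule ccontr)
    assume "\<not> G + 1 \<le> card (T \<beta>)"
    then have few: "2 * card {i\<in>{..<m}. \<exists>a\<in>C0. H \<le> card {l\<in>{..<k}. (l, e i l, cv i a l) \<in> T \<beta>}} < m"
      by (intro sparse) (auto simp: T_def)
    define Gd where "Gd = {i\<in>{..<m}. \<not> (\<exists>a\<in>C0. H \<le> card {l\<in>{..<k}. (l, e i l, cv i a l) \<in> T \<beta>})}"
    have "card {..<m} \<le> card ({i\<in>{..<m}. \<exists>a\<in>C0. H \<le> card {l\<in>{..<k}. (l, e i l, cv i a l) \<in> T \<beta>}} \<union> Gd)"
      by (rule card_mono) (auto simp: Gd_def)
    also have "\<dots> \<le> card {i\<in>{..<m}. \<exists>a\<in>C0. H \<le> card {l\<in>{..<k}. (l, e i l, cv i a l) \<in> T \<beta>}} + card Gd"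
      by (rule card_Un_le)
    finally have Gd: "m \<le> 2 * card Gd" using few by simp
    have row: "k \<le> H * card (S i \<alpha>)" if i: "i \<in> Gd" and \<alpha>: "\<alpha> < k" for i \<alpha>
    proof -
      have im: "i < m" using i by (simp add: Gd_def)
      have "l \<in> (\<Union>a\<in>S i \<alpha>. {l\<in>{..<k}. (l, e i l, cv i a l) \<in> T \<beta>})" if l: "l < k" for l
      proof -
        have "(enc (Src i \<alpha>), enc (Trm l (e i l) \<beta>)) \<in> Dm"
          unfolding Dm_def dem_def
          by (rule image_eqI[where x = "(i, \<alpha>, l, \<beta>)"]) (use im \<alpha> l \<beta> in auto)
        then have "(enc (Src i \<alpha>), enc (Trm l (e i l) \<beta>)) \<in> F\<^sup>*"
          using F by (auto simp: dsn_solution_def set_ds)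
        from reachable_label[OF FE this im \<alpha> l \<beta>]
        show ?thesis using l e_less[OF im l] by (auto simp: S_def T_def)
      qed
      then have "card {..<k} \<le> card (\<Union>a\<in>S i \<alpha>. {l\<in>{..<k}. (l, e i l, cv i a l) \<in> T \<beta>})"
        by (intro card_mono) (auto simp: finS)
      also have "\<dots> \<le> (\<Sum>a\<in>S i \<alpha>. card {l\<in>{..<k}. (l, e i l, cv i a l) \<in> T \<beta>})"
        by (rule card_UN_le[OF finS])
      also have "\<dots> \<le> (\<Sum>a\<in>S i \<alpha>. H)"
        by (rule sum_mono) (use i in \<open>fastforce simp: Gd_def S_def\<close>)
      finally show ?thesis by (simp add: mult.commute)
    qed
    define X where "X = Sigma ({..<m} \<times> {..<k}) (\<lambda>(i, \<alpha>). S i \<alpha>)"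
    have "inj_on (\<lambda>((i, \<alpha>), a). f1 (i, \<alpha>, a)) X"
      by (auto simp: inj_on_def X_def S_def f1_def)
    moreover have "(\<lambda>((i, \<alpha>), a). f1 (i, \<alpha>, a)) ` X \<subseteq> F" by (auto simp: X_def S_def)
    ultimately have "card X \<le> card F" using card_inj_on_le finF by blast
    moreover have "card X = (\<Sum>\<alpha><k. \<Sum>i<m. card (S i \<alpha>))"
    proof -
      have "card X = (\<Sum>(i, \<alpha>)\<in>{..<m} \<times> {..<k}. card (S i \<alpha>))"
        unfolding X_def by (subst card_SigmaI) (auto simp: finS intro!: sum.cong)
      also have "\<dots> = (\<Sum>i<m. \<Sum>\<alpha><k. card (S i \<alpha>))" by (simp add: sum.cartesian_product)
      also have "\<dots> = (\<Sum>\<alpha><k. \<Sum>i<m. card (S i \<alpha>))" by (rule sum.swap)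
      finally show ?thesis .
    qed
    ultimately have XF: "(\<Sum>\<alpha><k. \<Sum>i<m. card (S i \<alpha>)) \<le> card F" by simp
    have "m * k * k \<le> (\<Sum>\<alpha><k. 2 * (card Gd * k))" using Gd by (simp add: mult.commute mult.left_commute)
    also have "\<dots> \<le> (\<Sum>\<alpha><k. 2 * (\<Sum>i<m. H * card (S i \<alpha>)))"
    proof (rule sum_mono)
      fix \<alpha> assume \<alpha>: "\<alpha> \<in> {..<k}"
      have "card Gd * k = (\<Sum>i\<in>Gd. k)" by simp
      also have "\<dots> \<le> (\<Sum>i\<in>Gd. H * card (S i \<alpha>))" by (rule sum_mono) (use row \<alpha> in auto)
      also have "\<dots> \<le> (\<Sum>i<m. H * card (S i \<alpha>))" by (rule sum_mono2) (auto simp: Gd_def)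
      finally show "2 * (card Gd * k) \<le> 2 * (\<Sum>i<m. H * card (S i \<alpha>))" by simp
    qed
    also have "\<dots> = 2 * H * (\<Sum>\<alpha><k. \<Sum>i<m. card (S i \<alpha>))"
      by (simp add: sum_distrib_left mult.assoc)
    also have "\<dots> \<le> 2 * H * card F" using XF by (rule mult_le_mono2)
    finally show False using small by simp
  qed
  define X where "X = Sigma {..<W} T"
  have "inj_on (\<lambda>(\<beta>, l, j, c). f3 (l, j, \<beta>, c)) X"
    by (auto simp: inj_on_def X_def T_def f3_def)
  moreover have "(\<lambda>(\<beta>, l, j, c). f3 (l, j, \<beta>, c)) ` X \<subseteq> F" by (auto simp: X_def T_def)
  ultimately have "card X \<le> card F" using card_inj_on_le finF by blast
  moreover have "(\<Sum>\<beta><W. G + 1) \<le> (\<Sum>\<beta><W. card (T \<beta>))"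
    by (rule sum_mono) (use large in auto)
  moreover have "card X = (\<Sum>\<beta><W. card (T \<beta>))"
    unfolding X_def by (subst card_SigmaI) (auto simp: finT)
  ultimately show "(G + 1) * W \<le> card F" by (simp add: mult.commute[of W])
qed

lemma opt_attained:
  "\<exists>F. dsn_solution E ds F \<and> dsn_opt E ds = card F"
proof -
  have "finite {S. dsn_solution E ds S}"
    by (rule finite_subset[of _ "Pow E"]) (auto simp: dsn_solution_def)
  moreover have "{S. dsn_solution E ds S} \<noteq> {}" using dsn_solution_E by auto
  ultimately have "dsn_opt E ds \<in> card ` {S. dsn_solution E ds S}"
    unfolding dsn_opt_def by (intro Min_in) auto
  then show ?thesis by auto
qed

text \<open>\<open>m = N * W\<close> and \<open>2 * g * H \<le> k\<close> make both alternatives of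
  \<open>solution_card_ge\<close> yield at least \<open>g * m * k\<close>, while
  \<open>m = N * W\<close> also brings the relaxation down to \<open>3 * m * k\<close>.\<close>

theorem gap_ge:
  assumes sparse: "\<And>T. T \<subseteq> {..<k} \<times> {..<N} \<times> vecs {..<t} \<Longrightarrow> card T \<le> g * k * N \<Longrightarrow>
      2 * card {i\<in>{..<m}. \<exists>a\<in>C0. H \<le> card {l\<in>{..<k}. (l, e i l, cv i a l) \<in> T}} < m"
    and pos: "0 < k" "0 < W" "0 < N" "0 < H" and m: "m = N * W" and k: "2 * g * H \<le> k"
  shows "real g / 3 \<le> integrality_gap E ds r"
proof -
  obtain F where F: "dsn_solution E ds F" "dsn_opt E ds = card F" using opt_attained by blast
  have "g * m * k \<le> card F"
    using solution_card_ge[OF F(1) sparse]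
  proof
    assume "(g * k * N + 1) * W \<le> card F"
    moreover have "g * m * k \<le> (g * k * N + 1) * W" by (simp add: m algebra_simps)
    ultimately show ?thesis by simp
  next
    assume *: "m * k * k \<le> 2 * H * card F"
    have "2 * H * (g * m * k) = m * k * (2 * g * H)" by (simp add: algebra_simps)
    also have "\<dots> \<le> m * k * k" using k by (rule mult_le_mono2)
    also note *
    finally show ?thesis using pos by simp
  qed
  then have opt: "real g * real (m * k) \<le> real (dsn_opt E ds)"
    using F(2) by (metis of_nat_le_iff of_nat_mult mult.assoc)
  have v1: "1 \<le> sdp_dsn_value E ds r" using pos by (intro sdp_value_ge) (auto simp: m)
  have "2 * m * k + k * N * W = 3 * (m * k)" by (simp add: m algebra_simps)
  then have v2: "sdp_dsn_value E ds r \<le> 3 * real (m * k)"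
    using sdp_value_le by (metis of_nat_mult of_nat_numeral)
  have "real g / 3 * sdp_dsn_value E ds r \<le> real g / 3 * (3 * real (m * k))"
    by (rule mult_left_mono[OF v2]) simp
  also have "\<dots> \<le> real (dsn_opt E ds)" using opt by simp
  finally show ?thesis
    unfolding integrality_gap_def using v1 by (simp add: pos_le_divide_eq)
qed

end

section \<open>Random constraint systems\<close>

lemma card_UN_le_const:
  assumes "finite I" "\<And>i. i \<in> I \<Longrightarrow> real (card (A i)) \<le> c" "real (card I) \<le> d" "0 \<le> c"
  shows "real (card (\<Union>i\<in>I. A i)) \<le> d * c"
proof -
  have "real (card (\<Union>i\<in>I. A i)) \<le> real (\<Sum>i\<in>I. card (A i))"
    using card_UN_le[OF assms(1)] by (simp only: of_nat_le_iff)
  also have "\<dots> \<le> (\<Sum>i\<in>I. c)" unfolding of_nat_sum by (rule sum_mono) (rule assms(2))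
  also have "\<dots> \<le> d * c" using assms(3,4) by (simp add: mult_right_mono)
  finally show ?thesis .
qed

lemma card_subsets_eq_le:
  assumes "finite A"
  shows "card {X. X \<subseteq> A \<and> card X = q} \<le> card A ^ q"
  using n_subsets[OF assms, of q] binomial_le_pow[of q "card A"]
  by (cases "q \<le> card A") (auto simp: binomial_eq_0)

lemma card_subsets_le:
  assumes "finite A"
  shows "card {X. X \<subseteq> A \<and> card X \<le> q} \<le> (card A + 1) ^ q"
proof -
  have "{X. X \<subseteq> A \<and> card X \<le> q} = (\<Union>i\<in>{..q}. {X. X \<subseteq> A \<and> card X = i})" by auto
  then have "card {X. X \<subseteq> A \<and> card X \<le> q} \<le> (\<Sum>i\<le>q. card {X. X \<subseteq> A \<and> card X = i})"
    using card_UN_le[of "{..q}" "\<lambda>i. {X. X \<subseteq> A \<and> card X = i}"] by simp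
  also have "\<dots> \<le> (\<Sum>i\<le>q. (q choose i) * card A ^ i * 1 ^ (q - i))"
  proof (rule sum_mono)
    fix i assume "i \<in> {..q}"
    then have "1 \<le> q choose i" by (simp add: Suc_leI zero_less_binomial)
    then have "1 * card A ^ i \<le> (q choose i) * card A ^ i" by (rule mult_le_mono1)
    with card_subsets_eq_le[OF assms, of i]
    show "card {X. X \<subseteq> A \<and> card X = i} \<le> (q choose i) * card A ^ i * 1 ^ (q - i)"
      unfolding mult_1 power_one mult_1_right by (rule le_trans)
  qed
  also have "\<dots> = (card A + 1) ^ q" using binomial[of "card A" 1 q] by simp
  finally show ?thesis .
qed

lemma sum_quarter_powers: "(\<Sum>i=1..s. (1/4 :: real) ^ i) \<le> 1/3"
proof -
  have "(\<Sum>i=1..s. (1/4 :: real) ^ i) = (1 - (1/4) ^ s) / 3"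
  proof (induction s)
    case (Suc s)
    have "(\<Sum>i=1..Suc s. (1/4 :: real) ^ i) = (1 - (1/4) ^ s) / 3 + 1/4 * (1/4) ^ s"
      using Suc by simp
    also have "\<dots> = (1 - (1/4) ^ Suc s) / 3" unfolding power_Suc by argo
    finally show ?case .
  qed simp
  then show ?thesis by simp
qed

text \<open>Demanding a partner of smaller index keeps the partner relation acyclic and excludes
  first occurrences.\<close>

definition collision :: "nat \<Rightarrow> (nat \<times> nat \<Rightarrow> nat) \<Rightarrow> nat set \<Rightarrow> (nat \<times> nat) set \<Rightarrow> bool" where
  "collision k \<omega> S K \<longleftrightarrow> K \<subseteq> S \<times> {..<k} \<and> (\<forall>(i, l)\<in>K. \<exists>i'\<in>S. i' < i \<and> \<omega> (i', l) = \<omega> (i, l))"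

text \<open>Given the partners \<open>f\<close>, the values on \<open>K\<close> are determined by those outside \<open>K\<close>.\<close>

lemma card_collision_pattern:
  fixes m k N :: nat and K :: "(nat \<times> nat) set"
  assumes K: "K \<subseteq> {..<m} \<times> {..<k}"
  shows "card {\<omega>\<in>PiE ({..<m} \<times> {..<k}) (\<lambda>_. {..<N}). \<forall>(i, l)\<in>K. f (i, l) < i \<and> \<omega> (f (i, l), l) = \<omega> (i, l)}
    \<le> N ^ (m * k - card K)"
proof -
  let ?D = "{..<m} \<times> {..<k}"
  define B where "B = {\<omega>\<in>PiE ?D (\<lambda>_. {..<N}). \<forall>(i, l)\<in>K. f (i, l) < i \<and> \<omega> (f (i, l), l) = \<omega> (i, l)}"
  have finK: "finite K" using K finite_subset by blast
  have "inj_on (\<lambda>\<omega>. restrict \<omega> (?D - K)) B"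
  proof (rule inj_onI)
    fix \<omega> \<omega>' assume w: "\<omega> \<in> B" "\<omega>' \<in> B" and eq: "restrict \<omega> (?D - K) = restrict \<omega>' (?D - K)"
    have "i < m \<longrightarrow> l < k \<longrightarrow> \<omega> (i, l) = \<omega>' (i, l)" for i l
    proof (induction i rule: less_induct)
      case (less i)
      show ?case
      proof (intro impI)
        assume il: "i < m" "l < k"
        show "\<omega> (i, l) = \<omega>' (i, l)"
        proof (cases "(i, l) \<in> K")
          case True
          then have "f (i, l) < i" "\<omega> (f (i, l), l) = \<omega> (i, l)" "\<omega>' (f (i, l), l) = \<omega>' (i, l)"
            using w by (auto simp: B_def)
          moreover have "\<omega> (f (i, l), l) = \<omega>' (f (i, l), l)"
            using less[of "f (i, l)"] calculation(1) il by simp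
          ultimately show ?thesis by simp
        next
          case False
          then show ?thesis using fun_cong[OF eq, of "(i, l)"] il by simp
        qed
      qed
    qed
    then show "\<omega> = \<omega>'"
      using w by (intro PiE_ext[of \<omega> ?D "\<lambda>_. {..<N}" \<omega>']) (auto simp: B_def)
  qed
  moreover have "(\<lambda>\<omega>. restrict \<omega> (?D - K)) ` B \<subseteq> PiE (?D - K) (\<lambda>_. {..<N})"
    by (auto simp: B_def PiE_def Pi_def)
  ultimately have "card B \<le> card (PiE (?D - K) (\<lambda>_. {..<N}))"
    by (intro card_inj_on_le) (auto intro: finite_PiE)
  also have "\<dots> = N ^ (m * k - card K)"
    using K finK by (simp add: card_PiE card_Diff_subset card_cartesian_product)
  finally show ?thesis by (simp add: B_def)
qed

text \<open>Union bound over \<open>S\<close>, \<open>K\<close> and the partner map: for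
  \<open>card S = \<sigma>\<close> and \<open>card K = \<kappa>\<close> there are at most \<open>m ^
  \<sigma> * (\<sigma> * k) ^ \<kappa> * \<sigma> ^ \<kappa>\<close> choices, each of probability at
  most \<open>1 / N ^ \<kappa>\<close>. The factor 4 in \<open>cond\<close> brings this to
  \<open>(1/4) ^ \<sigma>\<close>, whose sum over all sizes is at most 1/3.\<close>

lemma card_collisions_le:
  fixes m k N s :: nat
  assumes N: "0 < N" and cond: "(4 * m) ^ 32 * (s\<^sup>2 * k) ^ 47 \<le> N ^ 47" and sk: "s\<^sup>2 * k \<le> N"
  shows "3 * real (card {\<omega>\<in>PiE ({..<m} \<times> {..<k}) (\<lambda>_. {..<N}). \<exists>S K. S \<subseteq> {..<m} \<and> S \<noteq> {} \<and> card S \<le> s \<and>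
      collision k \<omega> S K \<and> 47 * card S \<le> 32 * card K}) \<le> real N ^ (m * k)"
proof -
  let ?D = "{..<m} \<times> {..<k}"
  let ?\<Omega> = "PiE ?D (\<lambda>_. {..<N})"
  \<comment> \<open>This is 47/32 times \<open>\<sigma>\<close>, rounded up. A larger
    \<open>K\<close> may be cut down to this size, since subsets of a collision set are again
    collision sets.\<close>
  define \<kappa> where "\<kappa> \<sigma> = (47 * \<sigma> + 31) div 32" for \<sigma> :: nat
  have \<kappa>: "47 * \<sigma> \<le> 32 * \<kappa> \<sigma>" for \<sigma>
    using div_mult_mod_eq[of "47 * \<sigma> + 31" 32] mod_less_divisor[of 32 "47 * \<sigma> + 31"]
    unfolding \<kappa>_def by linarith
  have \<kappa>_le: "\<kappa> \<sigma> \<le> c" if "47 * \<sigma> \<le> 32 * c" for \<sigma> c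
  proof -
    have "47 * \<sigma> + 31 \<le> 31 + 32 * c" using that by simp
    then have "(47 * \<sigma> + 31) div 32 \<le> (31 + 32 * c) div 32" by (rule div_le_mono)
    then show ?thesis by (simp add: \<kappa>_def)
  qed
  define Bd where "Bd K f = {\<omega>\<in>?\<Omega>. \<forall>(i, l)\<in>K. f (i, l) < i \<and> \<omega> (f (i, l), l) = \<omega> (i, l)}" for K and f :: "nat \<times> nat \<Rightarrow> nat"
  define SS where "SS \<sigma> = {S :: nat set. S \<subseteq> {..<m} \<and> card S = \<sigma>}" for \<sigma>
  define KK where "KK \<sigma> S = {K. K \<subseteq> S \<times> {..<k} \<and> card K = \<kappa> \<sigma>}" for \<sigma> and S :: "nat set"
  define Tot where "Tot \<sigma> = (\<Union>S\<in>SS \<sigma>. \<Union>K\<in>KK \<sigma> S. \<Union>f\<in>PiE K (\<lambda>_. S). Bd K f)" for \<sigma>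
  have sub: "{\<omega>\<in>?\<Omega>. \<exists>S K. S \<subseteq> {..<m} \<and> S \<noteq> {} \<and> card S \<le> s \<and>
      collision k \<omega> S K \<and> 47 * card S \<le> 32 * card K} \<subseteq> (\<Union>\<sigma>\<in>{1..s}. Tot \<sigma>)"
  proof clarify
    fix \<omega> S K
    assume \<omega>: "\<omega> \<in> ?\<Omega>" and S: "S \<subseteq> {..<m}" "S \<noteq> {}" "card S \<le> s"
      and col: "collision k \<omega> S K" and large: "47 * card S \<le> 32 * card K"
    have finS: "finite S" using S finite_subset by blast
    obtain K' where K': "K' \<subseteq> K" "card K' = \<kappa> (card S)"
      using obtain_subset_with_card_n[OF \<kappa>_le[OF large]] by metis
    have "\<forall>p\<in>K'. \<exists>i'. i' \<in> S \<and> i' < fst p \<and> \<omega> (i', snd p) = \<omega> p"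
    proof
      fix p assume "p \<in> K'"
      then have "(fst p, snd p) \<in> K" using K'(1) by auto
      then have "\<exists>i'\<in>S. i' < fst p \<and> \<omega> (i', snd p) = \<omega> (fst p, snd p)"
        using col unfolding collision_def by blast
      then show "\<exists>i'. i' \<in> S \<and> i' < fst p \<and> \<omega> (i', snd p) = \<omega> p" by auto
    qed
    then obtain f0 where f0: "\<And>p. p \<in> K' \<Longrightarrow> f0 p \<in> S \<and> f0 p < fst p \<and> \<omega> (f0 p, snd p) = \<omega> p"
      by metis
    define f where "f = restrict f0 K'"
    have "f \<in> PiE K' (\<lambda>_. S)" using f0 by (auto simp: f_def)
    moreover have "\<omega> \<in> Bd K' f" 
    proof -
      have "f (i, l) < i \<and> \<omega> (f (i, l), l) = \<omega> (i, l)" if "(i, l) \<in> K'" for i l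
        using f0[OF that] that by (simp add: f_def)
      then show ?thesis using \<omega> by (auto simp: Bd_def)
    qed
    moreover have "K' \<in> KK (card S) S" using K' col by (auto simp: KK_def collision_def)
    moreover have "S \<in> SS (card S)" using S by (simp add: SS_def)
    ultimately have "\<omega> \<in> Tot (card S)" unfolding Tot_def by blast
    moreover have "card S \<in> {1..s}" using S finS by (simp add: Suc_leI card_gt_0_iff)
    ultimately show "\<omega> \<in> (\<Union>\<sigma>\<in>{1..s}. Tot \<sigma>)" by blast
  qed
  have TotB: "real (card (Tot \<sigma>)) \<le> (1/4) ^ \<sigma> * real N ^ (m * k)" if \<sigma>: "\<sigma> \<in> {1..s}" for \<sigma>
  proof (cases "\<kappa> \<sigma> \<le> m * k")
    \<comment> \<open>Here the exponent \<open>m * k - \<kappa> \<sigma>\<close> would be truncated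
      to 0, so the bound has to come from the absence of such \<open>K\<close>.\<close>
    case False
    have "KK \<sigma> S = {}" if "S \<in> SS \<sigma>" for S
    proof -
      have "card K \<le> m * k" if "K \<subseteq> S \<times> {..<k}" for K
      proof -
        have "card K \<le> card ?D" by (rule card_mono) (use that \<open>S \<in> SS \<sigma>\<close> in \<open>auto simp: SS_def\<close>)
        then show ?thesis by (simp add: card_cartesian_product)
      qed
      then have bound: "\<And>K. K \<subseteq> S \<times> {..<k} \<Longrightarrow> card K \<le> m * k" .
      have "K \<notin> KK \<sigma> S" for K
      proof
        assume "K \<in> KK \<sigma> S"
        then have "K \<subseteq> S \<times> {..<k}" "card K = \<kappa> \<sigma>" by (simp_all add: KK_def)
        then show False using bound[of K] False by linarith
      qed
      then show ?thesis by (simp add: set_eq_iff)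
    qed
    then have "Tot \<sigma> = {}" by (auto simp: Tot_def)
    then show ?thesis by simp
  next
    case True
    define c where "c = real N ^ (m * k - \<kappa> \<sigma>)"
    have finSS: "finite (SS \<sigma>)" by (rule finite_subset[of _ "Pow {..<m}"]) (auto simp: SS_def)
    have "real (card (Tot \<sigma>)) \<le> real m ^ \<sigma> * (real (\<sigma> * k) ^ \<kappa> \<sigma> * (real \<sigma> ^ \<kappa> \<sigma> * c))"
      unfolding Tot_def
    proof (rule card_UN_le_const[OF finSS])
      show "real (card (SS \<sigma>)) \<le> real m ^ \<sigma>"
        using card_subsets_eq_le[of "{..<m}" \<sigma>] unfolding SS_def of_nat_power[symmetric] of_nat_le_iff by simp
      fix S assume S: "S \<in> SS \<sigma>"
      then have S': "S \<subseteq> {..<m}" "card S = \<sigma>" by (auto simp: SS_def)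
      have finS: "finite S" by (rule finite_subset[OF S'(1)]) simp
      have finKK: "finite (KK \<sigma> S)"
        by (rule finite_subset[of _ "Pow (S \<times> {..<k})"]) (auto simp: KK_def finS)
      show "real (card (\<Union>K\<in>KK \<sigma> S. \<Union>f\<in>PiE K (\<lambda>_. S). Bd K f)) \<le> real (\<sigma> * k) ^ \<kappa> \<sigma> * (real \<sigma> ^ \<kappa> \<sigma> * c)"
      proof (rule card_UN_le_const[OF finKK])
        show "real (card (KK \<sigma> S)) \<le> real (\<sigma> * k) ^ \<kappa> \<sigma>"
          using card_subsets_eq_le[of "S \<times> {..<k}" "\<kappa> \<sigma>"] S' finS
          unfolding KK_def of_nat_power[symmetric] of_nat_le_iff by (simp add: card_cartesian_product)
        fix K assume K: "K \<in> KK \<sigma> S"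
        then have K': "K \<subseteq> S \<times> {..<k}" "card K = \<kappa> \<sigma>" by (auto simp: KK_def)
        have finK: "finite K" by (rule finite_subset[OF K'(1)]) (simp add: finS)
        show "real (card (\<Union>f\<in>PiE K (\<lambda>_. S). Bd K f)) \<le> real \<sigma> ^ \<kappa> \<sigma> * c"
        proof (rule card_UN_le_const)
          show "finite (PiE K (\<lambda>_. S))" by (intro finite_PiE finK) (rule finS)
          show "real (card (PiE K (\<lambda>_. S))) \<le> real \<sigma> ^ \<kappa> \<sigma>" by (simp add: card_PiE finK S' K')
          fix f
          have "K \<subseteq> ?D" using K' S' by blast
          from card_collision_pattern[OF this, of N f]
          show "real (card (Bd K f)) \<le> c"
            unfolding Bd_def c_def K'(2) of_nat_power[symmetric] of_nat_le_iff .
        qed (simp add: c_def)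
      qed (simp add: c_def)
    qed (simp add: c_def)
    also have "\<dots> = real (m ^ \<sigma> * (\<sigma>\<^sup>2 * k) ^ \<kappa> \<sigma>) * c"
      by (simp add: power2_eq_square power_mult_distrib mult_ac)
    also have "\<dots> \<le> ((1/4) ^ \<sigma> * real N ^ \<kappa> \<sigma>) * c"
    proof (rule mult_right_mono)
      \<comment> \<open>The 32nd power clears the denominator of 47/32. The excess exponent left by
        rounding is absorbed by \<open>s\<^sup>2 * k \<le> N\<close>.\<close>
      have "((4 * m) ^ \<sigma> * (\<sigma>\<^sup>2 * k) ^ \<kappa> \<sigma>) ^ 32 \<le> ((4 * m) ^ \<sigma> * (s\<^sup>2 * k) ^ \<kappa> \<sigma>) ^ 32"
        using \<sigma> by (intro power_mono mult_le_mono mult_left_mono mult_right_mono) auto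
      also have "\<dots> = (4 * m) ^ (\<sigma> * 32) * (s\<^sup>2 * k) ^ (\<kappa> \<sigma> * 32)"
        by (simp only: power_mult_distrib power_mult)
      also have "\<kappa> \<sigma> * 32 = 47 * \<sigma> + (32 * \<kappa> \<sigma> - 47 * \<sigma>)" using \<kappa>[of \<sigma>] by simp
      also have "(4 * m) ^ (\<sigma> * 32) * (s\<^sup>2 * k) ^ (47 * \<sigma> + (32 * \<kappa> \<sigma> - 47 * \<sigma>))
          = ((4 * m) ^ 32 * (s\<^sup>2 * k) ^ 47) ^ \<sigma> * (s\<^sup>2 * k) ^ (32 * \<kappa> \<sigma> - 47 * \<sigma>)"
        by (simp only: power_add power_mult_distrib power_mult[symmetric] mult.commute[of \<sigma>] mult.assoc)
      also have "\<dots> \<le> (N ^ 47) ^ \<sigma> * N ^ (32 * \<kappa> \<sigma> - 47 * \<sigma>)"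
        by (intro mult_le_mono power_mono cond sk) auto
      also have "\<dots> = N ^ (47 * \<sigma> + (32 * \<kappa> \<sigma> - 47 * \<sigma>))"
        by (simp only: power_add power_mult)
      also have "\<dots> = (N ^ \<kappa> \<sigma>) ^ 32"
        using \<kappa>[of \<sigma>] by (simp add: power_mult[symmetric] mult.commute)
      finally have "(4 * m) ^ \<sigma> * (\<sigma>\<^sup>2 * k) ^ \<kappa> \<sigma> \<le> N ^ \<kappa> \<sigma>"
        by (rule power_le_imp_le_base[where n = 31, simplified]) simp
      then have "real ((4 * m) ^ \<sigma> * (\<sigma>\<^sup>2 * k) ^ \<kappa> \<sigma>) \<le> real (N ^ \<kappa> \<sigma>)"
        by (simp only: of_nat_le_iff)
      then show "real (m ^ \<sigma> * (\<sigma>\<^sup>2 * k) ^ \<kappa> \<sigma>) \<le> (1/4) ^ \<sigma> * real N ^ \<kappa> \<sigma>"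
        by (simp add: power_mult_distrib power_divide field_simps)
    qed (simp add: c_def)
    also have "\<dots> = (1/4) ^ \<sigma> * real N ^ (m * k)"
      using True by (simp add: c_def power_add[symmetric] mult.assoc)
    finally show ?thesis .
  qed
  have fin\<Omega>: "finite ?\<Omega>" by (intro finite_PiE) auto
  have finTot: "finite (\<Union>\<sigma>\<in>{1..s}. Tot \<sigma>)"
    by (rule finite_subset[OF _ fin\<Omega>]) (auto simp: Tot_def Bd_def)
  have "real (card {\<omega>\<in>?\<Omega>. \<exists>S K. S \<subseteq> {..<m} \<and> S \<noteq> {} \<and> card S \<le> s \<and>
      collision k \<omega> S K \<and> 47 * card S \<le> 32 * card K}) \<le> real (card (\<Union>\<sigma>\<in>{1..s}. Tot \<sigma>))"
    unfolding of_nat_le_iff by (rule card_mono[OF finTot sub])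
  also have "\<dots> \<le> real (\<Sum>\<sigma>=1..s. card (Tot \<sigma>))"
    unfolding of_nat_le_iff by (rule card_UN_le) simp
  also have "\<dots> \<le> (\<Sum>\<sigma>=1..s. (1/4) ^ \<sigma> * real N ^ (m * k))"
    unfolding of_nat_sum by (rule sum_mono) (rule TotB)
  also have "\<dots> = (\<Sum>\<sigma>=1..s. (1/4) ^ \<sigma>) * real N ^ (m * k)" by (simp add: sum_distrib_right)
  also have "\<dots> \<le> 1/3 * real N ^ (m * k)" by (intro mult_right_mono sum_quarter_powers) simp
  finally show ?thesis by simp
qed

text \<open>A row holds all random choices of one constraint: for each position, the index of the
  variable and the shift. Rows of different constraints are independent.\<close>

definition weak :: "nat \<Rightarrow> nat \<Rightarrow> nat \<Rightarrow> (nat \<times> nat \<Rightarrow> bit) set \<Rightarrow> nat \<Rightarrow> (nat \<times> nat \<times> (nat \<Rightarrow> bit)) set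
    \<Rightarrow> (nat \<Rightarrow> nat \<times> (nat \<Rightarrow> bit)) set" where
  "weak k N t C0 H T = {\<rho>\<in>PiE {..<k} (\<lambda>_. {..<N} \<times> vecs {..<t}).
     \<exists>a\<in>C0. H \<le> card {l\<in>{..<k}. (l, fst (\<rho> l), (\<lambda>\<tau>. if \<tau> < t then a (l, \<tau>) + snd (\<rho> l) \<tau> else 0)) \<in> T}}"

text \<open>The \<open>H\<close> hit positions of a weak row are read off an \<open>H\<close>-element subset of \<open>T\<close>.\<close>

lemma card_weak_le:
  fixes C0 :: "(nat \<times> nat \<Rightarrow> bit) set"
  assumes finC: "finite C0" and finT: "finite T" and T: "card T \<le> G" and H: "H \<le> k"
  shows "card (weak k N t C0 H T) \<le> card C0 * (G ^ H * (N * 2 ^ t) ^ (k - H))"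
proof -
  let ?A = "{..<N} \<times> (vecs {..<t} :: (nat \<Rightarrow> bit) set)"
  let ?Rows = "PiE {..<k} (\<lambda>_. ?A)"
  define hit where "hit a \<rho> l = (l, fst (\<rho> l), (\<lambda>\<tau>. if \<tau> < t then a (l, \<tau>) + snd (\<rho> l) \<tau> else 0))"
    for a :: "nat \<times> nat \<Rightarrow> bit" and \<rho> :: "nat \<Rightarrow> nat \<times> (nat \<Rightarrow> bit)" and l
  define YY where "YY = {Y. Y \<subseteq> T \<and> card Y = H}"
  define B where "B a Y = {\<rho>\<in>?Rows. \<exists>L\<subseteq>{..<k}. Y = hit a \<rho> ` L}" for a Y
  have finA: "finite ?A" and cardA: "card ?A = N * 2 ^ t"
    by (simp_all add: card_cartesian_product card_vecs)
  have finRows: "finite ?Rows" by (intro finite_PiE) (auto simp: finA)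
  have finYY: "finite YY" by (rule finite_subset[of _ "Pow T"]) (auto simp: YY_def finT)
  have finB: "finite (B a Y)" for a Y unfolding B_def using finRows by simp
  have sub: "weak k N t C0 H T \<subseteq> (\<Union>a\<in>C0. \<Union>Y\<in>YY. B a Y)"
  proof
    fix \<rho> assume "\<rho> \<in> weak k N t C0 H T"
    then obtain a where \<rho>: "\<rho> \<in> ?Rows" and a: "a \<in> C0" "H \<le> card {l\<in>{..<k}. hit a \<rho> l \<in> T}"
      by (auto simp: weak_def hit_def)
    obtain L where L: "L \<subseteq> {l\<in>{..<k}. hit a \<rho> l \<in> T}" "card L = H"
      using obtain_subset_with_card_n[OF a(2)] by metis
    have "inj_on (hit a \<rho>) L" by (auto simp: inj_on_def hit_def)
    then have "hit a \<rho> ` L \<in> YY" using L by (auto simp: YY_def card_image)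
    moreover have "\<rho> \<in> B a (hit a \<rho> ` L)" using \<rho> L by (auto simp: B_def)
    ultimately show "\<rho> \<in> (\<Union>a\<in>C0. \<Union>Y\<in>YY. B a Y)" using a by blast
  qed
  have cardB: "card (B a Y) \<le> (N * 2 ^ t) ^ (k - H)" if Y: "Y \<in> YY" for a Y
  proof (cases "B a Y = {}")
    case True
    then show ?thesis by simp
  next
    case False
    then obtain \<rho>0 L where L: "L \<subseteq> {..<k}" "Y = hit a \<rho>0 ` L" by (auto simp: B_def)
    have "inj_on (hit a \<rho>0) L" by (auto simp: inj_on_def hit_def)
    then have cardL: "card L = H" using Y L card_image by (fastforce simp: YY_def)
    have finL: "finite L" using L finite_subset by blast
    \<comment> \<open>\<open>hit\<close> keeps the position as first component, so \<open>Y\<close>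
      determines \<open>L\<close> and, with \<open>a\<close> fixed, the row on \<open>L\<close>;
      only \<open>k - H\<close> positions remain free.\<close>
    have val: "hit a \<rho> l = hit a \<rho>0 l" if \<rho>: "\<rho> \<in> B a Y" and l: "l \<in> L" for \<rho> l
    proof -
      obtain L' where L': "Y = hit a \<rho> ` L'" using \<rho> by (auto simp: B_def)
      have "hit a \<rho>0 l \<in> hit a \<rho> ` L'" using L L' l by auto
      then show ?thesis by (auto simp: hit_def)
    qed
    have "inj_on (\<lambda>\<rho>. restrict \<rho> ({..<k} - L)) (B a Y)"
    proof (rule inj_onI)
      fix \<rho> \<rho>' assume r: "\<rho> \<in> B a Y" "\<rho>' \<in> B a Y"
        and eq: "restrict \<rho> ({..<k} - L) = restrict \<rho>' ({..<k} - L)"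
      have mem: "\<rho> \<in> ?Rows" "\<rho>' \<in> ?Rows" using r by (auto simp: B_def)
      have "\<rho> l = \<rho>' l" if l: "l < k" for l
      proof (cases "l \<in> L")
        case True
        then have h: "hit a \<rho> l = hit a \<rho>' l" using val r by metis
        have v: "snd (\<rho> l) \<in> vecs {..<t}" "snd (\<rho>' l) \<in> vecs {..<t}"
          using PiE_mem[OF mem(1), of l] PiE_mem[OF mem(2), of l] l by auto
        have "snd (\<rho> l) \<tau> = snd (\<rho>' l) \<tau>" for \<tau>
        proof (cases "\<tau> < t")
          case True
          have "(\<lambda>\<tau>. if \<tau> < t then a (l, \<tau>) + snd (\<rho> l) \<tau> else 0)
              = (\<lambda>\<tau>. if \<tau> < t then a (l, \<tau>) + snd (\<rho>' l) \<tau> else 0)"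
            using h unfolding hit_def prod.inject by (elim conjE)
          from fun_cong[OF this, of \<tau>] have "a (l, \<tau>) + snd (\<rho> l) \<tau> = a (l, \<tau>) + snd (\<rho>' l) \<tau>" using True by simp
          then show ?thesis by (rule add_left_imp_eq)
        qed (use v in \<open>simp add: vecs_def\<close>)
        moreover have "fst (\<rho> l) = fst (\<rho>' l)" using h by (simp add: hit_def)
        ultimately show ?thesis by (simp add: prod_eq_iff fun_eq_iff)
      next
        case False
        then show ?thesis using fun_cong[OF eq, of l] l by simp
      qed
      then show "\<rho> = \<rho>'" using mem by (intro PiE_ext[of \<rho> "{..<k}" "\<lambda>_. ?A" \<rho>']) auto
    qed
    moreover have "(\<lambda>\<rho>. restrict \<rho> ({..<k} - L)) ` B a Y \<subseteq> PiE ({..<k} - L) (\<lambda>_. ?A)"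
      by (auto simp: B_def PiE_def Pi_def)
    ultimately have "card (B a Y) \<le> card (PiE ({..<k} - L) (\<lambda>_. ?A))"
      by (intro card_inj_on_le) (auto intro!: finite_PiE)
    also have "\<dots> = (N * 2 ^ t) ^ (k - H)"
      using L finL cardL by (simp add: card_PiE card_Diff_subset cardA)
    finally show ?thesis .
  qed
  have "card (weak k N t C0 H T) \<le> card (\<Union>a\<in>C0. \<Union>Y\<in>YY. B a Y)"
    by (rule card_mono[OF _ sub]) (auto simp: finC finYY finB)
  also have "\<dots> \<le> (\<Sum>a\<in>C0. card (\<Union>Y\<in>YY. B a Y))" by (rule card_UN_le[OF finC])
  also have "\<dots> \<le> (\<Sum>a\<in>C0. G ^ H * (N * 2 ^ t) ^ (k - H))"
  proof (rule sum_mono)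
    fix a
    have "card (\<Union>Y\<in>YY. B a Y) \<le> (\<Sum>Y\<in>YY. card (B a Y))" by (rule card_UN_le[OF finYY])
    also have "\<dots> \<le> (\<Sum>Y\<in>YY. (N * 2 ^ t) ^ (k - H))" by (rule sum_mono) (rule cardB)
    also have "\<dots> = card YY * (N * 2 ^ t) ^ (k - H)" by simp
    also have "\<dots> \<le> G ^ H * (N * 2 ^ t) ^ (k - H)"
    proof (rule mult_le_mono1)
      have "card YY \<le> card T ^ H" unfolding YY_def by (rule card_subsets_eq_le[OF finT])
      also have "\<dots> \<le> G ^ H" using T by (rule power_mono) simp
      finally show "card YY \<le> G ^ H" .
    qed
    finally show "card (\<Union>Y\<in>YY. B a Y) \<le> G ^ H * (N * 2 ^ t) ^ (k - H)" .
  qed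
  finally show ?thesis by simp
qed

text \<open>By \<open>c1\<close> a row is weak with probability at most 1/64, so half of the rows
  are weak with probability at most \<open>1 / 8 ^ m\<close>. There are at most \<open>2 ^ m\<close>
  label sets by \<open>c2\<close> and \<open>2 ^ m\<close> sets of rows, which leaves
  \<open>1 / 2 ^ m\<close>.\<close>

lemma card_many_weak_le:
  fixes C0 :: "(nat \<times> nat \<Rightarrow> bit) set" and m k N t g H :: nat
  assumes finC: "finite C0" and H: "H \<le> k" and N: "0 < N" and m: "0 < m"
    and c1: "64 * card C0 * (g * k) ^ H \<le> (2 ^ t) ^ H"
    and c2: "(k * N * 2 ^ t + 1) ^ (g * k * N) \<le> 2 ^ m"
  shows "2 * real (card {\<omega>\<in>PiE {..<m} (\<lambda>_. PiE {..<k} (\<lambda>_. {..<N} \<times> vecs {..<t})).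
      \<exists>T\<subseteq>{..<k} \<times> {..<N} \<times> vecs {..<t}. card T \<le> g * k * N \<and> m \<le> 2 * card {i\<in>{..<m}. \<omega> i \<in> weak k N t C0 H T}})
    \<le> (real N * 2 ^ t) ^ (m * k)"
proof -
  let ?A = "{..<N} \<times> (vecs {..<t} :: (nat \<Rightarrow> bit) set)"
  let ?Rows = "PiE {..<k} (\<lambda>_. ?A)"
  let ?U = "{..<k} \<times> {..<N} \<times> (vecs {..<t} :: (nat \<Rightarrow> bit) set)"
  let ?wk = "weak k N t C0 H"
  define M where "M = (real N * 2 ^ t) ^ k"
  have M: "0 < M" using N by (simp add: M_def)
  have cardA: "card ?A = N * 2 ^ t" by (simp add: card_cartesian_product card_vecs)
  have cardRows: "real (card ?Rows) = M" by (simp add: card_PiE cardA M_def)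
  have finRows: "finite ?Rows" by (intro finite_PiE) auto
  have cardU: "card ?U = k * N * 2 ^ t" by (simp add: card_cartesian_product card_vecs)
  have weak_le: "64 * real (card (?wk T)) \<le> M" if T: "T \<subseteq> ?U" "card T \<le> g * k * N" for T
  proof -
    have finT: "finite T" by (rule finite_subset[OF T(1)]) simp
    have "64 * card (?wk T) \<le> 64 * (card C0 * ((g * k * N) ^ H * (N * 2 ^ t) ^ (k - H)))"
      using card_weak_le[OF finC finT T(2) H] by (rule mult_le_mono2)
    also have "\<dots> = (64 * card C0 * (g * k) ^ H) * (N ^ H * (N * 2 ^ t) ^ (k - H))"
      by (simp add: power_mult_distrib mult_ac)
    also have "\<dots> \<le> (2 ^ t) ^ H * (N ^ H * (N * 2 ^ t) ^ (k - H))" using c1 by (rule mult_le_mono1)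
    also have "\<dots> = (N * 2 ^ t) ^ H * (N * 2 ^ t) ^ (k - H)" by (simp add: power_mult_distrib mult_ac)
    also have "\<dots> = (N * 2 ^ t) ^ k" using H by (simp only: power_add[symmetric] le_add_diff_inverse)
    finally have "real (64 * card (?wk T)) \<le> real ((N * 2 ^ t) ^ k)" by (simp only: of_nat_le_iff)
    then show ?thesis by (simp add: M_def)
  qed
  define TT where "TT = {T. T \<subseteq> ?U \<and> card T \<le> g * k * N}"
  define XX where "XX = {X. X \<subseteq> {..<m} \<and> m \<le> 2 * card X}"
  define B where "B T X = PiE {..<m} (\<lambda>i. if i \<in> X then ?wk T else ?Rows)" for T X
  have wkR: "?wk T \<subseteq> ?Rows" for T by (auto simp: weak_def)
  have sub: "{\<omega>\<in>PiE {..<m} (\<lambda>_. ?Rows). \<exists>T\<subseteq>?U. card T \<le> g * k * N \<and> m \<le> 2 * card {i\<in>{..<m}. \<omega> i \<in> ?wk T}}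
      \<subseteq> (\<Union>T\<in>TT. \<Union>X\<in>XX. B T X)"
  proof clarify
    fix \<omega> T assume \<omega>: "\<omega> \<in> PiE {..<m} (\<lambda>_. ?Rows)" and T: "T \<subseteq> ?U" "card T \<le> g * k * N"
      and X: "m \<le> 2 * card {i\<in>{..<m}. \<omega> i \<in> ?wk T}"
    have "\<omega> \<in> B T {i\<in>{..<m}. \<omega> i \<in> ?wk T}"
      unfolding B_def using \<omega> by (intro PiE_I) (auto dest: PiE_arb)
    moreover have "T \<in> TT" using T by (simp add: TT_def)
    moreover have "{i\<in>{..<m}. \<omega> i \<in> ?wk T} \<in> XX" using X by (auto simp: XX_def)
    ultimately show "\<omega> \<in> (\<Union>T\<in>TT. \<Union>X\<in>XX. B T X)" by (intro UN_I)
  qed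
  have finTT: "finite TT" by (rule finite_subset[of _ "Pow ?U"]) (auto simp: TT_def)
  have finXX: "finite XX" by (rule finite_subset[of _ "Pow {..<m}"]) (auto simp: XX_def)
  have cardB: "real (card (B T X)) \<le> M ^ m / 8 ^ m" if T: "T \<in> TT" and X: "X \<in> XX" for T X
  proof -
    have X': "X \<subseteq> {..<m}" "m \<le> 2 * card X" using X by (auto simp: XX_def)
    have finX: "finite X" using X' finite_subset by blast
    have w: "real (card (?wk T)) \<le> M / 64" using weak_le[of T] T by (simp add: TT_def)
    have "real (card (B T X)) = (\<Prod>i<m. real (card (if i \<in> X then ?wk T else ?Rows)))"
      unfolding B_def by (simp add: card_PiE)
    also have "\<dots> \<le> (\<Prod>i<m. M * (if i \<in> X then 1/64 else 1))"
      by (rule prod_mono) (use w cardRows in auto)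
    also have "\<dots> = M ^ m * (\<Prod>i<m. if i \<in> X then 1/64 else 1)" by (simp add: prod.distrib)
    also have "(\<Prod>i<m. if i \<in> X then 1/64 else 1 :: real) = (1/64) ^ card X"
    proof -
      have "(\<Prod>i<m. if i \<in> X then 1/64 else 1 :: real) = (\<Prod>i\<in>X. 1/64)"
        by (rule prod.mono_neutral_cong_right) (use X' in auto)
      then show ?thesis by simp
    qed
    also have "M ^ m * (1/64) ^ card X \<le> M ^ m * (1 / 8 ^ m)"
    proof (rule mult_left_mono)
      have "(8 :: real) ^ m \<le> 8 ^ (2 * card X)" using X' by (intro power_increasing) auto
      also have "\<dots> = 64 ^ card X" by (simp add: power_mult)
      finally show "(1/64 :: real) ^ card X \<le> 1 / 8 ^ m" by (simp add: power_one_over field_simps)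
    qed (use M in simp)
    finally show ?thesis by simp
  qed
  have finBB: "finite (B T X)" for T X unfolding B_def
    by (intro finite_PiE) (auto simp: finRows intro: finite_subset[OF wkR])
  have "real (card (\<Union>T\<in>TT. \<Union>X\<in>XX. B T X)) \<le> 2 ^ m * (2 ^ m * (M ^ m / 8 ^ m))"
  proof (rule card_UN_le_const[OF finTT])
    have "card TT \<le> 2 ^ m"
      using card_subsets_le[of ?U "g * k * N"] c2 unfolding TT_def cardU by simp
    then show "real (card TT) \<le> 2 ^ m" by (metis of_nat_le_iff of_nat_numeral of_nat_power)
    fix T assume T: "T \<in> TT"
    show "real (card (\<Union>X\<in>XX. B T X)) \<le> 2 ^ m * (M ^ m / 8 ^ m)"
    proof (rule card_UN_le_const[OF finXX])
      have "card XX \<le> card (Pow {..<m})" by (rule card_mono) (auto simp: XX_def)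
      then have "card XX \<le> 2 ^ m" by (simp add: card_Pow)
      then show "real (card XX) \<le> 2 ^ m" by (metis of_nat_le_iff of_nat_numeral of_nat_power)
    qed (use cardB T M in auto)
  qed (use M in auto)
  also have "\<dots> = M ^ m / 2 ^ m"
  proof -
    have "(8 :: real) ^ m = 2 ^ m * (2 ^ m * 2 ^ m)" by (simp add: power_mult_distrib[symmetric])
    then show ?thesis by simp
  qed
  also have "\<dots> \<le> M ^ m / 2"
  proof -
    have "(2 :: real) ^ 1 \<le> 2 ^ m" using m by (intro power_increasing) auto
    then show ?thesis using M by (intro divide_left_mono) auto
  qed
  finally have total: "2 * real (card (\<Union>T\<in>TT. \<Union>X\<in>XX. B T X)) \<le> M ^ m" by simp
  have "card {\<omega>\<in>PiE {..<m} (\<lambda>_. ?Rows). \<exists>T\<subseteq>?U. card T \<le> g * k * N \<and> m \<le> 2 * card {i\<in>{..<m}. \<omega> i \<in> ?wk T}}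
      \<le> card (\<Union>T\<in>TT. \<Union>X\<in>XX. B T X)"
    by (rule card_mono[OF _ sub]) (auto simp: finTT finXX finBB)
  then have "2 * real (card {\<omega>\<in>PiE {..<m} (\<lambda>_. ?Rows). \<exists>T\<subseteq>?U. card T \<le> g * k * N \<and>
      m \<le> 2 * card {i\<in>{..<m}. \<omega> i \<in> ?wk T}}) \<le> M ^ m"
    using total by linarith
  then show ?thesis by (simp add: M_def power_mult[symmetric] mult.commute)
qed

text \<open>The two bad events have probability at most 1/3 and 1/2, so some sample avoids
  both.\<close>

lemma exists_good_system:
  fixes C0 :: "(nat \<times> nat \<Rightarrow> bit) set" and m k N t g H s :: nat
  assumes finC: "finite C0" and H: "H \<le> k" and N: "0 < N" and m: "0 < m"
    and coll: "(4 * m) ^ 32 * (s\<^sup>2 * k) ^ 47 \<le> N ^ 47" "s\<^sup>2 * k \<le> N"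
    and c1: "64 * card C0 * (g * k) ^ H \<le> (2 ^ t) ^ H"
    and c2: "(k * N * 2 ^ t + 1) ^ (g * k * N) \<le> 2 ^ m"
  obtains e :: "nat \<Rightarrow> nat \<Rightarrow> nat" and b :: "nat \<Rightarrow> nat \<times> nat \<Rightarrow> bit"
  where "\<And>i l. i < m \<Longrightarrow> l < k \<Longrightarrow> e i l < N"
    and "\<And>i. b i \<in> vecs ({..<k} \<times> {..<t})"
    and "\<And>S K. S \<subseteq> {..<m} \<Longrightarrow> S \<noteq> {} \<Longrightarrow> card S \<le> s \<Longrightarrow> K \<subseteq> S \<times> {..<k} \<Longrightarrow>
       (\<And>i l. (i, l) \<in> K \<Longrightarrow> \<exists>i'\<in>S. i' < i \<and> e i' l = e i l) \<Longrightarrow> 32 * card K < 47 * card S"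
    and "\<And>T. T \<subseteq> {..<k} \<times> {..<N} \<times> vecs {..<t} \<Longrightarrow> card T \<le> g * k * N \<Longrightarrow>
      2 * card {i\<in>{..<m}. \<exists>a\<in>C0. H \<le> card {l\<in>{..<k}.
        (l, e i l, (\<lambda>\<tau>. if \<tau> < t then a (l, \<tau>) + b i (l, \<tau>) else 0)) \<in> T}} < m"
proof -
  let ?D = "{..<m} \<times> {..<k}"
  let ?V = "vecs {..<t} :: (nat \<Rightarrow> bit) set"
  let ?\<Omega>e = "PiE ?D (\<lambda>_. {..<N})"
  let ?\<Omega>b = "PiE ?D (\<lambda>_. ?V)"
  let ?Rows = "PiE {..<k} (\<lambda>_. {..<N} \<times> ?V)"
  define bad1 where "bad1 = {\<omega>\<in>?\<Omega>e. \<exists>S K. S \<subseteq> {..<m} \<and> S \<noteq> {} \<and> card S \<le> s \<and>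
      collision k \<omega> S K \<and> 47 * card S \<le> 32 * card K}"
  define bad2 where "bad2 = {\<omega>\<in>PiE {..<m} (\<lambda>_. ?Rows).
      \<exists>T\<subseteq>{..<k} \<times> {..<N} \<times> ?V. card T \<le> g * k * N \<and> m \<le> 2 * card {i\<in>{..<m}. \<omega> i \<in> weak k N t C0 H T}}"
  define row where "row = (\<lambda>(\<omega> :: nat \<times> nat \<Rightarrow> nat, \<beta> :: nat \<times> nat \<Rightarrow> nat \<Rightarrow> bit).
      \<lambda>i\<in>{..<m}. \<lambda>l\<in>{..<k}. (\<omega> (i, l), \<beta> (i, l)))"
  have fine: "finite ?\<Omega>e" and finb: "finite ?\<Omega>b" by (auto intro!: finite_PiE)
  have carde: "real (card ?\<Omega>e) = real N ^ (m * k)" by (simp add: card_PiE card_cartesian_product)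
  have cardb: "real (card ?\<Omega>b) = (2 ^ t) ^ (m * k)"
    by (simp add: card_PiE card_cartesian_product card_vecs)
  \<comment> \<open>Collisions are counted over incidences alone, weak rows over incidences and
    shifts grouped by constraint. Injectivity of \<open>row\<close> carries the second bound over to
    the common sample space.\<close>
  have inj: "inj_on row (?\<Omega>e \<times> ?\<Omega>b)"
  proof (rule inj_onI)
    fix x y assume x: "x \<in> ?\<Omega>e \<times> ?\<Omega>b" and y: "y \<in> ?\<Omega>e \<times> ?\<Omega>b" and eq: "row x = row y"
    have *: "fst x (i, l) = fst y (i, l) \<and> snd x (i, l) = snd y (i, l)" if "i < m" "l < k" for i l
      using fun_cong[OF fun_cong[OF eq, of i], of l] that by (simp add: row_def case_prod_beta)
    have mem: "fst x \<in> ?\<Omega>e" "fst y \<in> ?\<Omega>e" "snd x \<in> ?\<Omega>b" "snd y \<in> ?\<Omega>b"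
      using x y by (simp_all only: mem_Times_iff)
    have "fst x = fst y"
      by (rule PiE_ext[OF mem(1,2)]) (use * in auto)
    moreover have "snd x = snd y"
      by (rule PiE_ext[OF mem(3,4)]) (use * in auto)
    ultimately show "x = y" by (rule prod_eqI)
  qed
  define B2 where "B2 = {x\<in>?\<Omega>e \<times> ?\<Omega>b. row x \<in> bad2}"
  have finbad2: "finite bad2" unfolding bad2_def by (simp add: finite_PiE)
  have "card B2 \<le> card bad2"
    by (rule card_inj_on_le[where f = row]) (use inj finbad2 in \<open>auto simp: B2_def intro: inj_on_subset\<close>)
  then have B2: "2 * real (card B2) \<le> (real N * 2 ^ t) ^ (m * k)"
    using card_many_weak_le[OF finC H N m c1 c2] unfolding bad2_def by linarith
  have "3 * real (card bad1) \<le> real N ^ (m * k)"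
    using card_collisions_le[OF N coll] by (simp add: bad1_def)
  then have "3 * real (card bad1) * (2 ^ t) ^ (m * k) \<le> real N ^ (m * k) * (2 ^ t) ^ (m * k)"
    by (rule mult_right_mono) simp
  then have B1: "3 * real (card (bad1 \<times> ?\<Omega>b)) \<le> (real N * 2 ^ t) ^ (m * k)"
    using cardb by (simp add: card_cartesian_product power_mult_distrib)
  have tot: "real (card (?\<Omega>e \<times> ?\<Omega>b)) = (real N * 2 ^ t) ^ (m * k)"
    by (simp only: card_cartesian_product of_nat_mult carde cardb power_mult_distrib)
  have "0 < (real N * 2 ^ t) ^ (m * k)" using N by simp
  then have "real (card (bad1 \<times> ?\<Omega>b)) + real (card B2) < real (card (?\<Omega>e \<times> ?\<Omega>b))"
    using B1 B2 tot by linarith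
  then have "card (bad1 \<times> ?\<Omega>b) + card B2 < card (?\<Omega>e \<times> ?\<Omega>b)" by linarith
  then have "card (bad1 \<times> ?\<Omega>b \<union> B2) < card (?\<Omega>e \<times> ?\<Omega>b)"
    using card_Un_le[of "bad1 \<times> ?\<Omega>b" B2] by linarith
  then have "\<not> ?\<Omega>e \<times> ?\<Omega>b \<subseteq> bad1 \<times> ?\<Omega>b \<union> B2"
    using card_mono[of "bad1 \<times> ?\<Omega>b \<union> B2" "?\<Omega>e \<times> ?\<Omega>b"] fine finb
    by (auto simp: bad1_def B2_def)
  then obtain \<omega> \<beta> where \<omega>: "\<omega> \<in> ?\<Omega>e" and \<beta>: "\<beta> \<in> ?\<Omega>b" and g1: "\<omega> \<notin> bad1" and g2: "row (\<omega>, \<beta>) \<notin> bad2"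
    by (auto simp: B2_def)
  define e where "e i l = \<omega> (i, l)" for i l
  \<comment> \<open>\<open>\<beta>\<close> is undefined outside its index set, whereas the shift has
    to vanish there.\<close>
  define b where "b i = (\<lambda>(l, \<tau>). if i < m \<and> l < k then \<beta> (i, l) \<tau> else 0)" for i
  have \<beta>V: "\<beta> (i, l) \<in> ?V" if "i < m" "l < k" for i l using PiE_mem[OF \<beta>, of "(i, l)"] that by simp
  have \<omega>N: "\<omega> (i, l) < N" if "i < m" "l < k" for i l using PiE_mem[OF \<omega>, of "(i, l)"] that by simp
  show thesis
  proof (rule that[of e b])
    show "e i l < N" if "i < m" "l < k" for i l using \<omega>N that by (simp add: e_def)
    show "b i \<in> vecs ({..<k} \<times> {..<t})" for i
      using \<beta>V[of i] by (auto simp: b_def vecs_def)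
    show "32 * card K < 47 * card S"
      if "S \<subseteq> {..<m}" "S \<noteq> {}" "card S \<le> s" "K \<subseteq> S \<times> {..<k}"
        "\<And>i l. (i, l) \<in> K \<Longrightarrow> \<exists>i'\<in>S. i' < i \<and> e i' l = e i l" for S K
    proof (rule ccontr)
      assume "\<not> 32 * card K < 47 * card S"
      moreover have "collision k \<omega> S K" using that(4,5) by (auto simp: collision_def e_def)
      ultimately have "\<omega> \<in> bad1" unfolding bad1_def using that(1-3) \<omega>
        by (intro CollectI conjI exI[of _ S] exI[of _ K]) simp_all
      then show False using g1 by simp
    qed
    show "2 * card {i\<in>{..<m}. \<exists>a\<in>C0. H \<le> card {l\<in>{..<k}.
        (l, e i l, (\<lambda>\<tau>. if \<tau> < t then a (l, \<tau>) + b i (l, \<tau>) else 0)) \<in> T}} < m"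
      if T: "T \<subseteq> {..<k} \<times> {..<N} \<times> ?V" "card T \<le> g * k * N" for T
    proof -
      have rowR: "row (\<omega>, \<beta>) \<in> PiE {..<m} (\<lambda>_. ?Rows)"
        using \<omega>N \<beta>V by (auto simp: row_def)
      have "i < m \<Longrightarrow> (\<exists>a\<in>C0. H \<le> card {l\<in>{..<k}.
          (l, e i l, (\<lambda>\<tau>. if \<tau> < t then a (l, \<tau>) + b i (l, \<tau>) else 0)) \<in> T})
          \<longleftrightarrow> row (\<omega>, \<beta>) i \<in> weak k N t C0 H T" for i
      proof -
        assume i: "i < m"
        have "row (\<omega>, \<beta>) i \<in> ?Rows" using PiE_mem[OF rowR, of i] i by simp
        moreover have "{l\<in>{..<k}. (l, e i l, (\<lambda>\<tau>. if \<tau> < t then a (l, \<tau>) + b i (l, \<tau>) else 0)) \<in> T}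
            = {l\<in>{..<k}. (l, fst (row (\<omega>, \<beta>) i l), (\<lambda>\<tau>. if \<tau> < t then a (l, \<tau>) + snd (row (\<omega>, \<beta>) i l) \<tau> else 0)) \<in> T}" for a
        proof (intro Collect_cong conj_cong refl)
          fix l assume "l \<in> {..<k}"
          then have "row (\<omega>, \<beta>) i l = (e i l, \<beta> (i, l))" "\<And>\<tau>. b i (l, \<tau>) = \<beta> (i, l) \<tau>"
            using i by (simp_all add: row_def e_def b_def)
          then show "(l, e i l, (\<lambda>\<tau>. if \<tau> < t then a (l, \<tau>) + b i (l, \<tau>) else 0)) \<in> T \<longleftrightarrow>
              (l, fst (row (\<omega>, \<beta>) i l), (\<lambda>\<tau>. if \<tau> < t then a (l, \<tau>) + snd (row (\<omega>, \<beta>) i l) \<tau> else 0)) \<in> T"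
            by (simp only: fst_conv snd_conv)
        qed
        ultimately show ?thesis unfolding weak_def by simp
      qed
      then have "{i\<in>{..<m}. \<exists>a\<in>C0. H \<le> card {l\<in>{..<k}.
          (l, e i l, (\<lambda>\<tau>. if \<tau> < t then a (l, \<tau>) + b i (l, \<tau>) else 0)) \<in> T}}
          = {i\<in>{..<m}. row (\<omega>, \<beta>) i \<in> weak k N t C0 H T}" by (intro Collect_cong conj_cong) auto
      moreover have "\<not> m \<le> 2 * card {i\<in>{..<m}. row (\<omega>, \<beta>) i \<in> weak k N t C0 H T}"
        using g2 rowR T unfolding bad2_def by blast
      ultimately show ?thesis by simp
    qed
  qed
qed

section \<open>Choice of parameters\<close>

text \<open>\<open>k * N * 2 ^ t\<close> labels take \<open>1068 * u\<close> bits, and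
  \<open>c2\<close> requires \<open>2 ^ u\<close> to exceed this. The least such \<open>u\<close> is
  14.\<close>

lemma linear_le_power2:
  assumes "14 \<le> u"
  shows "1068 * u + 1 \<le> (2::nat) ^ u"
  using assms
proof (induction u rule: dec_induct)
  case (step u)
  then show ?case by simp
qed simp

lemma exists_gap_instance:
  fixes u n :: nat
  assumes u: "14 \<le> u" and n: "2 ^ (1480 * u) \<le> n"
  shows "\<exists>E ds. dsn_instance n E ds \<and> dsn_feasible E ds \<and>
    2 ^ (100 * u) / 3 \<le> integrality_gap E ds (2 ^ u)"
proof -
  \<comment> \<open>\<open>k\<close> and \<open>2 ^ t\<close> exceed \<open>g\<close> and
    \<open>g * k\<close> by a factor \<open>2 ^ u\<close>, which yields
    \<open>2 * g * t \<le> k\<close> and \<open>c1\<close>; \<open>W\<close> exceeds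
    \<open>g * k\<close> by the same factor, which yields \<open>c2\<close>. \<open>N\<close> is
    then taken large enough for the collision condition with \<open>m = N * W\<close>, and
    \<open>s\<close> is \<open>r\<close> squared to dominate a constant multiple of
    \<open>r\<close>.\<close>
  define g k t N W m r s :: nat where "g = 2 ^ (100 * u)" and "k = 2 ^ (101 * u)" and "t = 202 * u"
    and "N = 2 ^ (765 * u)" and "W = 2 ^ (202 * u)" and "m = 2 ^ (967 * u)" and "r = 2 ^ u"
    and "s = 2 ^ (2 * u)"
  note defs = g_def k_def N_def W_def m_def r_def s_def
  note pow = power_add[symmetric] power_mult[symmetric]
  have lin: "1068 * u + 1 \<le> 2 ^ u" using u by (rule linear_le_power2)
  obtain C0 :: "(nat \<times> nat \<Rightarrow> bit) set" where
    C0: "C0 \<subseteq> vecs ({..<2 ^ (101 * u)} \<times> {..<t})" "0 \<in> C0" "\<And>x y. x \<in> C0 \<Longrightarrow> y \<in> C0 \<Longrightarrow> x + y \<in> C0"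
    and cardC: "card C0 \<le> 2 ^ (2 * t + 101 * u)"
    and dual: "\<And>z. z \<in> vecs ({..<2 ^ (101 * u)} \<times> {..<t}) \<Longrightarrow>
      \<forall>a\<in>C0. dot ({..<2 ^ (101 * u)} \<times> {..<t}) z a = 0 \<Longrightarrow> z \<noteq> 0 \<Longrightarrow>
      3 \<le> card {l. l < 2 ^ (101 * u) \<and> (\<exists>\<tau><t. z (l, \<tau>) \<noteq> 0)}"
    using toeplitz_code[of "101 * u" t] by blast
  note C0 = C0[folded k_def] and dual = dual[folded k_def]
  have finC: "finite C0" by (rule finite_subset[OF C0(1)]) simp
  have kgt: "2 * g * t \<le> k"
  proof -
    have "2 * g * t = (404 * u) * 2 ^ (100 * u)" by (simp add: g_def t_def)
    also have "\<dots> \<le> 2 ^ u * 2 ^ (100 * u)" using lin by (intro mult_le_mono1) simp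
    also have "\<dots> = k" by (simp add: k_def pow)
    finally show ?thesis .
  qed
  have tk: "t \<le> k"
  proof -
    have "1 * t \<le> (2 * g) * t" by (rule mult_le_mono1) (simp add: g_def)
    from order_trans[OF this kgt] show ?thesis by (simp only: mult_1)
  qed
  have coll1: "(4 * m) ^ 32 * (s\<^sup>2 * k) ^ 47 \<le> N ^ 47"
  proof -
    have e1: "4 * m = 2 ^ (2 + 967 * u)" by (simp add: m_def power_add)
    have e2: "s\<^sup>2 * k = 2 ^ (105 * u)" by (simp add: s_def k_def pow)
    have "(4 * m) ^ 32 * (s\<^sup>2 * k) ^ 47 = 2 ^ ((2 + 967 * u) * 32 + 105 * u * 47)"
      unfolding e1 e2 by (simp only: power_add power_mult)
    \<comment> \<open>The exponents are \<open>35879 * u + 64\<close> and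
      \<open>35955 * u\<close>.\<close>
    also have "\<dots> \<le> 2 ^ (765 * u * 47)" using u by (intro power_increasing) auto
    also have "\<dots> = N ^ 47" by (simp only: N_def power_mult)
    finally show ?thesis .
  qed
  have coll2: "s\<^sup>2 * k \<le> N"
  proof -
    have "s\<^sup>2 * k = 2 ^ (105 * u)" by (simp add: s_def k_def pow)
    also have "\<dots> \<le> N" unfolding N_def by (intro power_increasing) auto
    finally show ?thesis .
  qed
  \<comment> \<open>With \<open>H = t\<close> the gain is \<open>2 ^ (u * t)\<close>, whose exponent
    is quadratic in \<open>u\<close>, against a code of size at most
    \<open>2 ^ (505 * u)\<close>.\<close>
  have c1: "64 * card C0 * (g * k) ^ t \<le> (2 ^ t) ^ t"
  proof -
    have gk: "g * k = 2 ^ (201 * u)" by (simp add: g_def k_def pow)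
    have "64 * card C0 * (g * k) ^ t \<le> 2 ^ 6 * 2 ^ (2 * t + 101 * u) * (g * k) ^ t"
      using cardC by (intro mult_le_mono1 mult_le_mono) simp_all
    also have "\<dots> = 2 ^ (6 + (2 * t + 101 * u) + 201 * u * t)"
      unfolding gk by (simp only: power_add power_mult)
    also have "\<dots> \<le> 2 ^ (t * t)"
    proof (rule power_increasing)
      have "14 * u \<le> u * u" using u by (rule mult_le_mono1)
      moreover have "u * t = 202 * (u * u)" by (simp add: t_def)
      ultimately have "6 + 505 * u \<le> u * t" using u by linarith
      moreover have "t * t = 201 * u * t + u * t" by (simp add: t_def algebra_simps)
      moreover have "2 * t = 404 * u" by (simp add: t_def)
      ultimately show "6 + (2 * t + 101 * u) + 201 * u * t \<le> t * t" by linarith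
    qed simp
    also have "\<dots> = (2 ^ t) ^ t" by (rule power_mult)
    finally show ?thesis .
  qed
  have c2: "(k * N * 2 ^ t + 1) ^ (g * k * N) \<le> 2 ^ m"
  proof -
    have "k * N * 2 ^ t = 2 ^ (1068 * u)" by (simp add: k_def N_def t_def pow)
    then have "k * N * 2 ^ t + 1 \<le> 2 ^ (1068 * u + 1)" by simp
    then have "(k * N * 2 ^ t + 1) ^ (g * k * N) \<le> (2 ^ (1068 * u + 1)) ^ (g * k * N)"
      by (rule power_mono) simp
    also have "\<dots> = 2 ^ ((1068 * u + 1) * (g * k * N))" by (rule power_mult[symmetric])
    also have "\<dots> \<le> 2 ^ m"
    proof (rule power_increasing)
      have "(1068 * u + 1) * (g * k * N) \<le> 2 ^ u * (g * k * N)" using lin by (rule mult_le_mono1)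
      also have "\<dots> = m" by (simp add: defs pow)
      finally show "(1068 * u + 1) * (g * k * N) \<le> m" .
    qed simp
    finally show ?thesis .
  qed
  have m: "m = N * W" by (simp add: m_def N_def W_def pow)
  have Npos: "0 < N" and mpos: "0 < m" by (simp_all add: N_def m_def)
  obtain e b where e: "\<And>i l. i < m \<Longrightarrow> l < k \<Longrightarrow> e i l < N"
    and b: "\<And>i. b i \<in> vecs ({..<k} \<times> {..<t})"
    and few: "\<And>S K. S \<subseteq> {..<m} \<Longrightarrow> S \<noteq> {} \<Longrightarrow> card S \<le> s \<Longrightarrow> K \<subseteq> S \<times> {..<k} \<Longrightarrow>
       (\<And>i l. (i, l) \<in> K \<Longrightarrow> \<exists>i'\<in>S. i' < i \<and> e i' l = e i l) \<Longrightarrow> 32 * card K < 47 * card S"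
    and sparse: "\<And>T. T \<subseteq> {..<k} \<times> {..<N} \<times> vecs {..<t} \<Longrightarrow> card T \<le> g * k * N \<Longrightarrow>
      2 * card {i\<in>{..<m}. \<exists>a\<in>C0. t \<le> card {l\<in>{..<k}.
        (l, e i l, (\<lambda>\<tau>. if \<tau> < t then a (l, \<tau>) + b i (l, \<tau>) else 0)) \<in> T}} < m"
    by (fact exists_good_system[OF finC tk Npos mpos coll1 coll2 c1 c2])
  define Vt where "Vt = (\<lambda>(i, \<alpha>). Src i \<alpha>) ` ({..<m} \<times> {..<k}) \<union> (\<lambda>(i, a). Lab i a) ` ({..<m} \<times> C0)
      \<union> (\<lambda>(l, j, c). Var l j c) ` ({..<k} \<times> {..<N} \<times> vecs {..<t})
      \<union> (\<lambda>(l, j, \<beta>). Trm l j \<beta>) ` ({..<k} \<times> {..<N} \<times> {..<W})"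
  have finV: "finite Vt" by (simp add: Vt_def finC)
  have "card Vt \<le> card ((\<lambda>(i, \<alpha>). Src i \<alpha>) ` ({..<m} \<times> {..<k})) + card ((\<lambda>(i, a). Lab i a) ` ({..<m} \<times> C0))
      + card ((\<lambda>(l, j, c). Var l j c) ` ({..<k} \<times> {..<N} \<times> (vecs {..<t} :: (nat \<Rightarrow> bit) set)))
      + card ((\<lambda>(l, j, \<beta>). Trm l j \<beta>) ` ({..<k} \<times> {..<N} \<times> {..<W}))"
    unfolding Vt_def by (intro order_trans[OF card_Un_le] add_mono order_refl)
  also have "\<dots> \<le> card ({..<m} \<times> {..<k}) + card ({..<m} \<times> C0)
      + card ({..<k} \<times> {..<N} \<times> (vecs {..<t} :: (nat \<Rightarrow> bit) set)) + card ({..<k} \<times> {..<N} \<times> {..<W})"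
    by (intro add_mono card_image_le) (simp_all add: finC)
  also have "\<dots> = m * k + m * card C0 + k * N * 2 ^ t + k * N * W"
    by (simp add: card_cartesian_product card_vecs)
  also have "\<dots> \<le> 2 ^ (1472 * u) + 2 ^ (1472 * u) + 2 ^ (1472 * u) + 2 ^ (1472 * u)"
  proof (intro add_mono)
    have "m * card C0 \<le> m * 2 ^ (2 * t + 101 * u)" using cardC by (rule mult_le_mono2)
    also have "\<dots> = 2 ^ (1472 * u)" by (simp add: m_def t_def pow)
    finally show "m * card C0 \<le> 2 ^ (1472 * u)" .
    have "m * k = 2 ^ (1068 * u)" by (simp add: m_def k_def pow)
    also have le: "(2::nat) ^ (1068 * u) \<le> 2 ^ (1472 * u)" by (intro power_increasing) auto
    finally show "m * k \<le> 2 ^ (1472 * u)" .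
    have "k * N * 2 ^ t = 2 ^ (1068 * u)" by (simp add: k_def N_def t_def pow)
    then show "k * N * 2 ^ t \<le> 2 ^ (1472 * u)" using le by simp
    have "k * N * W = 2 ^ (1068 * u)" by (simp add: k_def N_def W_def pow)
    then show "k * N * W \<le> 2 ^ (1472 * u)" using le by simp
  qed
  also have "\<dots> = 2 ^ (1472 * u + 2)" by (simp add: power_add)
  also have "\<dots> \<le> 2 ^ (1480 * u)" using u by (intro power_increasing) auto
  also have "\<dots> \<le> n" by (rule n)
  finally have cardV: "card Vt \<le> card {..<n}" by simp
  obtain enc where enc: "inj_on enc Vt" "enc ` Vt \<subseteq> {..<n}"
    using inj_on_iff_card_le[OF finV, of "{..<n}"] cardV by auto
  have r_large: "512 \<le> r"
  proof -
    have "(2::nat) ^ 9 \<le> 2 ^ u" using u by (intro power_increasing) auto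
    then show ?thesis by (simp add: r_def)
  qed
  \<comment> \<open>For \<open>wm = 4 * r + 8\<close> and \<open>h = 48 * wm\<close>, the required
    \<open>2 * h + wm\<close> is \<open>97 * wm\<close>.\<close>
  have s_large: "388 * r + 776 \<le> s"
  proof -
    have "s = r * r" by (simp add: s_def r_def power2_eq_square[symmetric] pow mult.commute)
    moreover have "512 * r \<le> r * r" using r_large by (rule mult_le_mono1)
    ultimately show ?thesis using r_large by linarith
  qed
  interpret dsn_gap m k t N e b C0 s "48 * (4 * r + 8)" "4 * r + 8" W r n enc Vt
  proof (unfold_locales, goal_cases)
    case (6 z)
    then show ?case by (rule dual)
  next
    case (7 S K)
    then show ?case by (rule few)
  next
    case 11
    show ?case by (rule Vt_def)
  qed (use e b C0 enc s_large in auto)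
  have "real g / 3 \<le> integrality_gap E ds r"
  proof (rule gap_ge[OF _ _ _ _ _ m kgt])
    show "2 * card {i\<in>{..<m}. \<exists>a\<in>C0. t \<le> card {l\<in>{..<k}. (l, e i l, cv i a l) \<in> T}} < m"
      if "T \<subseteq> {..<k} \<times> {..<N} \<times> vecs {..<t}" "card T \<le> g * k * N" for T
      using sparse[OF that] by (simp only: cv_def)
  qed (use u in \<open>simp_all add: k_def W_def N_def t_def\<close>)
  then have "2 ^ (100 * u) / 3 \<le> integrality_gap E ds (2 ^ u)" by (simp add: g_def r_def)
  moreover have "dsn_feasible E ds" using dsn_solution_E by (auto simp: dsn_feasible_def)
  ultimately show ?thesis using dsn_instance_E by blast
qed

theorem theorem3:
  "\<exists>c1 c2 :: real. c1 > 0 \<and> c2 > 0 \<and>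
     (\<forall>\<epsilon> :: real. 0 < \<epsilon> \<and> \<epsilon> < 1 \<longrightarrow>
        (\<exists>N :: nat. \<forall>n \<ge> N.
           \<exists>E ds. dsn_instance n E ds \<and> dsn_feasible E ds \<and>
             (\<exists>r :: nat. real r \<ge> real n powr (c1 * \<epsilon>) \<and>
                integrality_gap E ds r \<ge> real n powr (1 / 16 - c2 * \<epsilon>))))"
proof (rule exI[of _ "1 / 3000"], rule exI[of _ 1], intro conjI allI impI)
  fix \<epsilon> :: real assume \<epsilon>: "0 < \<epsilon> \<and> \<epsilon> < 1"
  obtain B :: nat where B: "B = 2 ^ 1480" by blast
  have B2: "2 \<le> B" unfolding B using power_increasing[of 1 1480 "2::nat"] by simp
  show "\<exists>N. \<forall>n\<ge>N. \<exists>E ds. dsn_instance n E ds \<and> dsn_feasible E ds \<and>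
      (\<exists>r. real n powr (1 / 3000 * \<epsilon>) \<le> real r \<and> real n powr (1 / 16 - 1 * \<epsilon>) \<le> integrality_gap E ds r)"
  proof (intro exI[of _ "B ^ 14"] allI impI)
    fix n assume n: "B ^ 14 \<le> n"
    have n1: "1 \<le> n" using n B2 by (metis le_trans one_le_power one_le_numeral)
    obtain u where u: "B ^ u \<le> n" "n < B ^ (u + 1)" using ex_power_ivl1[OF B2 n1] by blast
    have "B ^ 14 < B ^ (u + 1)" using n u(2) by simp
    then have "14 < u + 1" by (rule power_less_imp_less_exp[rotated]) (use B2 in simp)
    then have u14: "14 \<le> u" by simp
    have Bpow: "B ^ j = 2 ^ (1480 * j)" for j unfolding B by (simp only: power_mult)
    obtain E ds where E: "dsn_instance n E ds" "dsn_feasible E ds"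
      and gap: "2 ^ (100 * u) / 3 \<le> integrality_gap E ds (2 ^ u)"
      using exists_gap_instance[OF u14 u(1)[unfolded Bpow]] by blast
    have "real n \<le> real (2 ^ (1480 * (u + 1)))"
      using u(2)[unfolded Bpow] by (simp only: of_nat_le_iff less_imp_le)
    then have n_le: "real n \<le> 2 powr (1480 * (real u + 1))"
      by (simp add: powr_realpow[symmetric] algebra_simps)
    have n_powr: "real n powr x \<le> 2 powr (1480 * (real u + 1) * x)" if "0 \<le> x" for x
      using powr_mono2[OF that _ n_le] by (simp add: powr_powr)
    have "real n powr (1 / 3000 * \<epsilon>) \<le> real n powr (1 / 3000)"
      using \<epsilon> n1 by (intro powr_mono) auto
    also have "\<dots> \<le> 2 powr (1480 * (real u + 1) * (1 / 3000))" by (rule n_powr) simp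
    \<comment> \<open>The constant 1/3000 is below half of 1/1480, which compensates for
      \<open>u + 1\<close> in place of \<open>u\<close>.\<close>
    also have "\<dots> \<le> 2 powr real u" using u14 by (intro powr_mono) auto
    also have "\<dots> = real (2 ^ u)" by (simp add: powr_realpow)
    finally have r: "real n powr (1 / 3000 * \<epsilon>) \<le> real (2 ^ u)" .
    have "real n powr (1 / 16 - 1 * \<epsilon>) \<le> real n powr (1 / 16)"
      using \<epsilon> n1 by (intro powr_mono) auto
    also have "\<dots> \<le> 2 powr (1480 * (real u + 1) * (1 / 16))" by (rule n_powr) simp
    \<comment> \<open>The requirement \<open>92.5 * (u + 1) \<le> 100 * u - 2\<close> holds from
      \<open>u = 13\<close> on; subtracting 2 leaves a factor 1/4 to stay below the 1/3 of the
      gap.\<close>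
    also have "\<dots> \<le> 2 powr (real (100 * u) - 2)" using u14 by (intro powr_mono) auto
    also have "\<dots> = 2 ^ (100 * u) / 4" by (simp add: powr_diff powr_realpow[symmetric])
    also have "\<dots> \<le> 2 ^ (100 * u) / 3" by (simp add: field_simps)
    also note gap
    finally have "real n powr (1 / 16 - 1 * \<epsilon>) \<le> integrality_gap E ds (2 ^ u)" .
    with E r show "\<exists>E ds. dsn_instance n E ds \<and> dsn_feasible E ds \<and>
      (\<exists>r. real n powr (1 / 3000 * \<epsilon>) \<le> real r \<and> real n powr (1 / 16 - 1 * \<epsilon>) \<le> integrality_gap E ds r)"
      by blast
  qed
qed simp_all

end
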